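(* Let $a<1$ be real. The function $X(a, w)$, originally defined for real $w>\frac{\pi}{4}(a+|a|-2)$, can be analytically extended in $w$ to the right half-plane $\operatorname{Re}(w) > 0$. For any non-negative integer $N$, this extended function admits the expansion $$X(a,w)=w + \sum_{n = 0}^{N-1} ( - 1)^n \frac{c_n(1-a)}{2n+1}\frac{1}{w^{2n+1}} +R_N^{(X)}(a,w),$$ where the remainder term $R_N^{(X)}(a, w)$ satisfies, for $\operatorname{Re}(w)>0$, the bound $$\left| R_N^{(X)}(a, w)\right| \le \frac{c_N (1 - a)}{2N + 1}\frac{1}{|w|^{2N + 1} } \times \begin{cases} 1 & \text{if } |\arg w| \leq \frac{\pi}{4}, \\ |\csc ( 2\arg w)| & \text{if } \frac{\pi}{4} < |\arg w| < \frac{\pi}{2}. \end{cases}$$ Additionally, if $w > 0$, the remainder term $R_N^{(X)}(a, w)$ does not exceed the first neglected term $(-1)^N \frac{c_N(1-a)}{2N+1}\frac{1}{w^{2N+1}}$ in absolute value and has the same sign as it. The coefficients $c_n(1 - a)$ are monic polynomials in $1 - a$ of degree $2n + 1$ with rational coefficients, and they satisfy $c_n(1 - a) > 0$.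
   Context: $\Gamma(a,z)$ is the (upper) incomplete gamma function (principal branch). For real $a<1$ and $z>0$, the modulus function $M(a,z)>0$ and the phase function $\varphi(a,z)$ are the continuous real-valued functions of $a$ and $z$ with $$M(a,z)e^{i\varphi (a,z)} = e^{\frac{\pi}{2} i a}\, \Gamma ( a,ze^{ - \frac{\pi}{2} i} ),$$ the branch of $\varphi$ being fixed by $\lim_{z \to 0^+} \varphi (a,z) = \frac{\pi}{4}(a + |a|)$. For each fixed $a<1$, $z\mapsto\varphi(a,z)-\frac{\pi}{2}$ is a strictly increasing bijection from $(0,+\infty)$ onto $\left(\frac{\pi}{4}(a+|a|-2),+\infty\right)$, and $w\mapsto X(a,w)$ denotes its inverse function. The coefficients $c_n(1-a)$ are those of the asymptotic expansion $X(a,w) \sim w + \sum_{n = 0}^\infty ( - 1)^n \frac{c_n(1-a)}{2n+1}\frac{1}{w^{2n+1}}$ as $w\to+\infty$. Explicitly, $(-1)^{n+1}c_n(x)$ is the coefficient of $z^{-2n-2}$ in the formal series $$\left( 1 - \sum_{k=0}^\infty (-1)^k \frac{t_k(x)}{2k+1} \frac{1}{z^{2k+2}} \right)^{2n+1},$$ where the $t_k(x)$ are given by the recurrence $$t_0(x) = x, \quad t_n(x) = \frac{n+1}{n + x+1}(x)_{2n+2} - \sum_{k=1}^{n} \frac{(x)_{2k + 1}}{k + x}\, t_{n - k}(x)\quad (n\ge 1),$$ with $(x)_n=x(x+1)\cdots(x+n-1)$, $(x)_0=1$. *)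

theory Defs
  imports
    "HOL-Complex_Analysis.Complex_Analysis"
    "HOL-Computational_Algebra.Computational_Algebra"
begin

(* The integral of u powr (a-1) * exp(-u) from z to infinity, taken along the horizontal ray
   u = z + t.  For z outside (-infinity, 0] this ray does not meet the branch cut of powr, so
   this is the principal branch; on the cut itself the value is meaningless. *)
definition upper_Gamma :: "complex \<Rightarrow> complex \<Rightarrow> complex" where
  "upper_Gamma a z =
     integral {0..} (\<lambda>t. (z + of_real t) powr (a - 1) * exp (- (z + of_real t)))"

definition is_modulus_phase ::
    "(real \<Rightarrow> real \<Rightarrow> real) \<Rightarrow> (real \<Rightarrow> real \<Rightarrow> real) \<Rightarrow> bool" where
  "is_modulus_phase M \<phi> \<longleftrightarrow>
     continuous_on ({..<1} \<times> {0<..}) (\<lambda>(a, z). M a z) \<and>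
     continuous_on ({..<1} \<times> {0<..}) (\<lambda>(a, z). \<phi> a z) \<and>
     (\<forall>a<1. \<forall>z>0. M a z > 0 \<and>
        of_real (M a z) * exp (\<i> * of_real (\<phi> a z)) =
          exp (of_real (pi / 2) * \<i> * of_real a) *
          upper_Gamma (of_real a) (of_real z * exp (- (of_real (pi / 2) * \<i>)))) \<and>
     (\<forall>a<1. ((\<lambda>z. \<phi> a z) \<longlongrightarrow> pi / 4 * (a + \<bar>a\<bar>)) (at_right 0))"

(* The conditions determine the phase uniquely for a < 1 and z > 0; elsewhere its value is
   arbitrary and never used. *)
definition phase :: "real \<Rightarrow> real \<Rightarrow> real" where
  "phase = (SOME \<phi>. \<exists>M. is_modulus_phase M \<phi>)"

(* X(a,w): for a < 1 the range of the map being inverted is the interval of all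
   w > pi/4 * (a + |a| - 2); that bound is negative, so all w > 0 belong to it. *)
definition phase_inverse :: "real \<Rightarrow> real \<Rightarrow> real" where
  "phase_inverse a = the_inv_into {0<..} (\<lambda>z. phase a z - pi / 2)"

(* Only used for x = 1 - a > 0, where no denominator vanishes. *)
function t_coeff :: "real \<Rightarrow> nat \<Rightarrow> real" where
  "t_coeff x 0 = x"
| "n \<ge> 1 \<Longrightarrow> t_coeff x n =
     (real n + 1) / (real n + x + 1) * pochhammer x (2 * n + 2) -
     (\<Sum>k=1..n. pochhammer x (2 * k + 1) / (real k + x) * t_coeff x (n - k))"
  by (auto, metis One_nat_def Suc_leI neq0_conv)
termination
  by (relation "Wellfounded.measure snd") auto

(* The formal series in the base of the power contains only even powers of 1/z, so it is written
   as a power series in the variable 1/z^2; the coefficient of z^(-2n-2) is then the one of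
   index n + 1. *)
definition c_coeff :: "nat \<Rightarrow> real \<Rightarrow> real" where
  "c_coeff n x = (-1) ^ (n + 1) *
     fps_nth ((1 - fps_X * Abs_fps (\<lambda>k. (-1) ^ k * t_coeff x k / real (2 * k + 1))) ^ (2 * n + 1)) (n + 1)"

definition X_term :: "real \<Rightarrow> nat \<Rightarrow> 'a::real_normed_field \<Rightarrow> 'a" where
  "X_term a n w = (-1) ^ n * of_real (c_coeff n (1 - a) / real (2 * n + 1)) * (1 / w ^ (2 * n + 1))"

definition X_remainder :: "real \<Rightarrow> (complex \<Rightarrow> complex) \<Rightarrow> nat \<Rightarrow> complex \<Rightarrow> complex" where
  "X_remainder a F N w = F w - (w + (\<Sum>n<N. X_term a n w))"

end

theory Submission
  imports Defs "HOL-Real_Asymp.Real_Asymp"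
begin

text \<open>Put \<open>x = 1 - a > 0\<close> and let \<open>S \<zeta> = \<integral> t\<^sup>x\<^sup>-\<^sup>1 e\<^sup>-\<^sup>t / (t + \<zeta>) dt\<close> over
\<open>t > 0\<close>. The incomplete gamma function is \<open>\<zeta>\<^sup>a e\<^sup>-\<^sup>\<zeta> S \<zeta> / \<Gamma> x\<close>
(\<open>upper_Gamma_eq_Stieltjes_gamma\<close>), so its phase along \<open>\<zeta> = - \<i> z\<close> is \<open>z + Arg (S (- \<i> z))\<close>, and
the function to be inverted is \<open>h z = z - f z\<close> with
\<open>f z = Arctan (\<i> (A + B) / (A - B))\<close>, \<open>A = S (- \<i> z)\<close>, \<open>B = S (\<i> z)\<close>.
This formula makes sense for \<open>Re z > 0\<close>. There \<open>A \<cdot> cnj B\<close> is a double integral whose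
integrand has positive imaginary part, and this is equivalent to \<open>0 < Re (f z) < \<pi> / 2\<close>
(\<open>Re_phase_defect\<close>). Thus \<open>f\<close> is a positive real function: it maps the right half-plane
holomorphically into itself and is real on the positive axis.

Everything else is squeezed out of this positivity. By the Schwarz-Pick inequality the equation
\<open>z = w + f z\<close> has at most one solution for each \<open>w\<close> with \<open>Re w > 0\<close>; a solution exists
by Brouwer's theorem, since \<open>w + f z\<close> maps a rectangle into itself. Hence \<open>h\<close> has a
holomorphic inverse \<open>F\<close> on the half-plane, and \<open>p\<^sub>0 w = F w - w = f (F w)\<close> is again positive
real (\<open>inverse_phase_remainder\<close>).

The remainders are treated without an integral representation. If \<open>p\<close> is positive real and
\<open>r p r \<rightarrow> C\<close> as \<open>r \<rightarrow> \<infinity>\<close>, the half-plane form of Julia's lemma gives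
\<open>p w = C / (w + C k w)\<close> with \<open>k\<close> again positive real, one step of a continued fraction; the
degenerate case \<open>p w = C / w\<close> is excluded by \<open>r p r \<rightarrow> 0\<close> as \<open>r \<rightarrow> 0\<close>.
Since \<open>\<bar>arg (k w)\<bar> \<le> \<bar>arg w\<bar>\<close>, elementary geometry bounds
\<open>w p w / C = 1 / (1 + C k w / w)\<close> by \<open>1\<close> or \<open>\<bar>csc (2 arg w)\<bar>\<close>; and
\<open>w (C - w p w) = C\<^sup>2 / (1 / k w + C / w)\<close> is positive real too, so that the argument can be
repeated (\<open>positive_real_step\<close>). Starting from \<open>p\<^sub>0\<close>, the functions produced in this way are
the remainders multiplied by \<open>(-1)\<^sup>N w\<^sup>2\<^sup>N\<close> (\<open>remainder_bounds\<close>). The theorem therefore needs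
asymptotic information on the positive real axis only: the limits \<open>C\<close> must be the numbers
\<open>c\<^sub>N(x) / (2 N + 1)\<close>. Their positivity comes as a by-product.

On the real axis \<open>h'\<close> is a quotient of Laplace-type integrals whose expansions in \<open>1 / z\<^sup>2\<close>
have Pochhammer symbols as coefficients; the recurrence for \<open>t\<^sub>k\<close> expresses that division
(\<open>derivative_series_identity\<close>). Integrating gives the expansion of \<open>h\<close>, and Lagrange inversion
gives that of \<open>F\<close> (\<open>shifted_phase_reversion\<close>).\<close>

section \<open>Positive real functions on the right half-plane\<close>

definition right_half_plane :: "complex set" where
  "right_half_plane = {z. Re z > 0}"

text \<open>The name is that of circuit theory: such functions are the impedances of passive networks. Reality
on the positive axis is what lets a real point serve as base point in the Schwarz-Pick inequality.\<close>

definition positive_real :: "(complex \<Rightarrow> complex) \<Rightarrow> bool" where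
  "positive_real f \<longleftrightarrow> f holomorphic_on right_half_plane \<and>
     (\<forall>z. Re z > 0 \<longrightarrow> Re (f z) > 0) \<and> (\<forall>r>0. f (of_real r) \<in> \<real>)"

lemma open_right_half_plane: "open right_half_plane"
  unfolding right_half_plane_def by (rule open_halfspace_Re_gt)

lemma connected_right_half_plane: "connected right_half_plane"
  unfolding right_half_plane_def by (intro convex_connected convex_halfspace_Re_gt)

lemma norm_diff_less_norm_add_cnj:
  assumes "Re z > 0" "Re w > 0"
  shows "norm (z - w) < norm (z + cnj w)"
proof -
  have "norm (z - w) ^ 2 < norm (z + cnj w) ^ 2"
    using mult_pos_pos[OF assms] unfolding cmod_power2 by (simp add: power2_eq_square algebra_simps)
  then show ?thesis by (simp add: power2_less_imp_less)
qed

text \<open>The Schwarz lemma, transported from the disc to the half-plane by Cayley maps that send the two base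
points \<open>w\<close> and \<open>f w\<close> to the origin.\<close>

lemma Schwarz_Pick_half_plane:
  assumes hol: "f holomorphic_on right_half_plane"
    and pos: "\<And>z. Re z > 0 \<Longrightarrow> Re (f z) > 0"
    and z: "Re z > 0" and w: "Re w > 0"
  shows "norm (f z - f w) * norm (z + cnj w) \<le> norm (f z + cnj (f w)) * norm (z - w)"
proof -
  \<comment> \<open>the inverse of the Cayley map \<open>(z - w) / (z + cnj w)\<close>; it sends \<open>0\<close> to \<open>w\<close>\<close>
  define \<phi> where "\<phi> = (\<lambda>\<xi>. (w + \<xi> * cnj w) / (1 - \<xi>))"
  define g where "g = (\<lambda>\<xi>. (f (\<phi> \<xi>) - f w) / (f (\<phi> \<xi>) + cnj (f w)))"
  have ne1: "1 - \<xi> \<noteq> 0" if "norm \<xi> < 1" for \<xi> :: complex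
    using that by auto
  have re\<phi>: "Re (\<phi> \<xi>) > 0" if "norm \<xi> < 1" for \<xi>
  proof -
    have "Re ((w + \<xi> * cnj w) * cnj (1 - \<xi>)) = Re w * (1 - norm \<xi> ^ 2)"
      unfolding cmod_power2 by (simp add: power2_eq_square algebra_simps)
    moreover have "norm \<xi> ^ 2 < 1" using that by (simp add: power_less_one_iff)
    ultimately have "Re ((w + \<xi> * cnj w) * cnj (1 - \<xi>)) > 0" using w by simp
    moreover have "\<phi> \<xi> = ((w + \<xi> * cnj w) * cnj (1 - \<xi>)) / of_real (norm (1 - \<xi>) ^ 2)"
      unfolding \<phi>_def using complex_div_cnj[of "w + \<xi> * cnj w" "1 - \<xi>"] by simp
    moreover have "norm (1 - \<xi>) ^ 2 > 0" using ne1[OF that] by simp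
    ultimately show ?thesis by (simp only: Re_divide_of_real) simp
  qed
  have hol\<phi>: "\<phi> holomorphic_on ball 0 1"
    unfolding \<phi>_def by (intro holomorphic_intros) (auto dest: ne1)
  have "(f \<circ> \<phi>) holomorphic_on ball 0 1"
    by (rule holomorphic_on_compose_gen[OF hol\<phi> hol]) (auto simp: right_half_plane_def re\<phi>)
  then have holf\<phi>: "(\<lambda>\<xi>. f (\<phi> \<xi>)) holomorphic_on ball 0 1" by (simp add: o_def)
  have nz: "f u + cnj (f w) \<noteq> 0" if "Re u > 0" for u
  proof -
    have "Re (f u + cnj (f w)) > 0" using pos[OF that] pos[OF w] by simp
    then show ?thesis by (metis less_irrefl zero_complex.sel(1))
  qed
  have holg: "g holomorphic_on ball 0 1"
    unfolding g_def by (intro holomorphic_intros holf\<phi>) (auto simp: nz re\<phi>)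
  have g0: "g 0 = 0" by (simp add: g_def \<phi>_def)
  have gless: "norm (g \<xi>) < 1" if "norm \<xi> < 1" for \<xi>
    using norm_diff_less_norm_add_cnj[OF pos[OF re\<phi>[OF that]] pos[OF w]] nz[OF re\<phi>[OF that]]
    by (simp add: g_def norm_divide divide_simps)
  define \<xi> where "\<xi> = (z - w) / (z + cnj w)"
  have lt: "norm (z - w) < norm (z + cnj w)" by (rule norm_diff_less_norm_add_cnj[OF z w])
  then have zw: "z + cnj w \<noteq> 0" by auto
  have n\<xi>: "norm \<xi> < 1" using lt zw by (simp add: \<xi>_def norm_divide divide_simps)
  have wcw: "w + cnj w \<noteq> 0" using w by (auto simp: complex_eq_iff)
  have "1 - \<xi> = (w + cnj w) / (z + cnj w)" using zw by (simp add: \<xi>_def field_simps)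
  moreover have "w + \<xi> * cnj w = z * (w + cnj w) / (z + cnj w)"
    using zw by (simp add: \<xi>_def field_simps)
  ultimately have \<phi>\<xi>: "\<phi> \<xi> = z" using zw wcw by (simp add: \<phi>_def)
  have "norm (g \<xi>) \<le> norm \<xi>" by (rule Schwarz_Lemma(1)[OF holg g0 gless n\<xi>])
  moreover have "norm (g \<xi>) = norm (f z - f w) / norm (f z + cnj (f w))"
    by (simp only: g_def \<phi>\<xi> norm_divide)
  moreover have "norm \<xi> = norm (z - w) / norm (z + cnj w)"
    by (simp only: \<xi>_def norm_divide)
  ultimately show ?thesis
    using nz[OF z] zw by (simp add: divide_simps mult.commute)
qed

lemma positive_real_on_reals:
  assumes "positive_real f" "r > 0"
  shows "f (of_real r) = of_real (Re (f (of_real r)))" "Re (f (of_real r)) > 0"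
  using assms by (auto simp: positive_real_def of_real_Re)

text \<open>With a real base point \<open>r\<close>, squaring the Schwarz-Pick inequality removes all square roots and
leaves a polynomial inequality between \<open>f z\<close> and \<open>f r\<close>.\<close>

lemma positive_real_Schwarz_Pick_real:
  assumes "positive_real f" "Re z > 0" "r > 0"
  shows "(norm (f z) ^ 2 + Re (f (of_real r)) ^ 2) * r * Re z
           \<le> (norm z ^ 2 + r ^ 2) * (Re (f z) * Re (f (of_real r)))"
proof -
  define q where "q = Re (f (of_real r))"
  have q: "f (of_real r) = of_real q" using positive_real_on_reals[OF assms(1,3)] by (simp add: q_def)
  have "norm (f z - of_real q) * norm (z + of_real r) \<le> norm (f z + of_real q) * norm (z - of_real r)"
    using Schwarz_Pick_half_plane[of f z "of_real r"] assms by (simp add: positive_real_def q)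
  then have "(norm (f z - of_real q) * norm (z + of_real r)) ^ 2
           \<le> (norm (f z + of_real q) * norm (z - of_real r)) ^ 2"
    by (intro power_mono) auto
  then show ?thesis
    unfolding q_def[symmetric] power_mult_distrib cmod_power2
    by (simp add: power2_eq_square algebra_simps)
qed

text \<open>A positive real function does not increase the modulus of the argument: the inequality says
\<open>cos (arg (f z)) \<ge> cos (arg z)\<close>. The base point \<open>r = \<bar>z\<bar>\<close> is the closest one to \<open>z\<close>
in the hyperbolic metric, hence the best choice.\<close>

lemma positive_real_angle:
  assumes "positive_real f" "Re z > 0"
  shows "norm (f z) * Re z \<le> norm z * Re (f z)"
proof -
  define r where "r = norm z"
  define q where "q = Re (f (of_real r))"
  have r: "r > 0" using assms(2) by (auto simp: r_def)
  have q: "q > 0" using positive_real_on_reals[OF assms(1) r] by (simp add: q_def)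
  have "(norm (f z) ^ 2 + q ^ 2) * r * Re z \<le> (2 * r ^ 2) * (Re (f z) * q)"
    using positive_real_Schwarz_Pick_real[OF assms r] by (simp add: q_def r_def)
  moreover have "2 * norm (f z) * q * (r * Re z) \<le> (norm (f z) ^ 2 + q ^ 2) * (r * Re z)"
    using r assms(2) sum_squares_bound[of "norm (f z)" q] by (intro mult_right_mono) auto
  ultimately have "(2 * r * q) * (norm (f z) * Re z) \<le> (2 * r * q) * (r * Re (f z))"
    by (simp add: power2_eq_square mult_ac)
  then have "norm (f z) * Re z \<le> r * Re (f z)"
    using r q by (simp add: mult_le_cancel_left)
  then show ?thesis by (simp add: r_def)
qed

text \<open>On the positive axis the hyperbolic distance of \<open>r\<close> and \<open>s\<close> is \<open>\<bar>ln (r / s)\<bar>\<close>, so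
\<open>f r / f s\<close> cannot exceed \<open>s / r\<close>.\<close>

lemma positive_real_times_argument_mono:
  assumes "positive_real f" "0 < r" "r \<le> s"
  shows "r * Re (f (of_real r)) \<le> s * Re (f (of_real s))"
proof (cases "r = s")
  case False
  then have rs: "r < s" using assms by simp
  define p where "p = Re (f (of_real r))"
  define q where "q = Re (f (of_real s))"
  have s: "s > 0" using assms by simp
  have p: "f (of_real r) = of_real p" and q: "f (of_real s) = of_real q"
    using positive_real_on_reals[OF assms(1)] assms(2) s by (auto simp: p_def q_def)
  have pq: "p > 0" "q > 0" using positive_real_on_reals[OF assms(1)] assms(2) s
    by (auto simp: p_def q_def)
  have "norm (f (of_real r) - f (of_real s)) * norm (complex_of_real r + cnj (of_real s))
     \<le> norm (f (of_real r) + cnj (f (of_real s))) * norm (complex_of_real r - of_real s)"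
    using assms s by (intro Schwarz_Pick_half_plane) (auto simp: positive_real_def)
  then have "\<bar>p - q\<bar> * (r + s) \<le> (p + q) * (s - r)"
    unfolding p q complex_cnj_complex_of_real of_real_add[symmetric] of_real_diff[symmetric] norm_of_real
    using rs assms(2) s pq by simp
  moreover have "(p - q) * (r + s) \<le> \<bar>p - q\<bar> * (r + s)"
    using assms(2) s by (intro mult_right_mono) auto
  ultimately show ?thesis unfolding p_def[symmetric] q_def[symmetric] by (simp add: algebra_simps)
qed auto

lemma positive_real_cong:
  assumes "positive_real f" "\<And>z. Re z > 0 \<Longrightarrow> f z = g z"
  shows "positive_real g"
  using assms holomorphic_cong[of right_half_plane right_half_plane f g]
  by (auto simp: positive_real_def right_half_plane_def)

lemma positive_real_inverse:
  assumes "positive_real f"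
  shows "positive_real (\<lambda>z. inverse (f z))"
proof -
  have pos: "Re (f z) > 0" if "Re z > 0" for z using assms that by (simp add: positive_real_def)
  have nz: "f z \<noteq> 0" if "Re z > 0" for z using pos[OF that] by auto
  have "Re (inverse (f z)) > 0" if "Re z > 0" for z
    using pos[OF that] by (simp add: add_pos_nonneg)
  then show ?thesis
    using assms nz unfolding positive_real_def right_half_plane_def
    by (auto intro!: holomorphic_intros simp: Reals_inverse)
qed

lemma positive_real_add:
  assumes "positive_real f" "positive_real g"
  shows "positive_real (\<lambda>z. f z + g z)"
  using assms unfolding positive_real_def by (auto intro!: holomorphic_intros add_pos_pos Reals_add)

lemma positive_real_scale:
  assumes "positive_real f" "c > 0"
  shows "positive_real (\<lambda>z. of_real c * f z)"
  using assms unfolding positive_real_def by (auto intro!: holomorphic_intros Reals_mult)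

lemma positive_real_ident: "positive_real (\<lambda>z. z)"
  unfolding positive_real_def by (auto intro!: holomorphic_intros)

text \<open>Julia's lemma at infinity. It is the limit of the Schwarz-Pick inequality as the base point
\<open>r\<close> escapes to infinity, after division by \<open>r\<^sup>3\<close>.\<close>

lemma positive_real_Julia:
  assumes g: "positive_real g" and c: "c > 0"
    and lim: "((\<lambda>r. Re (g (of_real r)) / r) \<longlongrightarrow> c) at_top"
    and z: "Re z > 0"
  shows "c * Re z \<le> Re (g z)"
proof -
  define q where "q = (\<lambda>r. Re (g (of_real r)) / r)"
  have ineq: "(norm (g z) ^ 2 / r ^ 2 + q r ^ 2) * Re z \<le> (norm z ^ 2 / r ^ 2 + 1) * (Re (g z) * q r)"
    if r: "r > 0" for r
  proof -
    have "(norm (g z) ^ 2 + (r * q r) ^ 2) * r * Re z \<le> (norm z ^ 2 + r ^ 2) * (Re (g z) * (r * q r))"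
      using positive_real_Schwarz_Pick_real[OF g z r] r by (simp add: q_def)
    moreover have "(norm (g z) ^ 2 + (r * q r) ^ 2) * r * Re z
        = r ^ 3 * ((norm (g z) ^ 2 / r ^ 2 + q r ^ 2) * Re z)"
      using r by (simp add: field_simps power2_eq_square power3_eq_cube)
    moreover have "(norm z ^ 2 + r ^ 2) * (Re (g z) * (r * q r))
        = r ^ 3 * ((norm z ^ 2 / r ^ 2 + 1) * (Re (g z) * q r))"
      using r by (simp add: field_simps power2_eq_square power3_eq_cube)
    ultimately show ?thesis using r by (simp add: mult_le_cancel_left)
  qed
  have inv0: "((\<lambda>r. k / r ^ 2) \<longlongrightarrow> 0) at_top" for k :: real
    by real_asymp
  have "((\<lambda>r. (norm (g z) ^ 2 / r ^ 2 + q r ^ 2) * Re z) \<longlongrightarrow> (0 + c ^ 2) * Re z) at_top"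
    using lim unfolding q_def[symmetric] by (intro tendsto_intros inv0)
  moreover have "((\<lambda>r. (norm z ^ 2 / r ^ 2 + 1) * (Re (g z) * q r)) \<longlongrightarrow> (0 + 1) * (Re (g z) * c)) at_top"
    using lim unfolding q_def[symmetric] by (intro tendsto_intros inv0)
  moreover have "eventually (\<lambda>r. (norm (g z) ^ 2 / r ^ 2 + q r ^ 2) * Re z
       \<le> (norm z ^ 2 / r ^ 2 + 1) * (Re (g z) * q r)) at_top"
    using eventually_gt_at_top[of 0] by eventually_elim (rule ineq)
  ultimately have "(0 + c ^ 2) * Re z \<le> (0 + 1) * (Re (g z) * c)"
    by (intro tendsto_le[OF _ _ _ ]) auto
  then have "c * (c * Re z) \<le> c * Re (g z)" by (simp add: power2_eq_square mult_ac)
  then show ?thesis using c by (simp add: mult_le_cancel_left)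
qed

text \<open>If \<open>\<bar>arg m\<bar> \<le> \<bar>arg z\<bar> = \<alpha>\<close>, then \<open>m / z\<close> lies in the sector of half-angle
\<open>2 \<alpha>\<close> around the positive axis, and the distance of \<open>-1\<close> to that sector is \<open>1\<close> when
\<open>2 \<alpha> \<le> \<pi> / 2\<close> and \<open>sin (2 \<alpha>)\<close> otherwise. This is the source of the cosecant factor.\<close>

lemma norm_add_ge_of_angle:
  assumes z: "Re z > 0" and m: "norm m * Re z \<le> norm z * Re m"
  shows "norm z \<le> norm (z + m) * (if \<bar>Arg z\<bar> \<le> pi / 4 then 1 else \<bar>1 / sin (2 * Arg z)\<bar>)"
proof -
  define \<alpha> where "\<alpha> = Arg z"
  have z0: "z \<noteq> 0" using z by auto
  have Rez: "Re z = norm z * cos \<alpha>" and Imz: "Im z = norm z * sin \<alpha>"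
    using z0 by (simp_all add: \<alpha>_def cos_Arg sin_Arg)
  have nz: "norm z > 0" using z0 by simp
  have c: "cos \<alpha> > 0" using Rez z nz by (simp add: zero_less_mult_iff)
  have Rem: "norm m * cos \<alpha> \<le> Re m" using m nz unfolding Rez by (simp add: mult.left_commute)
  have Rem0: "Re m \<ge> 0" using Rem c by (meson dual_order.trans mult_nonneg_nonneg norm_ge_zero less_imp_le)
  have "(Im m) ^ 2 \<le> (norm m * sin \<alpha>) ^ 2"
  proof -
    have "(norm m * cos \<alpha>) ^ 2 \<le> (Re m) ^ 2" using Rem c by (intro power_mono) auto
    moreover have "(Re m)^2 + (Im m)^2 = norm m ^ 2" by (simp add: cmod_power2)
    moreover have "(norm m * sin \<alpha>) ^ 2 = norm m ^ 2 - (norm m * cos \<alpha>) ^ 2"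
      by (simp add: power_mult_distrib sin_squared_eq algebra_simps)
    ultimately show ?thesis by linarith
  qed
  then have Imm: "\<bar>Im m\<bar> \<le> norm m * \<bar>sin \<alpha>\<bar>"
    by (metis abs_le_square_iff abs_mult abs_norm_cancel)
  have "\<bar>sin \<alpha> * Im m\<bar> \<le> \<bar>sin \<alpha>\<bar> * (norm m * \<bar>sin \<alpha>\<bar>)"
    unfolding abs_mult by (intro mult_left_mono Imm) auto
  then have "\<bar>sin \<alpha> * Im m\<bar> \<le> norm m * (sin \<alpha>)^2"
    by (simp add: power2_eq_square algebra_simps flip: abs_mult)
  moreover have "cos \<alpha> * Re m \<ge> norm m * (cos \<alpha>)^2"
    using mult_left_mono[OF Rem, of "cos \<alpha>"] c by (simp add: power2_eq_square algebra_simps)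
  ultimately have "norm m * cos (2 * \<alpha>) \<le> cos \<alpha> * Re m + sin \<alpha> * Im m"
    unfolding cos_double by (simp add: algebra_simps)
  then have "norm z * (norm m * cos (2 * \<alpha>)) \<le> norm z * (cos \<alpha> * Re m + sin \<alpha> * Im m)"
    using nz by (intro mult_left_mono) auto
  then have "norm z * norm m * cos (2 * \<alpha>) \<le> Re z * Re m + Im z * Im m"
    by (simp add: Rez Imz algebra_simps)
  moreover have "norm (z + m) ^ 2 = norm z ^ 2 + norm m ^ 2 + 2 * (Re z * Re m + Im z * Im m)"
    unfolding cmod_power2 by (simp add: power2_eq_square algebra_simps)
  ultimately have main: "norm (z + m) ^ 2 \<ge> norm z ^ 2 + norm m ^ 2 + 2 * norm z * norm m * cos (2 * \<alpha>)"
    by (simp add: algebra_simps)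
  have \<alpha>b: "\<bar>\<alpha>\<bar> < pi / 2" using Re_Ln_pos_lt[OF z0] z by (simp add: \<alpha>_def Arg_eq_Im_Ln z0)
  show ?thesis
  proof (cases "\<bar>\<alpha>\<bar> \<le> pi / 4")
    case True
    then have "cos (2 * \<alpha>) \<ge> 0" by (intro cos_ge_zero) auto
    then have "norm (z + m) ^ 2 \<ge> norm z ^ 2" using main
      by (smt (verit) mult_nonneg_nonneg norm_ge_zero zero_le_power2)
    then have "norm z \<le> norm (z + m)" by (rule power2_le_imp_le) simp
    then show ?thesis using True by (simp add: \<alpha>_def)
  next
    case False
    have sn: "sin (2 * \<alpha>) \<noteq> 0"
    proof (cases "\<alpha> > 0")
      case True
      then have "sin (2 * \<alpha>) > 0" using \<alpha>b by (intro sin_gt_zero) auto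
      then show ?thesis by simp
    next
      case F2: False
      then have "sin (2 * (-\<alpha>)) > 0" using \<alpha>b False by (intro sin_gt_zero) auto
      then show ?thesis by simp
    qed
    have "norm z ^ 2 + norm m ^ 2 + 2 * norm z * norm m * cos (2 * \<alpha>)
       = (norm z * sin (2 * \<alpha>)) ^ 2 + (norm m + norm z * cos (2 * \<alpha>)) ^ 2"
      unfolding power2_sum power_mult_distrib sin_squared_eq[of "2 * \<alpha>"] by (simp add: algebra_simps)
    then have "(norm z * sin (2 * \<alpha>)) ^ 2 \<le> norm (z + m) ^ 2" using main
      by (smt (verit) zero_le_power2)
    then have "norm z * \<bar>sin (2 * \<alpha>)\<bar> \<le> norm (z + m)"
      unfolding abs_le_square_iff[symmetric] by (simp add: abs_mult)
    then show ?thesis using False sn by (simp add: \<alpha>_def divide_simps mult.commute)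
  qed
qed

section \<open>Remainders generated by a positive real function\<close>

text \<open>One step of the continued fraction. Julia's lemma for \<open>1 / p\<close> shows that
\<open>k z = 1 / p z - z / C\<close> has nonnegative real part. By the open mapping theorem the real part is
positive unless \<open>k\<close> vanishes identically; but then \<open>p z = C / z\<close>, which the behaviour of
\<open>r p r\<close> at the origin excludes. The same behaviour is inherited by \<open>z (C - z p z)\<close>, so the step
can be iterated.\<close>

lemma positive_real_step:
  assumes p: "positive_real p"
    and at_0: "((\<lambda>r. r * Re (p (of_real r))) \<longlongrightarrow> 0) (at_right 0)"
    and at_inf: "((\<lambda>r. r * Re (p (of_real r))) \<longlongrightarrow> C) at_top"
  shows "C > 0"
    and "\<exists>k. positive_real k \<and> (\<forall>z. Re z > 0 \<longrightarrow> z + of_real C * k z \<noteq> 0 \<and>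
               p z = of_real C / (z + of_real C * k z))"
    and "positive_real (\<lambda>z. z * (of_real C - z * p z))"
    and "((\<lambda>r. r * Re (of_real r * (of_real C - of_real r * p (of_real r)))) \<longlongrightarrow> 0) (at_right 0)"
proof -
  have hol: "p holomorphic_on right_half_plane" using p by (simp add: positive_real_def)
  have pos: "Re (p z) > 0" if "Re z > 0" for z using p that by (simp add: positive_real_def)
  have nz: "p z \<noteq> 0" if "Re z > 0" for z using pos[OF that] by auto
  \<comment> \<open>\<open>r p r\<close> increases with \<open>r\<close>, so its limit is at least its value at \<open>r = 1\<close>\<close>
  have "1 * Re (p (of_real 1)) \<le> C"
  proof (rule tendsto_lowerbound[OF at_inf])
    show "\<forall>\<^sub>F r in at_top. 1 * Re (p (of_real 1)) \<le> r * Re (p (of_real r))"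
      using eventually_ge_at_top[of "1::real"]
      by eventually_elim (rule positive_real_times_argument_mono[OF p], auto)
  qed auto
  then show C: "C > 0" using pos[of 1] by simp
  define k where "k = (\<lambda>z. inverse (p z) - z / of_real C)"
  have ip: "positive_real (\<lambda>z. inverse (p z))" by (rule positive_real_inverse[OF p])
  have "((\<lambda>r. inverse (r * Re (p (of_real r)))) \<longlongrightarrow> inverse C) at_top"
    using at_inf C by (intro tendsto_inverse) auto
  moreover have "Re (inverse (p (of_real r))) / r = inverse (r * Re (p (of_real r)))" if "r > 0" for r
  proof -
    have q: "p (of_real r) = of_real (Re (p (of_real r)))" by (rule positive_real_on_reals(1)[OF p that])
    show ?thesis by (subst (1) q) (simp add: field_simps flip: of_real_inverse)
  qed
  then have "\<forall>\<^sub>F r in at_top. inverse (r * Re (p (of_real r))) = Re (inverse (p (of_real r))) / r"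
    by (intro eventually_mono[OF eventually_gt_at_top[of 0]]) simp
  ultimately have "((\<lambda>r. Re (inverse (p (of_real r))) / r) \<longlongrightarrow> inverse C) at_top"
    by (rule Lim_transform_eventually)
  note lim_inv = this
  have "0 < inverse C" using C by simp
  note Julia = positive_real_Julia[OF ip this lim_inv]
  then have kge: "Re (k z) \<ge> 0" if "Re z > 0" for z
    using Julia[OF that] unfolding k_def minus_complex.sel Re_divide_of_real
    by (simp only: divide_inverse mult.commute)
  have holk: "k holomorphic_on right_half_plane"
    unfolding k_def using C by (intro holomorphic_intros hol) (auto simp: nz right_half_plane_def)
  have kreal: "k (of_real r) \<in> \<real>" if "r > 0" for r
    using p that unfolding k_def positive_real_def by (auto intro!: Reals_diff Reals_divide Reals_inverse)
  have k_ne: "\<exists>z. Re z > 0 \<and> k z \<noteq> 0"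
  proof (rule ccontr)
    assume "\<not> ?thesis"
    then have k0: "inverse (p (of_real r)) = of_real r / of_real C" if "r > 0" for r
      using that by (simp add: k_def)
    have "r * Re (p (of_real r)) = C" if "r > 0" for r
    proof -
      have "p (of_real r) = of_real (C / r)"
        using arg_cong[OF k0[OF that], of inverse] by simp
      then show ?thesis using that by simp
    qed
    then have "eventually (\<lambda>r. r * Re (p (of_real r)) = C) (at_right 0)"
      by (auto simp: eventually_at_right_less intro: eventually_mono[OF eventually_at_right_less])
    then have "((\<lambda>r. r * Re (p (of_real r))) \<longlongrightarrow> C) (at_right 0)"
      by (rule tendsto_eventually)
    with at_0 have "C = 0" by (intro tendsto_unique[OF _ _ at_0]) auto
    with C show False by simp
  qed
  have kpos: "Re (k z) > 0" if z: "Re z > 0" for z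
  proof (rule ccontr)
    assume "\<not> Re (k z) > 0"
    then have z0: "Re (k z) = 0" using kge[OF z] by simp
    have "k constant_on right_half_plane"
    proof (rule ccontr)
      assume nc: "\<not> k constant_on right_half_plane"
      have "open (k ` right_half_plane)"
        by (rule open_mapping_thm[OF holk open_right_half_plane connected_right_half_plane
              open_right_half_plane order_refl nc])
      moreover have "k z \<in> k ` right_half_plane" using z by (simp add: right_half_plane_def)
      ultimately obtain e where e: "e > 0" "ball (k z) e \<subseteq> k ` right_half_plane"
        using open_contains_ball by blast
      \<comment> \<open>a value with negative real part would be attained\<close>
      have "k z - of_real (e / 2) \<in> ball (k z) e" using e by (simp add: dist_norm)
      then have "k z - of_real (e / 2) \<in> k ` right_half_plane" using e(2) by blast
      then obtain u where "u \<in> right_half_plane" "k z - of_real (e / 2) = k u" by blast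
      then have "Re u > 0" "k u = k z - of_real (e / 2)" by (simp_all add: right_half_plane_def)
      then show False using kge[of u] z0 e(1) by simp
    qed
    then obtain c where c: "k u = c" if "Re u > 0" for u
      by (auto simp: constant_on_def right_half_plane_def)
    then have "c \<in> \<real>" using kreal[of 1] by simp
    then have "c = 0" using z0 c[OF z] by (simp add: complex_eq_iff complex_is_Real_iff)
    then show False using k_ne c by auto
  qed
  have kpr: "positive_real k" using holk kpos kreal by (simp add: positive_real_def)
  have repr: "z + of_real C * k z \<noteq> 0" "p z = of_real C / (z + of_real C * k z)" if z: "Re z > 0" for z
  proof -
    have "Re (z + of_real C * k z) > 0" using z kpos[OF z] C by (simp add: add_pos_pos)
    then show 1: "z + of_real C * k z \<noteq> 0" by (metis less_irrefl zero_complex.sel(1))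
    have "z + of_real C * k z = of_real C * inverse (p z)" using C by (simp add: k_def algebra_simps)
    then have "p z * (z + of_real C * k z) = of_real C" using nz[OF z] by simp
    then show "p z = of_real C / (z + of_real C * k z)" using 1 by (simp add: eq_divide_eq)
  qed
  then show "\<exists>k. positive_real k \<and> (\<forall>z. Re z > 0 \<longrightarrow> z + of_real C * k z \<noteq> 0 \<and>
               p z = of_real C / (z + of_real C * k z))"
    using kpr by blast
  have "positive_real (\<lambda>z. of_real (C ^ 2) * inverse (inverse (k z) + of_real C * inverse z))"
    using C by (intro positive_real_scale positive_real_inverse positive_real_add kpr positive_real_ident) auto
  then show "positive_real (\<lambda>z. z * (of_real C - z * p z))"
  proof (rule positive_real_cong)
    fix z :: complex assume z: "Re z > 0"
    have kz: "k z \<noteq> 0" "z \<noteq> 0" using kpos[OF z] z by auto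
    have "inverse (k z) + of_real C * inverse z = (z + of_real C * k z) / (k z * z)"
      using kz by (simp add: field_simps)
    then have "of_real (C ^ 2) * inverse (inverse (k z) + of_real C * inverse z)
        = of_real C ^ 2 * k z * z / (z + of_real C * k z)" by simp
    also have "\<dots> = z * (of_real C - z * (of_real C / (z + of_real C * k z)))"
      using repr(1)[OF z] by (simp add: field_simps power2_eq_square)
    finally show "of_real (C ^ 2) * inverse (inverse (k z) + of_real C * inverse z) = z * (of_real C - z * p z)"
      using repr(2)[OF z] by simp
  qed
  have "((\<lambda>r. r * (r * C) - (r * r) * (r * Re (p (of_real r)))) \<longlongrightarrow> 0 * (0 * C) - (0 * 0) * 0) (at_right 0)"
    by (intro tendsto_intros at_0)
  then show "((\<lambda>r. r * Re (of_real r * (of_real C - of_real r * p (of_real r)))) \<longlongrightarrow> 0) (at_right 0)"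
    by (simp add: algebra_simps)
qed

lemma positive_real_sector_bound:
  assumes p: "positive_real p"
    and at_0: "((\<lambda>r. r * Re (p (of_real r))) \<longlongrightarrow> 0) (at_right 0)"
    and at_inf: "((\<lambda>r. r * Re (p (of_real r))) \<longlongrightarrow> C) at_top"
    and z: "Re z > 0"
  shows "norm (p z) \<le> C / norm z * (if \<bar>Arg z\<bar> \<le> pi / 4 then 1 else \<bar>1 / sin (2 * Arg z)\<bar>)"
proof -
  note C = positive_real_step(1)[OF p at_0 at_inf]
  obtain k where k: "positive_real k" and nz: "z + of_real C * k z \<noteq> 0"
    and pz: "p z = of_real C / (z + of_real C * k z)"
    using positive_real_step(2)[OF p at_0 at_inf] z by blast
  define B where "B = (if \<bar>Arg z\<bar> \<le> pi / 4 then 1 else \<bar>1 / sin (2 * Arg z)\<bar>)"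
  have ck: "positive_real (\<lambda>z. of_real C * k z)" by (rule positive_real_scale[OF k C])
  have "norm z \<le> norm (z + of_real C * k z) * B"
    unfolding B_def by (rule norm_add_ge_of_angle[OF z positive_real_angle[OF ck z]])
  moreover have "norm z > 0" "norm (z + of_real C * k z) > 0" using z nz by auto
  ultimately have "1 / norm (z + of_real C * k z) \<le> B / norm z"
    by (simp add: divide_simps mult.commute)
  then have "C * (1 / norm (z + of_real C * k z)) \<le> C * (B / norm z)" using C by (intro mult_left_mono) auto
  then show ?thesis unfolding B_def[symmetric] by (simp add: pz norm_divide C less_imp_le)
qed

text \<open>The functions \<open>(-1)\<^sup>N w\<^sup>2\<^sup>N R\<^sub>N w\<close> are linked by \<open>p \<mapsto> w (C - w p)\<close>, so they are all
positive real by \<open>positive_real_step\<close>. The sign and the size of each remainder can then be read off.\<close>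

lemma remainder_bounds:
  fixes F :: "complex \<Rightarrow> complex" and C :: "nat \<Rightarrow> real"
  defines "R \<equiv> \<lambda>N w. F w - (w + (\<Sum>n<N. (-1) ^ n * of_real (C n) / w ^ (2 * n + 1)))"
  assumes pr: "positive_real (\<lambda>w. F w - w)"
    and at_0: "((\<lambda>r. r * Re (F (of_real r) - of_real r)) \<longlongrightarrow> 0) (at_right 0)"
    and at_inf: "\<And>N. ((\<lambda>r. (-1) ^ N * r ^ (2 * N + 1) * Re (R N (of_real r))) \<longlongrightarrow> C N) at_top"
  shows "C N > 0"
    and "Re w > 0 \<Longrightarrow> norm (R N w) \<le> C N * (1 / norm w ^ (2 * N + 1)) *
               (if \<bar>Arg w\<bar> \<le> pi / 4 then 1 else \<bar>1 / sin (2 * Arg w)\<bar>)"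
    and "r > 0 \<Longrightarrow> R N (of_real r) \<in> \<real> \<and> 0 < (-1) ^ N * Re (R N (of_real r))"
proof -
  define p where "p = (\<lambda>N w. (-1) ^ N * w ^ (2 * N) * R N w)"
  have p_Suc: "p (Suc N) w = w * (of_real (C N) - w * p N w)" if "w \<noteq> 0" for N w
  proof -
    have "R (Suc N) w = R N w - (-1) ^ N * of_real (C N) / w ^ (2 * N + 1)" by (simp add: R_def)
    then have eq: "w ^ (2 * N + 1) * R (Suc N) w = w ^ (2 * N + 1) * R N w - (-1) ^ N * of_real (C N)"
      using that by (simp add: field_simps)
    have "p (Suc N) w = - ((-1) ^ N * w * (w ^ (2 * N + 1) * R (Suc N) w))"
      by (simp add: p_def mult_ac)
    also have "\<dots> = w * (of_real (C N) - w * p N w)"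
      unfolding eq p_def by (cases "even N") (simp_all add: algebra_simps)
    finally show ?thesis .
  qed
  have R_real: "Re (R N (of_real r)) = Re (p N (of_real r)) * (-1) ^ N / r ^ (2 * N)" if "r > 0" for r N
  proof -
    have "p N (of_real r) = of_real ((-1) ^ N * r ^ (2 * N)) * R N (of_real r)" by (simp add: p_def)
    then have "Re (p N (of_real r)) = (-1) ^ N * r ^ (2 * N) * Re (R N (of_real r))"
      by (metis scaleR_complex.sel(1) scaleR_conv_of_real)
    then show ?thesis using that by (cases "even N") (auto simp: field_simps)
  qed
  have inf: "((\<lambda>r. r * Re (p N (of_real r))) \<longlongrightarrow> C N) at_top" for N
  proof (rule Lim_transform_eventually[OF at_inf[of N]])
    show "\<forall>\<^sub>F r in at_top. (- 1) ^ N * r ^ (2 * N + 1) * Re (R N (of_real r)) = r * Re (p N (of_real r))"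
      using eventually_gt_at_top[of 0]
    proof eventually_elim
      case (elim r)
      show ?case unfolding R_real[OF elim] using elim by (cases "even N") auto
    qed
  qed
  have main: "positive_real (p N) \<and> ((\<lambda>r. r * Re (p N (of_real r))) \<longlongrightarrow> 0) (at_right 0)" for N
  proof (induction N)
    case 0
    have "p 0 = (\<lambda>w. F w - w)" by (auto simp: p_def R_def)
    then show ?case using pr at_0 by simp
  next
    case (Suc N)
    note step = positive_real_step[OF conjunct1[OF Suc] conjunct2[OF Suc] inf]
    have "positive_real (p (Suc N))"
      by (rule positive_real_cong[OF step(3)]) (subst p_Suc, auto)
    moreover have "((\<lambda>r. r * Re (p (Suc N) (of_real r))) \<longlongrightarrow> 0) (at_right 0)"
      by (rule Lim_transform_eventually[OF step(4)])
         (auto simp: p_Suc intro: eventually_mono[OF eventually_at_right_less])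
    ultimately show ?case by blast
  qed
  note prN = conjunct1[OF main] and zN = conjunct2[OF main]
  show "C N > 0" by (rule positive_real_step(1)[OF prN zN inf])
  have R_eq: "R N w = (-1) ^ N * p N w / w ^ (2 * N)" if "w \<noteq> 0" for w
    using that by (cases "even N") (auto simp: p_def)
  show "norm (R N w) \<le> C N * (1 / norm w ^ (2 * N + 1)) *
               (if \<bar>Arg w\<bar> \<le> pi / 4 then 1 else \<bar>1 / sin (2 * Arg w)\<bar>)" if w: "Re w > 0"
  proof -
    define B where "B = (if \<bar>Arg w\<bar> \<le> pi / 4 then 1 else \<bar>1 / sin (2 * Arg w)\<bar>)"
    have w0: "w \<noteq> 0" using w by auto
    have "norm (p N w) \<le> C N / norm w * B"
      unfolding B_def by (rule positive_real_sector_bound[OF prN zN inf w])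
    then have "norm (p N w) / norm w ^ (2 * N) \<le> C N / norm w * B / norm w ^ (2 * N)"
      by (intro divide_right_mono) auto
    then show ?thesis unfolding B_def[symmetric]
      by (simp add: R_eq[OF w0] norm_mult norm_divide norm_power mult_ac)
  qed
  show "R N (of_real r) \<in> \<real> \<and> 0 < (-1) ^ N * Re (R N (of_real r))" if r: "r > 0"
  proof
    have "p N (of_real r) \<in> \<real>" using prN r by (simp add: positive_real_def)
    then show "R N (of_real r) \<in> \<real>" using R_eq[of "of_real r"] r
      by (auto intro!: Reals_mult Reals_divide Reals_power)
    have "Re (p N (of_real r)) > 0" by (rule positive_real_on_reals(2)[OF prN r])
    then show "0 < (-1) ^ N * Re (R N (of_real r))"
      unfolding R_real[OF r] using r by (cases "even N") auto
  qed
qed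

section \<open>The Stieltjes transform of the gamma density\<close>

definition gamma_weight :: "real \<Rightarrow> real \<Rightarrow> real" where
  "gamma_weight x t = (if t > 0 then t powr (x - 1) * exp (- t) else 0)"

definition gamma_measure :: "real \<Rightarrow> real measure" where
  "gamma_measure x = density lborel (\<lambda>t. ennreal (gamma_weight x t))"

text \<open>Integrating against a measure instead of a density keeps the weight out of the estimates: every
kernel that is bounded on the positive axis is integrable.\<close>

definition Stieltjes_gamma :: "real \<Rightarrow> complex \<Rightarrow> complex" where
  "Stieltjes_gamma x \<zeta> = (LINT t|gamma_measure x. 1 / (of_real t + \<zeta>))"

lemma gamma_weight_nonneg: "gamma_weight x t \<ge> 0"
  by (simp add: gamma_weight_def)

lemma gamma_weight_measurable [measurable]: "gamma_weight x \<in> borel_measurable borel"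
  unfolding gamma_weight_def by measurable

lemma sets_gamma_measure [measurable_cong]: "sets (gamma_measure x) = sets borel"
  by (simp add: gamma_measure_def)

lemma integral_gamma_measure:
  fixes f :: "real \<Rightarrow> 'a::{banach, second_countable_topology}"
  assumes [measurable]: "f \<in> borel_measurable borel"
  shows "(LINT t|gamma_measure x. f t) = (LINT t|lborel. gamma_weight x t *\<^sub>R f t)"
  unfolding gamma_measure_def by (rule integral_density) (auto simp: gamma_weight_nonneg)

lemma integrable_gamma_measure_iff:
  fixes f :: "real \<Rightarrow> 'a::{banach, second_countable_topology}"
  assumes [measurable]: "f \<in> borel_measurable borel"
  shows "integrable (gamma_measure x) f \<longleftrightarrow> integrable lborel (\<lambda>t. gamma_weight x t *\<^sub>R f t)"
  unfolding gamma_measure_def by (rule integrable_density) (auto simp: gamma_weight_nonneg)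

lemma AE_gamma_measure: "AE t in gamma_measure x. t > 0"
  unfolding gamma_measure_def by (subst AE_density) (auto simp: gamma_weight_def)

lemma gamma_weight_has_bochner_integral:
  assumes "x > 0"
  shows "has_bochner_integral lborel (gamma_weight x) (Gamma x)"
proof -
  have "((\<lambda>t. if t \<in> {0..} then t powr (x - 1) / exp t else 0) has_integral Gamma x) UNIV"
    using Gamma_integral_real[OF assms] by (simp only: has_integral_restrict_UNIV)
  then have "(gamma_weight x has_integral Gamma x) UNIV"
    by (rule has_integral_spike[of "{0}", rotated 2])
       (auto simp: gamma_weight_def exp_minus field_simps)
  then have "integral\<^sup>N lborel (gamma_weight x) = Gamma x"
    by (intro nn_integral_has_integral_lborel) (auto simp: gamma_weight_nonneg)
  then show ?thesis
    by (intro has_bochner_integral_nn_integral) (auto simp: gamma_weight_nonneg Gamma_real_nonneg assms less_imp_le)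
qed

lemma finite_measure_gamma_measure:
  assumes "x > 0"
  shows "finite_measure (gamma_measure x)"
proof -
  have "emeasure (gamma_measure x) (space (gamma_measure x)) = integral\<^sup>N lborel (gamma_weight x)"
    unfolding gamma_measure_def by (subst emeasure_density) auto
  also have "\<dots> = Gamma x"
    using gamma_weight_has_bochner_integral[OF assms]
    by (simp add: nn_integral_eq_integral has_bochner_integral_iff gamma_weight_nonneg)
  finally show ?thesis by (intro finite_measureI) simp
qed

lemma gamma_weight_times_power: "gamma_weight x t * t ^ n = gamma_weight (x + real n) t"
  by (auto simp: gamma_weight_def powr_add powr_realpow[symmetric] algebra_simps powr_diff)

lemma gamma_measure_moment:
  assumes "x > 0"
  shows "has_bochner_integral (gamma_measure x) (\<lambda>t. t ^ n) (Gamma (x + real n))"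
proof -
  have "has_bochner_integral lborel (gamma_weight (x + real n)) (Gamma (x + real n))"
    by (rule gamma_weight_has_bochner_integral) (use assms in auto)
  then show ?thesis
    by (simp add: has_bochner_integral_iff integral_gamma_measure integrable_gamma_measure_iff
        gamma_weight_times_power)
qed

lemma integrable_gamma_bounded:
  fixes f :: "real \<Rightarrow> 'a::{banach, second_countable_topology}"
  assumes x: "x > 0" and [measurable]: "f \<in> borel_measurable borel"
    and bd: "\<And>t. t > 0 \<Longrightarrow> norm (f t) \<le> B"
  shows "integrable (gamma_measure x) f" "norm (LINT t|gamma_measure x. f t) \<le> Gamma x * B"
proof -
  interpret finite_measure "gamma_measure x" by (rule finite_measure_gamma_measure[OF x])
  have ae: "AE t in gamma_measure x. norm (f t) \<le> B"
    using AE_gamma_measure by eventually_elim (rule bd)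
  show int: "integrable (gamma_measure x) f"
    by (rule integrable_const_bound[OF ae]) measurable
  have "norm (LINT t|gamma_measure x. f t) \<le> (LINT t|gamma_measure x. norm (f t))"
    by (rule integral_norm_bound)
  also have "\<dots> \<le> (LINT t|gamma_measure x. B)"
    by (intro integral_mono_AE integrable_norm int ae) auto
  also have "(LINT t|gamma_measure x. B) = Gamma x * B"
    using gamma_measure_moment[OF x, of 0] by (simp add: has_bochner_integral_iff)
  finally show "norm (LINT t|gamma_measure x. f t) \<le> Gamma x * B" .
qed

lemma FTC_half_line:
  fixes F f :: "real \<Rightarrow> complex"
  assumes F: "\<And>t. t > 0 \<Longrightarrow> (F has_vector_derivative f t) (at t)"
    and f: "\<And>t. t > 0 \<Longrightarrow> isCont f t"
    and int: "set_integrable lborel {0<..} f"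
    and A: "(F \<longlongrightarrow> A) (at_right 0)" and B: "(F \<longlongrightarrow> B) at_top"
  shows "(LBINT t:{0<..}. f t) = B - A"
proof -
  have "einterval 0 \<infinity> = {0::real<..}" by (auto simp: einterval_def zero_ereal_def)
  then have "(LBINT t=0..\<infinity>. f t) = B - A"
    using assms by (intro interval_integral_FTC_integrable)
      (auto simp: zero_ereal_def ereal_tendsto_simps1)
  then show ?thesis by (simp add: interval_lebesgue_integral_0_infty)
qed

lemma norm_of_real_add_ge:
  fixes \<zeta> :: complex
  assumes "\<zeta> \<notin> \<real>\<^sub>\<le>\<^sub>0" "t \<ge> 0"
  shows "norm (of_real t + \<zeta>) \<ge> (if Re \<zeta> \<ge> 0 then norm \<zeta> else \<bar>Im \<zeta>\<bar>)"
proof (cases "Re \<zeta> \<ge> 0")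
  case True
  then have "norm (of_real t + \<zeta>) ^ 2 \<ge> norm \<zeta> ^ 2"
    unfolding cmod_power2 using assms(2) by (auto intro!: power_mono)
  then have "norm (of_real t + \<zeta>) \<ge> norm \<zeta>" by (rule power2_le_imp_le) simp
  then show ?thesis using True by simp
next
  case False
  then show ?thesis using abs_Im_le_cmod[of "of_real t + \<zeta>"] by simp
qed

text \<open>Off the cut the kernel \<open>1 / (t + \<zeta>)\<close> is bounded uniformly in \<open>t\<close>; this is all that is needed
for integrability and for differentiation under the integral sign.\<close>

lemma kernel_lower_bound:
  fixes \<zeta> :: complex
  assumes "\<zeta> \<notin> \<real>\<^sub>\<le>\<^sub>0"
  shows "\<exists>\<delta>>0. \<forall>t>0. \<delta> \<le> norm (of_real t + \<zeta>)"
proof (intro exI conjI allI impI)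
  show "(if Re \<zeta> \<ge> 0 then norm \<zeta> else \<bar>Im \<zeta>\<bar>) > 0"
    using assms by (auto simp: complex_nonpos_Reals_iff)
  show "\<And>t. t > 0 \<Longrightarrow> norm (of_real t + \<zeta>) \<ge> (if Re \<zeta> \<ge> 0 then norm \<zeta> else \<bar>Im \<zeta>\<bar>)"
    using norm_of_real_add_ge[OF assms] by simp
qed

lemma integrable_kernel:
  fixes \<zeta> :: complex
  assumes x: "x > 0" and \<zeta>: "\<zeta> \<notin> \<real>\<^sub>\<le>\<^sub>0"
  shows "integrable (gamma_measure x) (\<lambda>t. 1 / (of_real t + \<zeta>) ^ n)"
proof -
  obtain \<delta> where d: "\<delta> > 0" "\<And>t. t > 0 \<Longrightarrow> norm (of_real t + \<zeta>) \<ge> \<delta>"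
    using kernel_lower_bound[OF \<zeta>] by blast
  have "norm (1 / (of_real t + \<zeta>) ^ n) \<le> 1 / \<delta> ^ n" if "t > 0" for t
    using d(1) d(2)[OF that] by (simp add: norm_divide norm_power frac_le power_mono)
  then show ?thesis by (intro integrable_gamma_bounded[OF x]) auto
qed

lemma norm_Stieltjes_gamma_le:
  fixes \<zeta> :: complex
  assumes x: "x > 0" and \<zeta>: "Re \<zeta> \<ge> 0" "\<zeta> \<noteq> 0"
  shows "norm (Stieltjes_gamma x \<zeta>) \<le> Gamma x / norm \<zeta>"
proof -
  have \<zeta>': "\<zeta> \<notin> \<real>\<^sub>\<le>\<^sub>0" using \<zeta> by (auto simp: complex_nonpos_Reals_iff complex_eq_iff)
  have "norm (1 / (of_real t + \<zeta>)) \<le> 1 / norm \<zeta>" if "t > 0" for t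
    using norm_of_real_add_ge[OF \<zeta>', of t] that \<zeta> by (simp add: norm_divide frac_le)
  then have "norm (Stieltjes_gamma x \<zeta>) \<le> Gamma x * (1 / norm \<zeta>)"
    unfolding Stieltjes_gamma_def by (intro integrable_gamma_bounded[OF x]) auto
  then show ?thesis by simp
qed

text \<open>The difference quotient differs from the candidate derivative by the integral of
\<open>(\<xi> - \<zeta>) / ((t + \<xi>) (t + \<zeta>)\<^sup>2)\<close>, which the lower bound for the kernels makes
\<open>O(\<xi> - \<zeta>)\<close>.\<close>

lemma has_field_derivative_Stieltjes_gamma_integral:
  fixes \<zeta> :: complex
  assumes x: "x > 0" and \<zeta>: "\<zeta> \<notin> \<real>\<^sub>\<le>\<^sub>0"
  shows "(Stieltjes_gamma x has_field_derivative
           - (LINT t|gamma_measure x. 1 / (of_real t + \<zeta>) ^ 2)) (at \<zeta>)"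
proof -
  define D where "D = - (LINT t|gamma_measure x. 1 / (of_real t + \<zeta>) ^ 2)"
  obtain \<delta> where d: "\<delta> > 0" "\<And>t. t > 0 \<Longrightarrow> norm (of_real t + \<zeta>) \<ge> \<delta>"
    using kernel_lower_bound[OF \<zeta>] by blast
  have bound: "norm ((Stieltjes_gamma x \<xi> - Stieltjes_gamma x \<zeta>) / (\<xi> - \<zeta>) - D)
      \<le> Gamma x * (2 / \<delta> ^ 3) * norm (\<xi> - \<zeta>)"
    if \<xi>: "\<xi> \<notin> \<real>\<^sub>\<le>\<^sub>0" "\<xi> \<noteq> \<zeta>" "norm (\<xi> - \<zeta>) < \<delta> / 2" for \<xi>
  proof -
    have d\<xi>: "norm (of_real t + \<xi>) \<ge> \<delta> / 2" if "t > 0" for t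
    proof -
      have "norm (of_real t + \<zeta>) \<le> norm (of_real t + \<xi>) + norm (\<xi> - \<zeta>)"
        using norm_triangle_ineq4[of "of_real t + \<xi>" "\<xi> - \<zeta>"] by simp
      then show ?thesis using d(2)[OF that] \<xi>(3) by linarith
    qed
    have eq: "(1 / (of_real t + \<xi>) - 1 / (of_real t + \<zeta>)) / (\<xi> - \<zeta>) + 1 / (of_real t + \<zeta>) ^ 2
        = (\<xi> - \<zeta>) / ((of_real t + \<xi>) * (of_real t + \<zeta>) ^ 2)" if "t > 0" for t
    proof -
      have "of_real t + \<xi> \<noteq> 0" "of_real t + \<zeta> \<noteq> 0" "\<xi> - \<zeta> \<noteq> 0" using d(2)[OF that] d\<xi>[OF that] d(1) \<xi>(2) by auto
      then show ?thesis by (simp add: divide_simps) (simp add: algebra_simps power2_eq_square)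
    qed
    have int: "integrable (gamma_measure x) (\<lambda>t. 1 / (of_real t + \<xi>))"
      "integrable (gamma_measure x) (\<lambda>t. 1 / (of_real t + \<zeta>))"
      "integrable (gamma_measure x) (\<lambda>t. 1 / (of_real t + \<zeta>) ^ 2)"
      using integrable_kernel[OF x \<xi>(1), of 1] integrable_kernel[OF x \<zeta>, of 1]
        integrable_kernel[OF x \<zeta>, of 2] by simp_all
    have "(Stieltjes_gamma x \<xi> - Stieltjes_gamma x \<zeta>) / (\<xi> - \<zeta>) - D
      = (LINT t|gamma_measure x. (1 / (of_real t + \<xi>) - 1 / (of_real t + \<zeta>)) / (\<xi> - \<zeta>)
            + 1 / (of_real t + \<zeta>) ^ 2)"
      unfolding D_def Stieltjes_gamma_def diff_minus_eq_add
      by (intro has_bochner_integral_integral_eq[symmetric] has_bochner_integral_add has_bochner_integral_diff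
        has_bochner_integral_divide_zero has_bochner_integral_integrable int)
    also have "norm \<dots> \<le> Gamma x * (2 / \<delta> ^ 3 * norm (\<xi> - \<zeta>))"
    proof (rule integrable_gamma_bounded[OF x])
      fix t :: real assume t: "t > 0"
      have "\<delta> / 2 * \<delta> ^ 2 \<le> norm (of_real t + \<xi>) * norm (of_real t + \<zeta>) ^ 2"
        using d(1) d(2)[OF t] d\<xi>[OF t] by (intro mult_mono power_mono) auto
      then have "norm (\<xi> - \<zeta>) / (norm (of_real t + \<xi>) * norm (of_real t + \<zeta>) ^ 2)
          \<le> norm (\<xi> - \<zeta>) / (\<delta> / 2 * \<delta> ^ 2)"
        using d(1) by (intro frac_le) auto
      also have "\<dots> = 2 / \<delta> ^ 3 * norm (\<xi> - \<zeta>)" by (simp add: power2_eq_square power3_eq_cube mult.assoc)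
      finally show "norm ((1 / (of_real t + \<xi>) - 1 / (of_real t + \<zeta>)) / (\<xi> - \<zeta>) + 1 / (of_real t + \<zeta>) ^ 2)
           \<le> 2 / \<delta> ^ 3 * norm (\<xi> - \<zeta>)"
        unfolding eq[OF t] by (simp add: norm_divide norm_mult norm_power)
    qed measurable
    finally show ?thesis by (simp add: mult_ac)
  qed
  have "((\<lambda>\<xi>. (Stieltjes_gamma x \<xi> - Stieltjes_gamma x \<zeta>) / (\<xi> - \<zeta>)) \<longlongrightarrow> D) (at \<zeta>)"
  proof (rule LIM_zero_cancel, rule Lim_null_comparison)
    have "open (- \<real>\<^sub>\<le>\<^sub>0 :: complex set)" by (simp add: open_Compl)
    then have "eventually (\<lambda>\<xi>. \<xi> \<in> - \<real>\<^sub>\<le>\<^sub>0) (at \<zeta>)"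
      using \<zeta> by (intro eventually_at_in_open') auto
    moreover have "eventually (\<lambda>\<xi>. norm (\<xi> - \<zeta>) < \<delta> / 2) (at \<zeta>)"
      unfolding eventually_at using d(1) by (intro exI[of _ "\<delta> / 2"]) (auto simp: dist_norm)
    moreover have "eventually (\<lambda>\<xi>. \<xi> \<noteq> \<zeta>) (at \<zeta>)" by (simp add: eventually_at_filter)
    ultimately show "eventually (\<lambda>\<xi>. norm ((Stieltjes_gamma x \<xi> - Stieltjes_gamma x \<zeta>) / (\<xi> - \<zeta>) - D)
      \<le> Gamma x * (2 / \<delta> ^ 3) * norm (\<xi> - \<zeta>)) (at \<zeta>)"
      by eventually_elim (rule bound, auto)
    have "((\<lambda>\<xi>. Gamma x * (2 / \<delta> ^ 3) * norm (\<xi> - \<zeta>)) \<longlongrightarrow> Gamma x * (2 / \<delta> ^ 3) * norm (\<zeta> - \<zeta>)) (at \<zeta>)"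
      by (intro tendsto_intros)
    then show "((\<lambda>\<xi>. Gamma x * (2 / \<delta> ^ 3) * norm (\<xi> - \<zeta>)) \<longlongrightarrow> 0) (at \<zeta>)" by simp
  qed
  then show ?thesis unfolding D_def by (simp add: has_field_derivative_iff)
qed

text \<open>The integrand, multiplied by the weight, is the derivative of
\<open>t\<^sup>x e\<^sup>-\<^sup>t / (t + \<zeta>)\<close>, which vanishes at both ends.\<close>

lemma integration_by_parts_kernel:
  fixes \<zeta> :: complex
  assumes x: "x > 0" and \<zeta>: "\<zeta> \<notin> \<real>\<^sub>\<le>\<^sub>0"
  shows "(LINT t|gamma_measure x. (of_real (x - t)) / (of_real t + \<zeta>) - of_real t / (of_real t + \<zeta>) ^ 2) = 0"
proof -
  define g where "g = (\<lambda>t. (of_real (x - t)) / (of_real t + \<zeta>) - of_real t / (of_real t + \<zeta>) ^ 2)"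
  define V where "V = (\<lambda>t. of_real (t powr x * exp (- t)) / (of_real t + \<zeta>))"
  obtain \<delta> where d: "\<delta> > 0" "\<And>t. t > 0 \<Longrightarrow> norm (of_real t + \<zeta>) \<ge> \<delta>"
    using kernel_lower_bound[OF \<zeta>] by blast
  have nz: "of_real t + \<zeta> \<noteq> 0" if "t > 0" for t using d(1) d(2)[OF that] by auto
  have gm [measurable]: "g \<in> borel_measurable borel" unfolding g_def by measurable
  have geq: "g t = (of_real x + \<zeta> - 1) * (1 / (of_real t + \<zeta>)) - 1 + \<zeta> * (1 / (of_real t + \<zeta>) ^ 2)" if "t > 0" for t
    using nz[OF that] by (simp add: g_def divide_simps) (simp add: algebra_simps power2_eq_square)
  have "integrable (gamma_measure x) (\<lambda>t. (of_real x + \<zeta> - 1) * (1 / (of_real t + \<zeta>)) - 1 + \<zeta> * (1 / (of_real t + \<zeta>) ^ 2))"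
    using integrable_kernel[OF x \<zeta>, of 1] integrable_kernel[OF x \<zeta>, of 2] integrable_gamma_bounded(1)[OF x, of "\<lambda>_. 1::complex" 1]
    by (intro Bochner_Integration.integrable_add Bochner_Integration.integrable_diff integrable_mult_right) simp_all
  then have "integrable (gamma_measure x) g"
    by (rule integrable_cong_AE_imp) (use AE_gamma_measure[of x] in \<open>auto simp: geq elim!: eventually_mono\<close>)
  then have int: "set_integrable lborel {0<..} (\<lambda>t. gamma_weight x t *\<^sub>R g t)"
    unfolding set_integrable_def
    by (intro integrable_mult_indicator) (simp_all add: integrable_gamma_measure_iff)
  have dV: "(V has_vector_derivative gamma_weight x t *\<^sub>R g t) (at t)" if t: "t > 0" for t
  proof -
    have 1: "((\<lambda>t. t powr x * exp (- t)) has_field_derivative gamma_weight x t * (x - t)) (at t)"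
      using t by (auto intro!: derivative_eq_intros simp: gamma_weight_def algebra_simps powr_diff divide_simps)
    have 2: "((\<lambda>t. inverse (of_real t + \<zeta>)) has_vector_derivative - (1 / (of_real t + \<zeta>) ^ 2)) (at t)"
      using nz[OF t]
      by (auto intro!: derivative_eq_intros has_vector_derivative_real_field simp: power2_eq_square divide_simps)
    have "((\<lambda>t. (t powr x * exp (- t)) *\<^sub>R inverse (of_real t + \<zeta>)) has_vector_derivative
       (t powr x * exp (- t)) *\<^sub>R (- (1 / (of_real t + \<zeta>) ^ 2)) + (gamma_weight x t * (x - t)) *\<^sub>R inverse (of_real t + \<zeta>)) (at t)"
      by (rule has_vector_derivative_scaleR[OF 1 2])
    moreover have "(t powr x * exp (- t)) *\<^sub>R (- (1 / (of_real t + \<zeta>) ^ 2)) + (gamma_weight x t * (x - t)) *\<^sub>R inverse (of_real t + \<zeta>)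
        = gamma_weight x t *\<^sub>R g t"
    proof -
      have eq: "t powr x * exp (- t) = gamma_weight x t * t"
        using t by (simp add: gamma_weight_def powr_diff)
      show ?thesis unfolding eq by (simp add: g_def scaleR_conv_of_real divide_inverse algebra_simps)
    qed
    moreover have "V = (\<lambda>t. (t powr x * exp (- t)) *\<^sub>R inverse (of_real t + \<zeta>))"
      by (simp add: V_def scaleR_conv_of_real divide_inverse)
    ultimately show ?thesis by simp
  qed
  have cont: "isCont (\<lambda>t. gamma_weight x t *\<^sub>R g t) t" if t: "t > 0" for t
  proof -
    have "isCont (\<lambda>t. (t powr (x - 1) * exp (- t)) *\<^sub>R g t) t"
      unfolding g_def using t nz[OF t] by (intro continuous_intros) auto
    moreover have "eventually (\<lambda>t. t \<in> {0<..}) (nhds t)" using t by (intro eventually_nhds_in_open) auto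
    then have "eventually (\<lambda>t. (t powr (x - 1) * exp (- t)) *\<^sub>R g t = gamma_weight x t *\<^sub>R g t) (nhds t)"
      by eventually_elim (simp add: gamma_weight_def)
    ultimately show ?thesis by (simp add: isCont_cong)
  qed
  have Vbd: "norm (V t) \<le> t powr x * exp (- t) / \<delta>" if "t > 0" for t
    unfolding V_def using d(1) d(2)[OF that] that by (simp add: norm_divide norm_mult divide_left_mono frac_le)
  have A: "(V \<longlongrightarrow> 0) (at_right 0)"
  proof (rule Lim_null_comparison)
    show "eventually (\<lambda>t. norm (V t) \<le> t powr x * exp (- t) / \<delta>) (at_right 0)"
      using eventually_at_right_less by eventually_elim (rule Vbd)
    show "((\<lambda>t. t powr x * exp (- t) / \<delta>) \<longlongrightarrow> 0) (at_right 0)"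
      using x d(1) by real_asymp
  qed
  have B: "(V \<longlongrightarrow> 0) at_top"
  proof (rule Lim_null_comparison)
    show "eventually (\<lambda>t. norm (V t) \<le> t powr x * exp (- t) / \<delta>) at_top"
      using eventually_gt_at_top[of 0] by eventually_elim (rule Vbd)
    show "((\<lambda>t. t powr x * exp (- t) / \<delta>) \<longlongrightarrow> 0) at_top"
      using x d(1) by real_asymp
  qed
  have "(LBINT t:{0<..}. gamma_weight x t *\<^sub>R g t) = 0 - 0"
    by (rule FTC_half_line[OF dV cont int A B])
  moreover have "(\<lambda>t. indicat_real {0<..} t *\<^sub>R gamma_weight x t *\<^sub>R g t) = (\<lambda>t. gamma_weight x t *\<^sub>R g t)"
    by (auto simp: gamma_weight_def)
  ultimately have "(LINT t|gamma_measure x. g t) = 0"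
    by (simp add: integral_gamma_measure set_lebesgue_integral_def)
  then show ?thesis by (simp add: g_def)
qed

text \<open>A first-order differential equation for the transform. Partial fractions in
\<open>integration_by_parts_kernel\<close> express the derivative, an integral of \<open>1 / (t + \<zeta>)\<^sup>2\<close>, by
the transform itself and the total mass \<open>\<Gamma> x\<close>.\<close>

lemma has_field_derivative_Stieltjes_gamma:
  fixes \<zeta> :: complex
  assumes x: "x > 0" and \<zeta>: "\<zeta> \<notin> \<real>\<^sub>\<le>\<^sub>0"
  shows "(Stieltjes_gamma x has_field_derivative
           ((\<zeta> + of_real x - 1) * Stieltjes_gamma x \<zeta> - of_real (Gamma x)) / \<zeta>) (at \<zeta>)"
proof -
  have \<zeta>0: "\<zeta> \<noteq> 0" using \<zeta> by auto
  have nz: "of_real t + \<zeta> \<noteq> 0" if "t > 0" for t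
    using kernel_lower_bound[OF \<zeta>] that by (metis norm_zero not_less)
  define J where "J = (LINT t|gamma_measure x. 1 / (of_real t + \<zeta>) ^ 2)"
  have int: "integrable (gamma_measure x) (\<lambda>t. 1 / (of_real t + \<zeta>))"
    "integrable (gamma_measure x) (\<lambda>t. 1 / (of_real t + \<zeta>) ^ 2)"
    "integrable (gamma_measure x) (\<lambda>t. 1::complex)"
    using integrable_kernel[OF x \<zeta>, of 1] integrable_kernel[OF x \<zeta>, of 2] integrable_gamma_bounded(1)[OF x, of "\<lambda>_. 1::complex" 1]
    by auto
  have "0 = (LINT t|gamma_measure x. (of_real (x - t)) / (of_real t + \<zeta>) - of_real t / (of_real t + \<zeta>) ^ 2)"
    using integration_by_parts_kernel[OF x \<zeta>] by simp
  also have "\<dots> = (LINT t|gamma_measure x. (of_real x + \<zeta> - 1) * (1 / (of_real t + \<zeta>)) - 1 + \<zeta> * (1 / (of_real t + \<zeta>) ^ 2))"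
  proof (rule integral_cong_AE)
    show "AE t in gamma_measure x. (of_real (x - t)) / (of_real t + \<zeta>) - of_real t / (of_real t + \<zeta>) ^ 2
        = (of_real x + \<zeta> - 1) * (1 / (of_real t + \<zeta>)) - 1 + \<zeta> * (1 / (of_real t + \<zeta>) ^ 2)"
      using AE_gamma_measure
    proof eventually_elim
      case (elim t)
      then show ?case using nz[OF elim] by (simp add: divide_simps) (simp add: algebra_simps power2_eq_square)
    qed
  qed measurable
  also have "\<dots> = (of_real x + \<zeta> - 1) * Stieltjes_gamma x \<zeta> - (LINT t|gamma_measure x. 1) + \<zeta> * J"
    unfolding Stieltjes_gamma_def J_def
    by (intro has_bochner_integral_integral_eq has_bochner_integral_add has_bochner_integral_diff
        has_bochner_integral_mult_right has_bochner_integral_integrable int)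
  also have "(LINT t|gamma_measure x. 1::complex) = of_real (Gamma x)"
  proof -
    have "(LINT t|gamma_measure x. 1::complex) = of_real (LINT t|gamma_measure x. 1)"
      by (simp add: scaleR_conv_of_real flip: integral_complex_of_real)
    then show ?thesis using gamma_measure_moment[OF x, of 0] by (simp add: has_bochner_integral_iff)
  qed
  finally have "- J = ((\<zeta> + of_real x - 1) * Stieltjes_gamma x \<zeta> - of_real (Gamma x)) / \<zeta>"
    using \<zeta>0 by (simp add: field_simps)
  then show ?thesis
    using has_field_derivative_Stieltjes_gamma_integral[OF x \<zeta>] by (simp add: J_def)
qed

section \<open>The phase defect is positive real\<close>

text \<open>For real \<open>z\<close> the two transforms are conjugate, \<open>A = P + \<i> Q\<close> and \<open>B = P - \<i> Q\<close>, and the value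
is \<open>arctan (P / Q) = \<pi> / 2 - Arg A\<close>. The symmetric form is the one that continues
analytically.\<close>

definition phase_defect :: "real \<Rightarrow> complex \<Rightarrow> complex" where
  "phase_defect x z =
     (let A = Stieltjes_gamma x (- (\<i> * z)); B = Stieltjes_gamma x (\<i> * z)
      in Arctan (\<i> * (A + B) / (A - B)))"

lemma integral_gamma_pos:
  fixes f :: "real \<Rightarrow> real"
  assumes x: "x > 0" and int: "integrable (gamma_measure x) f" and pos: "\<And>t. t > 0 \<Longrightarrow> f t > 0"
  shows "(LINT t|gamma_measure x. f t) > 0"
proof -
  have nn: "AE t in gamma_measure x. 0 \<le> f t"
    using AE_gamma_measure by eventually_elim (simp add: pos less_imp_le)
  have "(LINT t|gamma_measure x. f t) \<noteq> 0"
  proof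
    assume "(LINT t|gamma_measure x. f t) = 0"
    then have "AE t in gamma_measure x. f t = 0"
      using integral_nonneg_eq_0_iff_AE[OF int nn] by simp
    then have "AE t in gamma_measure x. (1::real) = 0"
      using AE_gamma_measure by eventually_elim (use pos in fastforce)
    then have "(LINT t|gamma_measure x. (1::real)) = (LINT t|gamma_measure x. 0)"
      by (intro integral_cong_AE) auto
    moreover have "(LINT t|gamma_measure x. (1::real)) = Gamma x"
      using gamma_measure_moment[OF x, of 0] by (simp add: has_bochner_integral_iff)
    ultimately show False using Gamma_real_pos[OF x] by simp
  qed
  moreover have "(LINT t|gamma_measure x. f t) \<ge> 0" by (rule integral_nonneg_AE[OF nn])
  ultimately show ?thesis by simp
qed

lemma Stieltjes_gamma_cnj: "Stieltjes_gamma x (cnj \<zeta>) = cnj (Stieltjes_gamma x \<zeta>)"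
  using Bochner_Integration.integral_cnj[of "gamma_measure x" "\<lambda>t. 1 / (complex_of_real t + \<zeta>)"]
  by (simp add: Stieltjes_gamma_def)

lemma not_nonpos_Reals_rotated:
  assumes "Re z > 0"
  shows "- (\<i> * z) \<notin> \<real>\<^sub>\<le>\<^sub>0" "\<i> * z \<notin> \<real>\<^sub>\<le>\<^sub>0"
  using assms by (auto simp: complex_nonpos_Reals_iff)

text \<open>The product is the double integral of \<open>1 / ((t - \<i> z) (s + cnj (\<i> z)))\<close>, and the denominator
has imaginary part \<open>- Re z (t + s) < 0\<close>. Taking imaginary parts in the inner and then in the outer
integral needs no theorem of Fubini type.\<close>

lemma Im_Stieltjes_gamma_product_pos:
  assumes x: "x > 0" and z: "Re z > 0"
  shows "Im (Stieltjes_gamma x (- (\<i> * z)) * cnj (Stieltjes_gamma x (\<i> * z))) > 0"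
proof -
  define k where "k = (\<lambda>t. 1 / (complex_of_real t + - (\<i> * z)))"
  define l where "l = (\<lambda>s. 1 / (complex_of_real s + cnj (\<i> * z)))"
  define L where "L = (LINT s|gamma_measure x. l s)"
  have c: "cnj (\<i> * z) \<notin> \<real>\<^sub>\<le>\<^sub>0" using z by (auto simp: complex_nonpos_Reals_iff)
  have intk: "integrable (gamma_measure x) k"
    using integrable_kernel[OF x not_nonpos_Reals_rotated(1)[OF z], of 1] by (simp add: k_def)
  have intl: "integrable (gamma_measure x) l"
    using integrable_kernel[OF x c, of 1] by (simp add: l_def)
  have L: "cnj (Stieltjes_gamma x (\<i> * z)) = L"
    unfolding Stieltjes_gamma_cnj[symmetric] by (simp add: L_def l_def Stieltjes_gamma_def)
  have pt: "Im (k t * l s) > 0" if "t > 0" "s > 0" for t s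
  proof -
    define w where "w = (complex_of_real t + - (\<i> * z)) * (complex_of_real s + cnj (\<i> * z))"
    have "Im w = - (Re z * (t + s))" by (simp add: w_def algebra_simps)
    moreover have "Re z * (t + s) > 0" using z that by simp
    ultimately have w: "Im w < 0" by simp
    then have w0: "norm w > 0" by auto
    have "1 / w = cnj w / of_real (norm w ^ 2)"
      using complex_div_cnj[of 1 w] by simp
    then have "Im (1 / w) = - Im w / norm w ^ 2" by (simp only: Im_divide_of_real complex_cnj)
       simp
    then have "Im (1 / w) > 0" using w w0 by (simp add: divide_neg_pos)
    then show ?thesis by (simp add: k_def l_def w_def)
  qed
  have inner: "Im (k t * L) > 0" if t: "t > 0" for t
  proof -
    have i: "integrable (gamma_measure x) (\<lambda>s. k t * l s)" using intl by simp
    have "(LINT s|gamma_measure x. Im (k t * l s)) > 0"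
      by (intro integral_gamma_pos[OF x] integrable_Im i pt t)
    also have "(LINT s|gamma_measure x. Im (k t * l s)) = Im (k t * L)"
      by (simp only: integral_Im[OF i] L_def integral_mult_right_zero)
    finally show ?thesis .
  qed
  have i: "integrable (gamma_measure x) (\<lambda>t. k t * L)" using intk by simp
  have "(LINT t|gamma_measure x. Im (k t * L)) > 0"
    by (intro integral_gamma_pos[OF x] integrable_Im i inner)
  also have "(LINT t|gamma_measure x. Im (k t * L)) = Im ((LINT t|gamma_measure x. k t) * L)"
    by (simp only: integral_Im[OF i] integral_mult_left_zero)
  finally show ?thesis unfolding L by (simp add: k_def Stieltjes_gamma_def)
qed

text \<open>\<open>Arctan\<close> is \<open>\<i> / 2\<close> times a logarithm of \<open>(1 - \<i> q) / (1 + \<i> q)\<close>, which lies in the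
lower half-plane when \<open>Re q > 0\<close>.\<close>

lemma Re_Arctan_pos:
  assumes "Re q > 0"
  shows "Re (Arctan q) > 0" "Re (Arctan q) < pi / 2"
proof -
  show "Re (Arctan q) < pi / 2" using Re_Arctan_bounds[of q] assms by simp
  define u where "u = (1 - \<i> * q) / (1 + \<i> * q)"
  have "1 + \<i> * q \<noteq> 0" using assms by (auto simp: complex_eq_iff)
  then have n: "norm (1 + \<i> * q) ^ 2 > 0" by simp
  have "u = (1 - \<i> * q) * cnj (1 + \<i> * q) / of_real (norm (1 + \<i> * q) ^ 2)"
    using complex_div_cnj[of "1 - \<i> * q" "1 + \<i> * q"] by (simp add: u_def)
  then have "Im u = Im ((1 - \<i> * q) * cnj (1 + \<i> * q)) / norm (1 + \<i> * q) ^ 2"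
    by (simp only: Im_divide_of_real)
  also have "Im ((1 - \<i> * q) * cnj (1 + \<i> * q)) = - 2 * Re q" by (simp add: algebra_simps)
  finally have "Im u < 0" using n assms by (simp add: divide_neg_pos)
  then have "Im (Ln u) < 0" using Arg_less_0[of u] by (cases "u = 0") (auto simp: Arg_eq_Im_Ln)
  then show "Re (Arctan q) > 0" by (simp add: Arctan_def u_def)
qed

text \<open>With \<open>q = \<i> (A + B) / (A - B)\<close> one has \<open>Re q = 2 Im (A cnj B) / \<bar>A - B\<bar>\<^sup>2\<close>.\<close>

lemma phase_defect_arctan_argument:
  assumes x: "x > 0" and z: "Re z > 0"
  defines "A \<equiv> Stieltjes_gamma x (- (\<i> * z))" and "B \<equiv> Stieltjes_gamma x (\<i> * z)"
  shows "A \<noteq> B" "Re (\<i> * (A + B) / (A - B)) > 0"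
proof -
  have *: "Im (A * cnj B) > 0"
    unfolding A_def B_def by (rule Im_Stieltjes_gamma_product_pos[OF x z])
  then show "A \<noteq> B" by (auto simp: complex_norm_square[symmetric])
  then have n: "norm (A - B) ^ 2 > 0" by simp
  have "\<i> * (A + B) / (A - B) = \<i> * (A + B) * cnj (A - B) / of_real (norm (A - B) ^ 2)"
    using complex_div_cnj[of "\<i> * (A + B)" "A - B"] by simp
  then have "Re (\<i> * (A + B) / (A - B)) = Re (\<i> * (A + B) * cnj (A - B)) / norm (A - B) ^ 2"
    by (simp only: Re_divide_of_real)
  also have "Re (\<i> * (A + B) * cnj (A - B)) = 2 * Im (A * cnj B)" by (simp add: algebra_simps)
  finally show "Re (\<i> * (A + B) / (A - B)) > 0" using * n by simp
qed

lemma Re_phase_defect: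
  assumes "x > 0" "Re z > 0"
  shows "Re (phase_defect x z) > 0" "Re (phase_defect x z) < pi / 2"
  using Re_Arctan_pos[OF phase_defect_arctan_argument(2)[OF assms]]
  by (simp_all add: phase_defect_def Let_def)

lemma holomorphic_phase_defect:
  assumes x: "x > 0"
  shows "phase_defect x holomorphic_on right_half_plane"
proof -
  have S: "Stieltjes_gamma x holomorphic_on - \<real>\<^sub>\<le>\<^sub>0"
    by (rule holomorphic_onI, rule field_differentiable_at_within)
       (use has_field_derivative_Stieltjes_gamma[OF x] in \<open>auto simp: field_differentiable_def\<close>)
  have A: "(\<lambda>z. Stieltjes_gamma x (- (\<i> * z))) holomorphic_on right_half_plane"
    by (rule holomorphic_on_compose_gen[OF _ S, of _ right_half_plane, unfolded o_def])
       (auto intro!: holomorphic_intros simp: right_half_plane_def complex_nonneg_Reals_iff complex_nonpos_Reals_iff)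
  have B: "(\<lambda>z. Stieltjes_gamma x (\<i> * z)) holomorphic_on right_half_plane"
    by (rule holomorphic_on_compose_gen[OF _ S, of _ right_half_plane, unfolded o_def])
       (auto intro!: holomorphic_intros simp: right_half_plane_def complex_nonneg_Reals_iff complex_nonpos_Reals_iff)
  have q: "(\<lambda>z. \<i> * (Stieltjes_gamma x (- (\<i> * z)) + Stieltjes_gamma x (\<i> * z)) /
        (Stieltjes_gamma x (- (\<i> * z)) - Stieltjes_gamma x (\<i> * z))) holomorphic_on right_half_plane"
    by (intro holomorphic_intros A B)
       (use phase_defect_arctan_argument(1)[OF x] in \<open>auto simp: right_half_plane_def\<close>)
  have "Arctan holomorphic_on right_half_plane"
    by (rule holomorphic_on_Arctan) (auto simp: right_half_plane_def)
  from holomorphic_on_compose_gen[OF q this] show ?thesis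
    using phase_defect_arctan_argument(2)[OF x]
    by (simp add: o_def phase_defect_def[abs_def] Let_def right_half_plane_def image_subset_iff)
qed

definition stieltjes_re :: "real \<Rightarrow> real \<Rightarrow> real" where
  "stieltjes_re x r = Re (Stieltjes_gamma x (- (\<i> * of_real r)))"

definition stieltjes_im :: "real \<Rightarrow> real \<Rightarrow> real" where
  "stieltjes_im x r = Im (Stieltjes_gamma x (- (\<i> * of_real r)))"

lemma stieltjes_re_im_integrals:
  assumes x: "x > 0" and r: "r > 0"
  shows "has_bochner_integral (gamma_measure x) (\<lambda>t. t / (t ^ 2 + r ^ 2)) (stieltjes_re x r)"
    and "has_bochner_integral (gamma_measure x) (\<lambda>t. r / (t ^ 2 + r ^ 2)) (stieltjes_im x r)"
proof -
  let ?k = "\<lambda>t. 1 / (complex_of_real t + - (\<i> * of_real r))"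
  have int: "integrable (gamma_measure x) ?k"
    using integrable_kernel[OF x not_nonpos_Reals_rotated(1)[of "of_real r"], of 1] r by simp
  have k: "?k t = (of_real t + \<i> * of_real r) / of_real (t ^ 2 + r ^ 2)" for t
  proof -
    have "?k t = cnj (of_real t + - (\<i> * of_real r)) / of_real (norm (of_real t + - (\<i> * of_real r)) ^ 2)"
      using complex_div_cnj[of 1 "of_real t + - (\<i> * of_real r)"] by simp
    also have "norm (of_real t + - (\<i> * of_real r)) ^ 2 = t ^ 2 + r ^ 2" by (simp add: cmod_power2)
    finally show ?thesis by simp
  qed
  have "Re (?k t) = t / (t ^ 2 + r ^ 2)" "Im (?k t) = r / (t ^ 2 + r ^ 2)" for t
    unfolding k Re_divide_of_real Im_divide_of_real by simp_all
  then have "(\<lambda>t. t / (t ^ 2 + r ^ 2)) = (\<lambda>t. Re (?k t))" "(\<lambda>t. r / (t ^ 2 + r ^ 2)) = (\<lambda>t. Im (?k t))"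
    by simp_all
  then show "has_bochner_integral (gamma_measure x) (\<lambda>t. t / (t ^ 2 + r ^ 2)) (stieltjes_re x r)"
    "has_bochner_integral (gamma_measure x) (\<lambda>t. r / (t ^ 2 + r ^ 2)) (stieltjes_im x r)"
    using int by (simp_all only: has_bochner_integral_iff integrable_Re integrable_Im integral_Re integral_Im
        stieltjes_re_def stieltjes_im_def Stieltjes_gamma_def)
qed

lemma stieltjes_pos:
  assumes x: "x > 0" and r: "r > 0"
  shows "stieltjes_re x r > 0" "stieltjes_im x r > 0"
proof -
  note I = stieltjes_re_im_integrals[OF assms, unfolded has_bochner_integral_iff]
  have p: "t ^ 2 + r ^ 2 > 0" for t :: real using r by (simp add: add_nonneg_pos)
  show "stieltjes_re x r > 0"
    using integral_gamma_pos[OF x conjunct1[OF I(1)]] p I(1) by simp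
  show "stieltjes_im x r > 0"
    using integral_gamma_pos[OF x conjunct1[OF I(2)]] p I(2) r by simp
qed

lemma phase_defect_of_real:
  assumes x: "x > 0" and r: "r > 0"
  shows "phase_defect x (of_real r) = of_real (arctan (stieltjes_re x r / stieltjes_im x r))"
proof -
  define A where "A = Stieltjes_gamma x (- (\<i> * of_real r))"
  have B: "Stieltjes_gamma x (\<i> * of_real r) = cnj A"
    unfolding A_def Stieltjes_gamma_cnj[symmetric] by simp
  have nz: "Im A \<noteq> 0" using stieltjes_pos(2)[OF assms] by (simp add: stieltjes_im_def A_def)
  have "\<i> * (A + cnj A) / (A - cnj A) = of_real (Re A / Im A)"
    using nz by (simp add: complex_add_cnj complex_diff_cnj)
  then show ?thesis
    by (simp add: phase_defect_def Let_def B A_def[symmetric] stieltjes_re_def stieltjes_im_def Arctan_of_real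
      del: of_real_divide)
qed

lemma positive_real_phase_defect:
  assumes "x > 0"
  shows "positive_real (phase_defect x)"
  using assms unfolding positive_real_def
  by (simp add: holomorphic_phase_defect Re_phase_defect phase_defect_of_real)

lemma stieltjes_derivs:
  assumes x: "x > 0" and r: "r > 0"
  shows "(stieltjes_re x has_real_derivative
            ((x - 1) * stieltjes_re x r + r * stieltjes_im x r - Gamma x) / r) (at r)"
    and "(stieltjes_im x has_real_derivative
            ((x - 1) * stieltjes_im x r - r * stieltjes_re x r) / r) (at r)"
proof -
  define A where "A = Stieltjes_gamma x (- (\<i> * of_real r))"
  define D where "D = (- \<i>) * (((- (\<i> * of_real r) + of_real x - 1) * A - of_real (Gamma x)) / (- (\<i> * of_real r)))"
  have "((\<lambda>r. - (\<i> * complex_of_real r)) has_vector_derivative (- \<i>)) (at r)"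
    by (auto intro!: derivative_eq_intros has_vector_derivative_real_field)
  from field_vector_diff_chain_at[OF this
      has_field_derivative_Stieltjes_gamma[OF x not_nonpos_Reals_rotated(1)[of "of_real r"]]]
  have "((\<lambda>r. Stieltjes_gamma x (- (\<i> * of_real r))) has_vector_derivative D) (at r)"
    using r by (simp add: o_def D_def A_def)
  moreover have "D = ((of_real (x - 1) - \<i> * of_real r) * A - of_real (Gamma x)) / of_real r"
    using r by (simp add: D_def field_simps)
  ultimately have d: "((\<lambda>r. Stieltjes_gamma x (- (\<i> * of_real r))) has_vector_derivative
      ((of_real (x - 1) - \<i> * of_real r) * A - of_real (Gamma x)) / of_real r) (at r)" by simp
  show "(stieltjes_re x has_real_derivative
            ((x - 1) * stieltjes_re x r + r * stieltjes_im x r - Gamma x) / r) (at r)"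
    using has_field_derivative_Re[OF d]
    by (simp only: Re_divide_of_real) (simp add: stieltjes_re_def[abs_def] stieltjes_im_def A_def algebra_simps)
  show "(stieltjes_im x has_real_derivative
            ((x - 1) * stieltjes_im x r - r * stieltjes_re x r) / r) (at r)"
    using has_field_derivative_Im[OF d]
    by (simp only: Im_divide_of_real) (simp add: stieltjes_re_def stieltjes_im_def[abs_def] A_def algebra_simps)
qed

text \<open>By the differential equation, \<open>P' Q - P Q' = P\<^sup>2 + Q\<^sup>2 - \<Gamma> x Q / r\<close>, and
the first two terms cancel the derivative \<open>1\<close> of \<open>r\<close>.\<close>

lemma arctan_quotient_deriv:
  assumes x: "x > 0" and r: "r > 0"
  shows "((\<lambda>r. r - arctan (stieltjes_re x r / stieltjes_im x r)) has_real_derivative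
           Gamma x * stieltjes_im x r / (r * (stieltjes_re x r ^ 2 + stieltjes_im x r ^ 2))) (at r)"
proof -
  define P where "P = stieltjes_re x r"
  define Q where "Q = stieltjes_im x r"
  have Q: "Q > 0" using stieltjes_pos[OF assms] by (simp add: Q_def)
  have PQ: "P ^ 2 + Q ^ 2 > 0" using Q by (simp add: add_nonneg_pos)
  define P' where "P' = ((x - 1) * P + r * Q - Gamma x) / r"
  define Q' where "Q' = ((x - 1) * Q - r * P) / r"
  have "((\<lambda>r. r - arctan (stieltjes_re x r / stieltjes_im x r)) has_real_derivative
      1 - inverse (1 + (P / Q) ^ 2) * ((P' * Q - P * Q') / (Q * Q))) (at r)"
    using Q stieltjes_derivs[OF assms]
    by (auto intro!: derivative_eq_intros simp: P'_def Q'_def P_def Q_def)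
  moreover have "inverse (1 + (P / Q) ^ 2) * ((P' * Q - P * Q') / (Q * Q)) = (P' * Q - P * Q') / (P ^ 2 + Q ^ 2)"
    using Q PQ by (simp add: divide_simps power2_eq_square)
  moreover have "P' * Q - P * Q' = (P ^ 2 + Q ^ 2) - Gamma x * Q / r"
    using r by (simp add: P'_def Q'_def field_simps power2_eq_square)
  moreover have "1 - ((P ^ 2 + Q ^ 2) - Gamma x * Q / r) / (P ^ 2 + Q ^ 2) = Gamma x * Q / (r * (P ^ 2 + Q ^ 2))"
    using PQ by (auto simp: diff_divide_distrib)
  ultimately show ?thesis by (simp add: P_def Q_def)
qed

section \<open>The incomplete gamma function and the uniqueness of its phase\<close>

text \<open>The differential equation of the Stieltjes transform is exactly what makes this function a primitive
of the negated integrand \<open>\<zeta>\<^sup>a\<^sup>-\<^sup>1 e\<^sup>-\<^sup>\<zeta>\<close> of the incomplete gamma function.\<close>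

lemma has_field_derivative_incomplete_gamma_primitive:
  fixes \<zeta> :: complex
  assumes a: "a < 1" and \<zeta>: "\<zeta> \<notin> \<real>\<^sub>\<le>\<^sub>0"
  shows "((\<lambda>\<zeta>. \<zeta> powr of_real a * exp (- \<zeta>) * Stieltjes_gamma (1 - a) \<zeta> / of_real (Gamma (1 - a)))
           has_field_derivative - (\<zeta> powr (of_real a - 1) * exp (- \<zeta>))) (at \<zeta>)"
proof -
  have x: "1 - a > 0" using a by simp
  have \<zeta>0: "\<zeta> \<noteq> 0" using \<zeta> by auto
  have G: "complex_of_real (Gamma (1 - a)) \<noteq> 0" using Gamma_real_pos[OF x] by simp
  define S where "S = Stieltjes_gamma (1 - a) \<zeta>"
  define S' where "S' = ((\<zeta> + of_real (1 - a) - 1) * S - of_real (Gamma (1 - a))) / \<zeta>"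
  have dS: "(Stieltjes_gamma (1 - a) has_field_derivative S') (at \<zeta>)"
    unfolding S'_def S_def by (rule has_field_derivative_Stieltjes_gamma[OF x \<zeta>])
  have p: "\<zeta> powr of_real a = \<zeta> powr (of_real a - 1) * \<zeta>"
    using \<zeta>0 by (simp add: powr_diff)
  have dp: "((\<lambda>\<zeta>. \<zeta> powr of_real a) has_field_derivative of_real a * \<zeta> powr (of_real a - 1)) (at \<zeta>)"
    using \<zeta> by (rule has_field_derivative_powr)
  have de: "((\<lambda>\<zeta>. exp (- \<zeta>)) has_field_derivative - exp (- \<zeta>)) (at \<zeta>)"
    by (auto intro!: derivative_eq_intros)
  have "((\<lambda>\<zeta>. \<zeta> powr of_real a * exp (- \<zeta>) * Stieltjes_gamma (1 - a) \<zeta> / of_real (Gamma (1 - a)))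
           has_field_derivative
     ((of_real a * \<zeta> powr (of_real a - 1) * exp (- \<zeta>) + (- exp (- \<zeta>)) * \<zeta> powr of_real a) * S
        + S' * (\<zeta> powr of_real a * exp (- \<zeta>))) / of_real (Gamma (1 - a))) (at \<zeta>)"
    unfolding S_def by (intro DERIV_cdivide DERIV_mult dp de dS)
  also have "((of_real a * \<zeta> powr (of_real a - 1) * exp (- \<zeta>) + (- exp (- \<zeta>)) * \<zeta> powr of_real a) * S
        + S' * (\<zeta> powr of_real a * exp (- \<zeta>))) / of_real (Gamma (1 - a))
     = \<zeta> powr (of_real a - 1) * exp (- \<zeta>) * ((of_real a - \<zeta>) * S + S' * \<zeta>) / of_real (Gamma (1 - a))"
    unfolding p by (simp add: algebra_simps)
  also have "(of_real a - \<zeta>) * S + S' * \<zeta> = - of_real (Gamma (1 - a))"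
  proof -
    have "S' * \<zeta> = (\<zeta> + of_real (1 - a) - 1) * S - of_real (Gamma (1 - a))"
      using \<zeta>0 by (simp add: S'_def)
    then show ?thesis by (simp add: algebra_simps)
  qed
  also have "\<zeta> powr (of_real a - 1) * exp (- \<zeta>) * (- of_real (Gamma (1 - a))) / of_real (Gamma (1 - a))
     = - (\<zeta> powr (of_real a - 1) * exp (- \<zeta>))" using G by simp
  finally show ?thesis .
qed

lemma upper_Gamma_set_integrable:
  assumes a: "a < 1" and \<zeta>: "Re \<zeta> \<ge> 0" "\<zeta> \<noteq> 0"
  shows "set_integrable lborel {0<..} (\<lambda>t. (\<zeta> + of_real t) powr (of_real a - 1) * exp (- (\<zeta> + of_real t)))"
proof -
  have e: "integrable lborel (\<lambda>t. gamma_weight 1 t *\<^sub>R (norm \<zeta> powr (a - 1)))"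
    using gamma_weight_has_bochner_integral[of 1] by (auto simp: has_bochner_integral_iff)
  have \<zeta>': "\<zeta> \<notin> \<real>\<^sub>\<le>\<^sub>0" using \<zeta> by (auto simp: complex_nonpos_Reals_iff complex_eq_iff)
  show ?thesis
    unfolding set_integrable_def
  proof (rule Bochner_Integration.integrable_bound[OF e])
    show "AE t in lborel. norm (indicat_real {0<..} t *\<^sub>R ((\<zeta> + of_real t) powr (of_real a - 1) * exp (- (\<zeta> + of_real t))))
         \<le> norm (gamma_weight 1 t *\<^sub>R (norm \<zeta> powr (a - 1)))"
    proof (intro AE_I2)
      fix t :: real
      show "norm (indicat_real {0<..} t *\<^sub>R ((\<zeta> + of_real t) powr (of_real a - 1) * exp (- (\<zeta> + of_real t))))
         \<le> norm (gamma_weight 1 t *\<^sub>R (norm \<zeta> powr (a - 1)))"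
      proof (cases "t > 0")
        case True
        have n: "norm \<zeta> \<le> norm (\<zeta> + of_real t)"
          using norm_of_real_add_ge[OF \<zeta>', of t] True \<zeta> by (simp add: add.commute)
        have "norm ((\<zeta> + of_real t) powr (of_real a - 1)) = norm (\<zeta> + of_real t) powr (a - 1)"
          using norm_powr_real_powr'[of "of_real a - 1" "\<zeta> + of_real t"] by simp
        also have "\<dots> \<le> norm \<zeta> powr (a - 1)" using n \<zeta>(2) a by (intro powr_mono2') auto
        finally have 1: "norm ((\<zeta> + of_real t) powr (of_real a - 1)) \<le> norm \<zeta> powr (a - 1)" .
        have 2: "norm (exp (- (\<zeta> + of_real t))) \<le> exp (- t)" using \<zeta>(1) by simp
        show ?thesis using mult_mono[OF 1 2] True
          by (simp add: gamma_weight_def norm_mult mult.commute)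
      qed simp
    qed
  qed measurable
qed

text \<open>The fundamental theorem of calculus along the ray \<open>\<zeta> + t\<close>, with the primitive just found: it
vanishes at infinity because \<open>S \<zeta>\<close> is at most \<open>\<Gamma> x / \<bar>\<zeta>\<bar>\<close> and the exponential
decays. This avoids exchanging integrals, which would fail to converge absolutely on the imaginary
axis when \<open>a \<le> 0\<close>.\<close>

lemma upper_Gamma_eq_Stieltjes_gamma:
  assumes a: "a < 1" and \<zeta>: "Re \<zeta> \<ge> 0" "\<zeta> \<noteq> 0"
  shows "upper_Gamma (of_real a) \<zeta> = (LBINT t:{0<..}. (\<zeta> + of_real t) powr (of_real a - 1) * exp (- (\<zeta> + of_real t)))"
    and "upper_Gamma (of_real a) \<zeta> =
           \<zeta> powr of_real a * exp (- \<zeta>) * Stieltjes_gamma (1 - a) \<zeta> / of_real (Gamma (1 - a))"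
proof -
  define f where "f = (\<lambda>t. (\<zeta> + of_real t) powr (of_real a - 1) * exp (- (\<zeta> + of_real t)))"
  define K where "K = (\<lambda>\<zeta>. \<zeta> powr of_real a * exp (- \<zeta>) * Stieltjes_gamma (1 - a) \<zeta> / of_real (Gamma (1 - a)))"
  have x: "1 - a > 0" using a by simp
  have int: "set_integrable lborel {0<..} f" unfolding f_def by (rule upper_Gamma_set_integrable[OF assms])
  have cut: "\<zeta> + of_real t \<notin> \<real>\<^sub>\<le>\<^sub>0" if "t \<ge> 0" for t
    using \<zeta> that by (auto simp: complex_nonpos_Reals_iff complex_eq_iff)
  have dK: "(K has_field_derivative - f t) (at (\<zeta> + of_real t))" if "t \<ge> 0" for t
    unfolding K_def f_def by (rule has_field_derivative_incomplete_gamma_primitive[OF a cut[OF that]])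
  have sh: "((\<lambda>t. \<zeta> + of_real t) has_vector_derivative 1) (at t)" for t
    by (auto intro!: derivative_eq_intros has_vector_derivative_real_field)
  have dF: "((\<lambda>t. - K (\<zeta> + of_real t)) has_vector_derivative f t) (at t)" if "t \<ge> 0" for t
    using has_vector_derivative_minus[OF field_vector_diff_chain_at[OF sh dK[OF that]]] by (simp add: o_def)
  have c: "isCont f t" if "t > 0" for t
    unfolding f_def using cut[of t] that by (intro continuous_intros isCont_powr_complex) auto
  have "isCont (\<lambda>t. - K (\<zeta> + of_real t)) 0"
    using dF[of 0] by (intro has_vector_derivative_continuous) auto
  then have A: "((\<lambda>t. - K (\<zeta> + of_real t)) \<longlongrightarrow> - K \<zeta>) (at_right 0)"
    unfolding isCont_def by (auto intro: tendsto_mono[OF at_le])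
  have B: "((\<lambda>t. - K (\<zeta> + of_real t)) \<longlongrightarrow> 0) at_top"
  proof (rule Lim_null_comparison)
    show "eventually (\<lambda>t. norm (- K (\<zeta> + of_real t)) \<le> norm \<zeta> powr (a - 1) * exp (- t)) at_top"
      using eventually_gt_at_top[of 0]
    proof eventually_elim
      case (elim t)
      define \<xi> where "\<xi> = \<zeta> + of_real t"
      have n: "norm \<zeta> \<le> norm \<xi>" and n0: "norm \<xi> > 0"
        using norm_of_real_add_ge[OF cut[of 0], of t] cut[of t] elim \<zeta> by (auto simp: add.commute \<xi>_def)
      have "norm (K \<xi>) = norm \<xi> powr a * exp (- Re \<xi>) * norm (Stieltjes_gamma (1 - a) \<xi>) / Gamma (1 - a)"
        using norm_powr_real_powr'[of "of_real a" \<xi>] Gamma_real_pos[OF x]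
        by (simp add: K_def norm_mult norm_divide)
      also have "\<dots> \<le> norm \<xi> powr a * exp (- Re \<xi>) * (Gamma (1 - a) / norm \<xi>) / Gamma (1 - a)"
        using norm_Stieltjes_gamma_le[OF x, of \<xi>] Gamma_real_pos[OF x] elim \<zeta> n0
        by (intro divide_right_mono mult_left_mono) (auto simp: \<xi>_def)
      also have "\<dots> = norm \<xi> powr (a - 1) * exp (- Re \<xi>)"
        using Gamma_real_pos[OF x] n0 by (simp add: powr_diff)
      also have "\<dots> \<le> norm \<zeta> powr (a - 1) * exp (- t)"
        using n \<zeta> a by (intro mult_mono powr_mono2') (auto simp: \<xi>_def)
      finally show ?case by (simp add: \<xi>_def)
    qed
    show "((\<lambda>t. norm \<zeta> powr (a - 1) * exp (- t)) \<longlongrightarrow> 0) at_top" by real_asymp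
  qed
  have "(LBINT t:{0<..}. f t) = 0 - - K \<zeta>"
    by (rule FTC_half_line[OF dF c int A B]) auto
  moreover have "integral {0..} f = integral {0<..} f"
  proof -
    have "(f has_integral I) {0..} \<longleftrightarrow> (f has_integral I) {0<..}" for I
      by (rule has_integral_spike_set_eq[of _ _ ]) (auto intro: negligible_subset[of "{0}"])
    then show ?thesis by (simp add: integral_def integrable_on_def)
  qed
  moreover have "(LBINT t:{0<..}. f t) = integral {0<..} f"
    by (rule set_borel_integral_eq_integral[OF int])
  ultimately show "upper_Gamma (of_real a) \<zeta> = (LBINT t:{0<..}. (\<zeta> + of_real t) powr (of_real a - 1) * exp (- (\<zeta> + of_real t)))"
    "upper_Gamma (of_real a) \<zeta> =
           \<zeta> powr of_real a * exp (- \<zeta>) * Stieltjes_gamma (1 - a) \<zeta> / of_real (Gamma (1 - a))"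
    unfolding upper_Gamma_def f_def[symmetric] by (simp_all add: K_def)
qed

text \<open>The right-hand side of the equation that defines modulus and phase.\<close>

definition rotated_gamma :: "real \<Rightarrow> real \<Rightarrow> complex" where
  "rotated_gamma a z = exp (of_real (pi / 2) * \<i> * of_real a) *
     upper_Gamma (of_real a) (of_real z * exp (- (of_real (pi / 2) * \<i>)))"

lemma exp_minus_half_pi: "exp (- (of_real (pi / 2) * \<i>)) = - \<i>"
proof -
  have "exp (- (of_real (pi / 2) * \<i>)) = cis (- (pi / 2))" by (simp add: cis_conv_exp mult.commute)
  then show ?thesis by simp
qed

lemma powr_minus_ii:
  fixes a z :: real
  assumes "z > 0"
  shows "(- (\<i> * of_real z)) powr of_real a = of_real (z powr a) * exp (- (of_real (pi / 2) * \<i> * of_real a))"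
proof -
  have L: "Ln (- (\<i> * of_real z)) = of_real (ln z) - \<i> * of_real (pi / 2)"
    using assms Ln_times_of_real[of z "- \<i>"] Ln_of_real[of z] by (simp add: mult.commute)
  then have "(- (\<i> * of_real z)) powr of_real a = exp (of_real (a * ln z) - of_real (pi / 2) * \<i> * of_real a)"
    using assms unfolding powr_def L by (simp add: algebra_simps)
  also have "\<dots> = of_real (z powr a) * exp (- (of_real (pi / 2) * \<i> * of_real a))"
    unfolding diff_conv_add_uminus exp_add exp_of_real using assms by (simp add: powr_def)
  finally show ?thesis .
qed

lemma rotated_gamma_eq:
  assumes a: "a < 1" and z: "z > 0"
  shows "rotated_gamma a z = of_real (z powr a / Gamma (1 - a)) * exp (\<i> * of_real z) *
           Stieltjes_gamma (1 - a) (- (\<i> * of_real z))"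
proof -
  have eq: "of_real z * exp (- (of_real (pi / 2) * \<i>)) = - (\<i> * of_real z)"
    unfolding exp_minus_half_pi by simp
  have "upper_Gamma (of_real a) (- (\<i> * of_real z)) =
     (- (\<i> * of_real z)) powr of_real a * exp (\<i> * of_real z) * Stieltjes_gamma (1 - a) (- (\<i> * of_real z)) / of_real (Gamma (1 - a))"
    using upper_Gamma_eq_Stieltjes_gamma(2)[OF a, of "- (\<i> * of_real z)"] z by simp
  then show ?thesis
    unfolding rotated_gamma_def eq powr_minus_ii[OF z] by (simp add: exp_minus field_simps)
qed

lemma rotated_gamma_derivative:
  assumes a: "a < 1" and z: "z > 0"
  shows "(rotated_gamma a has_vector_derivative - (of_real (z powr (a - 1)) * exp (\<i> * of_real z))) (at z)"
proof -
  define K where "K = (\<lambda>\<zeta>. \<zeta> powr of_real a * exp (- \<zeta>) * Stieltjes_gamma (1 - a) \<zeta> / of_real (Gamma (1 - a)))"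
  define E where "E = exp (of_real (pi / 2) * \<i> * of_real a)"
  have rot: "((\<lambda>r. - (\<i> * complex_of_real r)) has_vector_derivative (- \<i>)) (at z)"
    by (auto intro!: derivative_eq_intros has_vector_derivative_real_field)
  have dK: "(K has_field_derivative - ((- (\<i> * of_real z)) powr (of_real a - 1) * exp (- (- (\<i> * of_real z))))) (at (- (\<i> * of_real z)))"
    unfolding K_def using z
    by (intro has_field_derivative_incomplete_gamma_primitive[OF a] not_nonpos_Reals_rotated) auto
  have "((\<lambda>r. E * K (- (\<i> * of_real r))) has_vector_derivative
      E * ((- \<i>) * - ((- (\<i> * of_real z)) powr (of_real (a - 1)) * exp (\<i> * of_real z)))) (at z)"
    using has_vector_derivative_mult_right[OF field_vector_diff_chain_at[OF rot dK], of E] by (simp add: o_def)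
  also have "E * ((- \<i>) * - ((- (\<i> * of_real z)) powr (of_real (a - 1)) * exp (\<i> * of_real z)))
      = - (of_real (z powr (a - 1)) * exp (\<i> * of_real z))"
  proof -
    have "exp (- (h * of_real (a - 1))) = exp h / exp (h * of_real a)" for h :: complex
      by (simp add: algebra_simps flip: exp_diff)
    then have "exp (- (of_real (pi / 2) * \<i> * of_real (a - 1))) = exp (of_real (pi / 2) * \<i>) / E"
      unfolding E_def .
    also have "exp (of_real (pi / 2) * \<i>) = \<i>"
      using cis_conv_exp[of "pi / 2"] by (simp add: mult.commute)
    finally show ?thesis unfolding powr_minus_ii[OF z] by (simp add: E_def field_simps)
  qed
  finally have d: "((\<lambda>r. E * K (- (\<i> * of_real r))) has_vector_derivative
      - (of_real (z powr (a - 1)) * exp (\<i> * of_real z))) (at z)" .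
  show ?thesis
  proof (rule has_vector_derivative_transform_within_open[OF d, of "{0<..}"])
    show "E * K (- (\<i> * of_real r)) = rotated_gamma a r" if "r \<in> {0<..}" for r
      using that upper_Gamma_eq_Stieltjes_gamma(2)[OF a, of "- (\<i> * of_real r)"]
      unfolding rotated_gamma_def exp_minus_half_pi by (simp add: E_def K_def mult.commute)
  qed (use z in auto)
qed

text \<open>An explicit phase: \<open>S (- \<i> z)\<close> stays in the open first quadrant, so the principal argument is
continuous along the whole positive axis and no unwinding is necessary.\<close>

definition phase_branch :: "real \<Rightarrow> real \<Rightarrow> real" where
  "phase_branch a z = z + Arg (Stieltjes_gamma (1 - a) (- (\<i> * of_real z)))"

lemma Arg_Stieltjes_gamma_rotated:
  assumes x: "x > 0" and z: "z > 0"
  shows "Arg (Stieltjes_gamma x (- (\<i> * of_real z))) = pi / 2 - arctan (stieltjes_re x z / stieltjes_im x z)"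
proof -
  note p = stieltjes_pos[OF assms]
  have "Arg (Stieltjes_gamma x (- (\<i> * of_real z))) = arctan (stieltjes_im x z / stieltjes_re x z)"
    using p by (subst arg_conv_arctan) (auto simp: stieltjes_re_def stieltjes_im_def)
  also have "stieltjes_im x z / stieltjes_re x z = inverse (stieltjes_re x z / stieltjes_im x z)"
    by simp
  also have "arctan \<dots> = pi / 2 - arctan (stieltjes_re x z / stieltjes_im x z)"
    using p arctan_inverse[of "stieltjes_re x z / stieltjes_im x z"] by (simp add: inverse_eq_divide)
  finally show ?thesis .
qed

lemma phase_branch_eq:
  assumes a: "a < 1" and z: "z > 0"
  shows "phase_branch a z - pi / 2 = z - Re (phase_defect (1 - a) (of_real z))"
  using Arg_Stieltjes_gamma_rotated[of "1 - a" z] phase_defect_of_real[of "1 - a" z] assms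
  by (simp add: phase_branch_def)

lemma rotated_gamma_polar:
  assumes a: "a < 1" and z: "z > 0"
  shows "rotated_gamma a z = of_real (norm (rotated_gamma a z)) * exp (\<i> * of_real (phase_branch a z))"
    and "rotated_gamma a z \<noteq> 0"
proof -
  define S where "S = Stieltjes_gamma (1 - a) (- (\<i> * of_real z))"
  have x: "1 - a > 0" using a by simp
  have c: "z powr a / Gamma (1 - a) > 0" using Gamma_real_pos[OF x] z by simp
  have S0: "S \<noteq> 0" using stieltjes_pos(1)[OF x z] by (auto simp: S_def stieltjes_re_def)
  have "norm (rotated_gamma a z) = z powr a / Gamma (1 - a) * norm S"
    unfolding rotated_gamma_eq[OF assms] S_def[symmetric] norm_mult norm_of_real using c
    by (simp add: abs_of_pos[OF Gamma_real_pos[OF x]])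
  moreover have "exp (\<i> * of_real (phase_branch a z)) = exp (\<i> * of_real z) * exp (\<i> * of_real (Arg S))"
    by (simp add: phase_branch_def S_def distrib_left exp_add)
  moreover have "S = of_real (norm S) * exp (\<i> * of_real (Arg S))" by (rule Arg_eq[OF S0])
  ultimately show "rotated_gamma a z = of_real (norm (rotated_gamma a z)) * exp (\<i> * of_real (phase_branch a z))"
    unfolding rotated_gamma_eq[OF assms] S_def[symmetric] by (metis (no_types, lifting) mult.assoc mult.commute of_real_mult)
  show "rotated_gamma a z \<noteq> 0"
    unfolding rotated_gamma_eq[OF assms] S_def[symmetric] using c S0 by auto
qed

text \<open>Dominated convergence. On a strip \<open>x\<^sub>1 < x < x\<^sub>2\<close>, \<open>z > z\<^sub>0\<close> the sum of the two extreme weights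
divided by \<open>z\<^sub>0\<close> dominates.\<close>

lemma continuous_on_rotated_Stieltjes_gamma:
  assumes x: "0 < x1" and z0: "0 < z0"
  shows "continuous_on ({x1<..<x2} \<times> {z0<..})
           (\<lambda>(x, z). Stieltjes_gamma x (- (\<i> * of_real z)))"
  unfolding continuous_on_sequentially
proof (intro ballI allI impI, elim conjE)
  fix X :: "nat \<Rightarrow> real \<times> real" and p :: "real \<times> real"
  assume p: "p \<in> {x1<..<x2} \<times> {z0<..}" and X: "\<forall>n. X n \<in> {x1<..<x2} \<times> {z0<..}"
    and lim: "X \<longlonglongrightarrow> p"
  define k where "k = (\<lambda>x z t. gamma_weight x t *\<^sub>R (1 / (of_real t + - (\<i> * complex_of_real z))))"
  have S: "Stieltjes_gamma x (- (\<i> * of_real z)) = (LINT t|lborel. k x z t)" for x z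
    unfolding Stieltjes_gamma_def k_def by (rule integral_gamma_measure) measurable
  define x z xs zs where "x = fst p" and "z = snd p" and "xs = (\<lambda>n. fst (X n))" and "zs = (\<lambda>n. snd (X n))"
  have limx: "xs \<longlonglongrightarrow> x" and limz: "zs \<longlonglongrightarrow> z"
    using tendsto_fst[OF lim] tendsto_snd[OF lim] by (simp_all add: x_def z_def xs_def zs_def)
  have xb: "x1 < xs n" "xs n < x2" and zb: "z0 < zs n" for n
    using X by (auto simp: xs_def zs_def mem_Times_iff)
  have xp: "x > 0" and zp: "z > 0" and x2: "x2 > 0"
    using p x z0 by (auto simp: x_def z_def mem_Times_iff)
  have bound: "norm (k u v t) \<le> (gamma_weight x1 t + gamma_weight x2 t) * (1 / z0)"
    if "x1 < u" "u < x2" "z0 < v" for u v t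
  proof (cases "t > 0")
    case True
    have "t powr (u - 1) \<le> t powr (x1 - 1) + t powr (x2 - 1)"
    proof (cases "t \<le> 1")
      case True
      then have "t powr (u - 1) \<le> t powr (x1 - 1)" using that \<open>t > 0\<close> by (intro powr_mono') auto
      then show ?thesis by (smt (verit) powr_ge_zero)
    next
      case False
      then have "t powr (u - 1) \<le> t powr (x2 - 1)" using that by (intro powr_mono) auto
      then show ?thesis by (smt (verit) powr_ge_zero)
    qed
    then have 1: "gamma_weight u t \<le> gamma_weight x1 t + gamma_weight x2 t"
      using True by (simp add: gamma_weight_def flip: distrib_right)
    have "norm (of_real t + - (\<i> * complex_of_real v)) \<ge> v"
      using abs_Im_le_cmod[of "of_real t + - (\<i> * complex_of_real v)"] by simp
    then have 2: "norm (1 / (of_real t + - (\<i> * complex_of_real v))) \<le> 1 / z0"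
      using that z0 by (simp add: norm_divide frac_le)
    show ?thesis
      using mult_mono[OF 1 2] by (simp add: k_def gamma_weight_nonneg)
  qed (simp add: k_def gamma_weight_def)
  have "(\<lambda>n. LINT t|lborel. k (xs n) (zs n) t) \<longlonglongrightarrow> (LINT t|lborel. k x z t)"
  proof (rule integral_dominated_convergence)
    show "k x z \<in> borel_measurable lborel" unfolding k_def by measurable
    show "k (xs n) (zs n) \<in> borel_measurable lborel" for n unfolding k_def by measurable
    show "integrable lborel (\<lambda>t. (gamma_weight x1 t + gamma_weight x2 t) * (1 / z0))"
      using gamma_weight_has_bochner_integral[OF x] gamma_weight_has_bochner_integral[OF x2]
      by (auto simp: has_bochner_integral_iff)
    show "AE t in lborel. norm (k (xs n) (zs n) t) \<le> (gamma_weight x1 t + gamma_weight x2 t) * (1 / z0)" for n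
      by (intro AE_I2 bound xb zb)
    show "AE t in lborel. (\<lambda>n. k (xs n) (zs n) t) \<longlonglongrightarrow> k x z t"
    proof (intro AE_I2)
      fix t :: real
      show "(\<lambda>n. k (xs n) (zs n) t) \<longlonglongrightarrow> k x z t"
      proof (cases "t > 0")
        case True
        have nz: "of_real t + - (\<i> * complex_of_real z) \<noteq> 0" using zp by (auto simp: complex_eq_iff)
        have "(\<lambda>n. (t powr (xs n - 1) * exp (- t)) *\<^sub>R (1 / (of_real t + - (\<i> * complex_of_real (zs n)))))
           \<longlonglongrightarrow> (t powr (x - 1) * exp (- t)) *\<^sub>R (1 / (of_real t + - (\<i> * complex_of_real z)))"
          using True nz by (intro tendsto_intros limx limz) auto
        then show ?thesis using True by (simp add: k_def gamma_weight_def)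
      qed (simp add: k_def gamma_weight_def)
    qed
  qed
  then show "((\<lambda>(x, z). Stieltjes_gamma x (- (\<i> * of_real z))) \<circ> X) \<longlonglongrightarrow> (\<lambda>(x, z). Stieltjes_gamma x (- (\<i> * of_real z))) p"
    by (simp add: o_def case_prod_unfold S xs_def zs_def x_def z_def)
qed

lemma continuous_on_Stieltjes_gamma_jointly:
  "continuous_on ({..<1} \<times> {0<..}) (\<lambda>(a, z). Stieltjes_gamma (1 - a) (- (\<i> * of_real z)))"
proof -
  let ?g = "\<lambda>(x, z). Stieltjes_gamma x (- (\<i> * complex_of_real z))"
  have "continuous_on ({0<..} \<times> {0<..}) ?g"
  proof (intro continuous_at_imp_continuous_on ballI)
    fix p :: "real \<times> real" assume p: "p \<in> {0<..} \<times> {0<..}"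
    then have pos: "fst p > 0" "snd p > 0" by auto
    have o: "open ({fst p / 2<..<fst p + 1} \<times> {snd p / 2<..})" by (intro open_Times) auto
    have "p \<in> {fst p / 2<..<fst p + 1} \<times> {snd p / 2<..}" using pos by (auto simp: mem_Times_iff)
    with continuous_on_rotated_Stieltjes_gamma[of "fst p / 2" "snd p / 2" "fst p + 1"] pos o
    show "isCont ?g p" by (auto simp: continuous_on_eq_continuous_at)
  qed
  then have "continuous_on ({..<1} \<times> {0<..}) (\<lambda>q. ?g ((\<lambda>(a, z). (1 - a, z)) q))"
    by (rule continuous_on_compose2) (auto intro!: continuous_intros simp: case_prod_unfold)
  then show ?thesis by (simp add: case_prod_unfold)
qed

text \<open>The upper bound shows that the phase is a principal argument for small \<open>z\<close>, so that its limit at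
the origin can be computed from that of the rotated gamma function.\<close>

lemma phase_branch_bounds:
  assumes a: "a < 1" and z: "z > 0"
  shows "z < phase_branch a z" "phase_branch a z < z + pi / 2"
proof -
  have x: "1 - a > 0" using a by simp
  have "stieltjes_re (1 - a) z / stieltjes_im (1 - a) z > 0" using stieltjes_pos[OF x z] by simp
  then show "z < phase_branch a z" "phase_branch a z < z + pi / 2"
    unfolding phase_branch_def Arg_Stieltjes_gamma_rotated[OF x z]
    using arctan_ubound zero_less_arctan_iff by auto
qed

lemma eventually_Arg_rotated_gamma:
  assumes a: "a < 1"
  shows "eventually (\<lambda>z. Arg (rotated_gamma a z) = phase_branch a z) (at_right 0)"
proof -
  have "eventually (\<lambda>z. z \<in> {0<..<1}) (at_right (0::real))"
    by (rule eventually_at_right_real) simp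
  then show ?thesis
  proof eventually_elim
    case (elim z)
    then have z: "z > 0" "z < 1" by auto
    have "pi > 2" using pi_gt3 by simp
    then show ?case
      using phase_branch_bounds[OF a z(1)] rotated_gamma_polar[OF a z(1)] z
      by (intro Arg_unique[of "norm (rotated_gamma a z)"]) auto
  qed
qed

text \<open>For \<open>a > 0\<close> the defining integral converges at the origin, and dominated convergence applies
because \<open>\<bar>t - \<i> z\<bar> \<ge> t\<close>.\<close>

lemma rotated_gamma_at_zero_pos:
  assumes a: "0 < a" "a < 1"
  shows "(rotated_gamma a \<longlongrightarrow> exp (of_real (pi / 2) * \<i> * of_real a) * of_real (Gamma a)) (at_right 0)"
  unfolding tendsto_at_iff_sequentially
proof (intro allI impI)
  fix Z :: "nat \<Rightarrow> real" assume Z: "\<forall>i. Z i \<in> {0<..} - {0}" and lim: "Z \<longlonglongrightarrow> 0"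
  define f where "f = (\<lambda>z t. indicat_real {0<..} t *\<^sub>R ((- (\<i> * of_real z) + complex_of_real t) powr (of_real a - 1) * exp (- (- (\<i> * of_real z) + complex_of_real t))))"
  have Zp: "Z n > 0" for n using Z by auto
  have "(\<lambda>n. LINT t|lborel. f (Z n) t) \<longlonglongrightarrow> (LINT t|lborel. complex_of_real (gamma_weight a t))"
  proof (rule integral_dominated_convergence)
    show "(\<lambda>t. complex_of_real (gamma_weight a t)) \<in> borel_measurable lborel" by measurable
    show "f (Z n) \<in> borel_measurable lborel" for n unfolding f_def by measurable
    show "integrable lborel (gamma_weight a)"
      using gamma_weight_has_bochner_integral[OF a(1)] by (simp add: has_bochner_integral_iff)
    show "AE t in lborel. norm (f (Z n) t) \<le> gamma_weight a t" for n
    proof (intro AE_I2)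
      fix t :: real
      show "norm (f (Z n) t) \<le> gamma_weight a t"
      proof (cases "t > 0")
        case True
        have "t \<le> norm (- (\<i> * of_real (Z n)) + complex_of_real t)"
          using abs_Re_le_cmod[of "- (\<i> * of_real (Z n)) + complex_of_real t"] by simp
        then have "norm (- (\<i> * of_real (Z n)) + complex_of_real t) powr (a - 1) \<le> t powr (a - 1)"
          using True a by (intro powr_mono2') auto
        then have "norm ((- (\<i> * of_real (Z n)) + complex_of_real t) powr (of_real a - 1)) \<le> t powr (a - 1)"
          using norm_powr_real_powr'[of "of_real a - 1" "- (\<i> * of_real (Z n)) + complex_of_real t"] by simp
        then show ?thesis using True by (simp add: f_def gamma_weight_def norm_mult)
      qed (simp add: f_def gamma_weight_def)
    qed
    show "AE t in lborel. (\<lambda>n. f (Z n) t) \<longlonglongrightarrow> complex_of_real (gamma_weight a t)"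
    proof (intro AE_I2)
      fix t :: real
      show "(\<lambda>n. f (Z n) t) \<longlonglongrightarrow> complex_of_real (gamma_weight a t)"
      proof (cases "t > 0")
        case True
        have c: "- (\<i> * of_real 0) + complex_of_real t \<notin> \<real>\<^sub>\<le>\<^sub>0" using True by simp
        have "isCont (\<lambda>\<zeta>. \<zeta> powr (of_real a - 1) * exp (- \<zeta>)) (- (\<i> * of_real 0) + complex_of_real t)"
          using c by (intro continuous_intros isCont_powr_complex) auto
        moreover have "(\<lambda>n. - (\<i> * of_real (Z n)) + complex_of_real t) \<longlonglongrightarrow> - (\<i> * of_real 0) + complex_of_real t"
          by (intro tendsto_intros lim)
        ultimately have "(\<lambda>n. (- (\<i> * of_real (Z n)) + complex_of_real t) powr (of_real a - 1) * exp (- (- (\<i> * of_real (Z n)) + complex_of_real t)))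
           \<longlonglongrightarrow> (- (\<i> * of_real 0) + complex_of_real t) powr (of_real a - 1) * exp (- (- (\<i> * of_real 0) + complex_of_real t))"
          by (rule isCont_tendsto_compose)
        moreover have "complex_of_real t powr (of_real a - 1) = of_real (t powr (a - 1))"
          using True powr_of_real[of t "a - 1"] by simp
        ultimately show ?thesis using True by (simp add: f_def gamma_weight_def flip: exp_of_real)
      qed (simp add: f_def gamma_weight_def)
    qed
  qed
  moreover have "(LINT t|lborel. complex_of_real (gamma_weight a t)) = of_real (Gamma a)"
    using gamma_weight_has_bochner_integral[OF a(1)] by (simp add: has_bochner_integral_iff)
  moreover have "upper_Gamma (of_real a) (- (\<i> * of_real (Z n))) = (LINT t|lborel. f (Z n) t)" for n
    using upper_Gamma_eq_Stieltjes_gamma(1)[OF a(2), of "- (\<i> * of_real (Z n))"] Zp[of n]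
    by (simp add: f_def set_lebesgue_integral_def)
  ultimately have "(\<lambda>n. upper_Gamma (of_real a) (- (\<i> * of_real (Z n)))) \<longlonglongrightarrow> of_real (Gamma a)" by simp
  then have "(\<lambda>n. exp (of_real (pi / 2) * \<i> * of_real a) * upper_Gamma (of_real a) (- (\<i> * of_real (Z n))))
      \<longlonglongrightarrow> exp (of_real (pi / 2) * \<i> * of_real a) * of_real (Gamma a)"
    by (intro tendsto_intros)
  then show "(rotated_gamma a \<circ> Z) \<longlonglongrightarrow> exp (of_real (pi / 2) * \<i> * of_real a) * of_real (Gamma a)"
    unfolding o_def rotated_gamma_def exp_minus_half_pi by (simp add: mult.commute[of _ \<i>])
qed

lemma phase_branch_at_zero_pos:
  assumes a: "0 < a" "a < 1"
  shows "(phase_branch a \<longlongrightarrow> pi / 2 * a) (at_right 0)"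
proof -
  define c where "c = exp (of_real (pi / 2) * \<i> * of_real a) * complex_of_real (Gamma a)"
  have pa: "pi / 2 * a < pi / 2" using a by simp
  have c_eq: "of_real (Gamma a) * exp (\<i> * of_real (pi / 2 * a)) = c" by (simp add: c_def mult_ac)
  have Arg_c: "Arg c = pi / 2 * a"
    by (rule Arg_unique[OF c_eq Gamma_real_pos[OF a(1)]]) (use a pa in \<open>auto intro: less_trans[of _ 0]\<close>)
  have "c \<notin> \<real>\<^sub>\<le>\<^sub>0"
  proof
    assume "c \<in> \<real>\<^sub>\<le>\<^sub>0"
    then have "Im c = 0" by (simp add: complex_nonpos_Reals_iff)
    moreover have "0 < pi / 2 * a" using a by simp
    ultimately show False using Arg_c Arg_lt_pi[of c] pa by auto
  qed
  then have "((\<lambda>z. Arg (rotated_gamma a z)) \<longlongrightarrow> Arg c) (at_right 0)"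
    using isCont_tendsto_compose[OF continuous_at_Arg rotated_gamma_at_zero_pos[OF a]] by (simp add: c_def)
  then show ?thesis
    unfolding Arg_c by (rule Lim_transform_eventually) (rule eventually_Arg_rotated_gamma[OF a(2)])
qed

text \<open>For \<open>a \<le> 0\<close> the derivative \<open>- z\<^sup>a\<^sup>-\<^sup>1 e\<^sup>\<i>\<^sup>z\<close> forces the real part to infinity
at least logarithmically, and by l'Hospital's rule the ratio of imaginary and real part behaves like
\<open>tan z\<close>.\<close>

lemma phase_branch_at_zero_nonpos:
  assumes a: "a \<le> 0"
  shows "(phase_branch a \<longlongrightarrow> 0) (at_right 0)"
proof -
  have a1: "a < 1" using a by simp
  have dR: "((\<lambda>z. Re (rotated_gamma a z)) has_real_derivative - (z powr (a - 1) * cos z)) (at z)"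
    and dI: "((\<lambda>z. Im (rotated_gamma a z)) has_real_derivative - (z powr (a - 1) * sin z)) (at z)"
    if "z > 0" for z
    using has_field_derivative_Re[OF rotated_gamma_derivative[OF a1 that]]
      has_field_derivative_Im[OF rotated_gamma_derivative[OF a1 that]]
    by (simp_all add: Re_exp Im_exp)
  have near: "eventually (\<lambda>z. z \<in> {0<..<1}) (at_right (0::real))"
    by (rule eventually_at_right_real) simp
  have cos_ge: "cos z \<ge> cos 1" "cos z > 0" if "0 < z" "z < 1" for z :: real
    using that pi_gt3 by (auto intro!: cos_monotone_0_pi_le cos_gt_zero_pi)
  have cos1: "cos (1::real) > 0" using pi_gt3 by (intro cos_gt_zero_pi) auto
  have ge: "Re (rotated_gamma a z) \<ge> Re (rotated_gamma a 1) - cos 1 * ln z" if "0 < z" "z < 1" for z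
  proof -
    have "Re (rotated_gamma a z) + cos 1 * ln z \<ge> Re (rotated_gamma a 1) + cos 1 * ln 1"
    proof (rule DERIV_nonpos_imp_nonincreasing[where f = "\<lambda>z. Re (rotated_gamma a z) + cos 1 * ln z"])
      show "z \<le> 1" using that by simp
      fix s assume s: "z \<le> s" "s \<le> 1"
      then have s0: "s > 0" using that by simp
      have "s powr (- 1) \<le> s powr (a - 1)" using s s0 a by (intro powr_mono') auto
      moreover have "cos 1 \<le> cos s" using s s0 pi_gt3 by (intro cos_monotone_0_pi_le) auto
      ultimately have "s powr (-1) * cos 1 \<le> s powr (a - 1) * cos s"
        using cos1 by (intro mult_mono) auto
      then have "- (s powr (a - 1) * cos s) + cos 1 * (1 / s) \<le> 0"
        using s0 by (simp add: powr_minus field_simps)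
      moreover have "((\<lambda>z. Re (rotated_gamma a z) + cos 1 * ln z) has_real_derivative - (s powr (a - 1) * cos s) + cos 1 * (1 / s)) (at s)"
        by (rule DERIV_add[OF dR[OF s0] DERIV_cmult[OF DERIV_ln_divide[OF s0]]])
      ultimately show "\<exists>y. ((\<lambda>z. Re (rotated_gamma a z) + cos 1 * ln z) has_real_derivative y) (at s) \<and> y \<le> 0"
        by blast
    qed
    then show ?thesis by simp
  qed
  have top: "LIM z at_right 0. Re (rotated_gamma a z) :> at_top"
  proof (rule filterlim_at_top_mono)
    show "LIM z at_right 0. Re (rotated_gamma a 1) - cos 1 * ln z :> at_top"
      using cos1 by real_asymp
    show "eventually (\<lambda>z. Re (rotated_gamma a 1) - cos 1 * ln z \<le> Re (rotated_gamma a z)) (at_right 0)"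
      using near by eventually_elim (use ge in auto)
  qed
  have "((\<lambda>z. Im (rotated_gamma a z) / Re (rotated_gamma a z)) \<longlongrightarrow> 0) (at_right 0)"
  proof (rule lhopital_right_at_top[OF top])
    show "eventually (\<lambda>z. - (z powr (a - 1) * cos z) \<noteq> 0) (at_right 0)"
      using near by eventually_elim (use cos_ge(2) in fastforce)
    show "eventually (\<lambda>z. ((\<lambda>z. Im (rotated_gamma a z)) has_real_derivative - (z powr (a - 1) * sin z)) (at z)) (at_right 0)"
      using near by eventually_elim (simp add: dI)
    show "eventually (\<lambda>z. ((\<lambda>z. Re (rotated_gamma a z)) has_real_derivative - (z powr (a - 1) * cos z)) (at z)) (at_right 0)"
      using near by eventually_elim (simp add: dR)
    have "((\<lambda>z. tan z) \<longlongrightarrow> tan 0) (at_right (0::real))" by (intro tendsto_intros) auto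
    then have "((\<lambda>z. tan z) \<longlongrightarrow> 0) (at_right (0::real))" by simp
    then show "((\<lambda>z. - (z powr (a - 1) * sin z) / - (z powr (a - 1) * cos z)) \<longlongrightarrow> 0) (at_right 0)"
      by (rule Lim_transform_eventually)
         (use near in \<open>eventually_elim, auto simp: tan_def\<close>)
  qed
  then have "((\<lambda>z. arctan (Im (rotated_gamma a z) / Re (rotated_gamma a z))) \<longlongrightarrow> arctan 0) (at_right 0)"
    by (intro tendsto_intros)
  moreover have "eventually (\<lambda>z. Re (rotated_gamma a z) > 0) (at_right 0)"
    using top by (auto simp: filterlim_at_top_dense)
  then have "eventually (\<lambda>z. arctan (Im (rotated_gamma a z) / Re (rotated_gamma a z)) = phase_branch a z) (at_right 0)"
    using eventually_Arg_rotated_gamma[OF a1]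
    by eventually_elim (simp add: arg_conv_arctan)
  ultimately show ?thesis by (simp add: Lim_transform_eventually)
qed

lemma is_modulus_phase_branch:
  "is_modulus_phase (\<lambda>a z. norm (rotated_gamma a z)) phase_branch"
  unfolding is_modulus_phase_def
proof (intro conjI allI impI)
  let ?D = "{..<1} \<times> {0<..} :: (real \<times> real) set"
  have notcut: "Stieltjes_gamma (1 - a) (- (\<i> * of_real z)) \<notin> \<real>\<^sub>\<le>\<^sub>0" if "a < 1" "z > 0" for a z
    using stieltjes_pos(1)[of "1 - a" z] that by (simp add: stieltjes_re_def complex_nonpos_Reals_iff)
  have "continuous_on ?D (\<lambda>p. z_of p + Arg (case p of (a, z) \<Rightarrow> Stieltjes_gamma (1 - a) (- (\<i> * of_real z))))"
    if "continuous_on ?D z_of" for z_of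
    by (intro continuous_intros that continuous_on_Stieltjes_gamma_jointly) (auto simp: notcut)
  from this[of snd] show "continuous_on ?D (\<lambda>(a, z). phase_branch a z)"
    by (simp add: phase_branch_def case_prod_unfold continuous_intros)
  have G: "continuous_on ?D (\<lambda>p. Gamma (1 - fst p))"
    by (rule continuous_on_compose2[OF continuous_on_Gamma[of "{0<..}"]])
       (auto intro!: continuous_intros dest!: nonpos_Ints_nonpos)
  have "continuous_on ?D (\<lambda>p. snd p powr fst p / Gamma (1 - fst p) *
      norm (case p of (a, z) \<Rightarrow> Stieltjes_gamma (1 - a) (- (\<i> * of_real z))))"
    by (intro continuous_intros continuous_on_Stieltjes_gamma_jointly G)
       (auto simp: Gamma_eq_zero_iff dest!: nonpos_Ints_nonpos)
  then show "continuous_on ?D (\<lambda>(a, z). norm (rotated_gamma a z))"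
  proof (rule continuous_on_eq)
    fix p assume "p \<in> ?D"
    then have p: "fst p < 1" "snd p > 0" by auto
    then have "Gamma (1 - fst p) > 0" by (intro Gamma_real_pos) auto
    then show "snd p powr fst p / Gamma (1 - fst p) * norm (case p of (a, z) \<Rightarrow> Stieltjes_gamma (1 - a) (- (\<i> * of_real z)))
       = (case p of (a, z) \<Rightarrow> norm (rotated_gamma a z))"
      using p by (simp add: case_prod_unfold rotated_gamma_eq norm_mult norm_divide)
  qed
  fix a :: real assume a: "a < 1"
  show "(phase_branch a \<longlongrightarrow> pi / 4 * (a + \<bar>a\<bar>)) (at_right 0)"
    using phase_branch_at_zero_pos[OF _ a] phase_branch_at_zero_nonpos[of a] by (cases "a > 0") auto
  fix z :: real assume z: "z > 0"
  show "norm (rotated_gamma a z) > 0" using rotated_gamma_polar(2)[OF a z] by simp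
  show "of_real (norm (rotated_gamma a z)) * exp (\<i> * of_real (phase_branch a z)) =
          exp (of_real (pi / 2) * \<i> * of_real a) *
          upper_Gamma (of_real a) (of_real z * exp (- (of_real (pi / 2) * \<i>)))"
    using rotated_gamma_polar(1)[OF a z] unfolding rotated_gamma_def by simp
qed

text \<open>Two phases of the same function differ by a continuous function with values in \<open>2 \<pi> \<int>\<close>,
which is constant; the prescribed limit at the origin makes it zero. Hence the choice operator in
the definition of the phase picks the explicit branch.\<close>

lemma is_modulus_phase_unique:
  assumes mp: "is_modulus_phase M \<phi>" and a: "a < 1" and z: "z > 0"
  shows "\<phi> a z = phase_branch a z"
proof -
  define d where "d = (\<lambda>z. \<phi> a z - phase_branch a z)"
  have c1: "continuous_on ({..<1} \<times> {0<..}) (\<lambda>(a, z). \<phi> a z)"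
    and c2: "continuous_on ({..<1} \<times> {0<..}) (\<lambda>(a, z). phase_branch a z)"
    using mp is_modulus_phase_branch by (auto simp: is_modulus_phase_def)
  have emb: "continuous_on {0<..} (\<lambda>z. (a, z))" "(\<lambda>z. (a, z)) ` {0<..} \<subseteq> {..<1} \<times> {0<..}"
    using a by (auto intro!: continuous_intros)
  have cont: "continuous_on {0<..} d"
    unfolding d_def using continuous_on_compose2[OF c1 emb] continuous_on_compose2[OF c2 emb]
    by (auto intro!: continuous_intros)
  have int: "\<exists>n::int. d z = of_int n * (2 * pi)" if z: "z > 0" for z
  proof -
    have M: "M a z > 0" "of_real (M a z) * exp (\<i> * of_real (\<phi> a z)) = rotated_gamma a z"
      using mp a z by (auto simp: is_modulus_phase_def rotated_gamma_def)
    have "M a z = norm (rotated_gamma a z)"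
      using M by (simp flip: M(2) add: norm_mult)
    then have "complex_of_real (M a z) * exp (\<i> * of_real (\<phi> a z)) = of_real (M a z) * exp (\<i> * of_real (phase_branch a z))"
      using M(2) rotated_gamma_polar(1)[OF a z] by simp
    then have "exp (\<i> * of_real (\<phi> a z)) = exp (\<i> * of_real (phase_branch a z))"
      using M(1) by simp
    then obtain n :: int where
      n: "\<i> * of_real (\<phi> a z) = \<i> * of_real (phase_branch a z) + complex_of_real (real_of_int (2 * n) * pi) * \<i>"
      unfolding exp_eq by blast
    have "\<phi> a z = phase_branch a z + of_int n * (2 * pi)"
      using arg_cong[OF n, of Im] by simp
    then show ?thesis by (auto simp: d_def)
  qed
  have "d constant_on {0<..}"
  proof (rule continuous_discrete_range_constant[OF _ cont])
    show "connected {0::real<..}" by simp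
    fix u :: real assume u: "u \<in> {0<..}"
    show "\<exists>e>0. \<forall>y. y \<in> {0<..} \<and> d y \<noteq> d u \<longrightarrow> e \<le> norm (d y - d u)"
    proof (intro exI[of _ "2 * pi"] conjI allI impI)
      fix y assume y: "y \<in> {0<..} \<and> d y \<noteq> d u"
      obtain m n :: int where mn: "d y = of_int m * (2 * pi)" "d u = of_int n * (2 * pi)"
        using int[of y] int[of u] y u by auto
      then have "m \<noteq> n" using y by auto
      then have "1 \<le> \<bar>m - n\<bar>" by simp
      then have "1 \<le> \<bar>real_of_int (m - n)\<bar>" by (metis of_int_1_le_iff of_int_abs)
      moreover have "d y - d u = real_of_int (m - n) * (2 * pi)" by (simp add: mn algebra_simps)
      ultimately show "2 * pi \<le> norm (d y - d u)" by (simp add: abs_mult)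
    qed simp
  qed
  then obtain k where k: "d u = k" if "u > 0" for u by (auto simp: constant_on_def)
  have "(d \<longlongrightarrow> pi / 4 * (a + \<bar>a\<bar>) - pi / 4 * (a + \<bar>a\<bar>)) (at_right 0)"
    unfolding d_def using mp is_modulus_phase_branch a
    by (intro tendsto_diff) (auto simp: is_modulus_phase_def)
  moreover have "(d \<longlongrightarrow> k) (at_right 0)"
    by (rule tendsto_eventually) (auto intro: eventually_mono[OF eventually_at_right_less] k)
  ultimately have "k = 0" using tendsto_unique[of "at_right (0::real)" d] by fastforce
  then show ?thesis using k[OF z] by (simp add: d_def)
qed

lemma phase_eq_phase_branch:
  assumes "a < 1" "z > 0"
  shows "phase a z = phase_branch a z"
proof -
  have "\<exists>M. is_modulus_phase M phase"
    unfolding phase_def by (rule someI_ex[of "\<lambda>\<phi>. \<exists>M. is_modulus_phase M \<phi>"]) (use is_modulus_phase_branch in blast)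
  then show ?thesis using is_modulus_phase_unique assms by blast
qed

section \<open>The coefficients are monic rational polynomials\<close>

text \<open>Tracking the coefficient of a nominal degree \<open>d\<close>, possibly zero, rather than the degree itself makes
leading coefficients add and multiply without case distinctions.\<close>

definition rational_polynomial_on_pos :: "nat \<Rightarrow> real \<Rightarrow> (real \<Rightarrow> real) \<Rightarrow> bool" where
  "rational_polynomial_on_pos d c f \<longleftrightarrow>
     (\<exists>p. degree p \<le> d \<and> coeff p d = c \<and> (\<forall>i. coeff p i \<in> \<rat>) \<and> (\<forall>x>0. f x = poly p x))"

lemma rational_polynomial_add:
  assumes "rational_polynomial_on_pos d b f" "rational_polynomial_on_pos d c g"
  shows "rational_polynomial_on_pos d (b + c) (\<lambda>x. f x + g x)"
proof -
  from assms obtain p q where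
    "degree p \<le> d" "coeff p d = b" "\<forall>i. coeff p i \<in> \<rat>" "\<forall>x>0. f x = poly p x"
    "degree q \<le> d" "coeff q d = c" "\<forall>i. coeff q i \<in> \<rat>" "\<forall>x>0. g x = poly q x"
    unfolding rational_polynomial_on_pos_def by blast
  then show ?thesis unfolding rational_polynomial_on_pos_def
    by (intro exI[of _ "p + q"]) (auto intro: degree_add_le Rats_add)
qed

lemma rational_polynomial_mult:
  assumes "rational_polynomial_on_pos d b f" "rational_polynomial_on_pos e c g"
  shows "rational_polynomial_on_pos (d + e) (b * c) (\<lambda>x. f x * g x)"
proof -
  from assms obtain p q where pq:
    "degree p \<le> d" "coeff p d = b" "\<forall>i. coeff p i \<in> \<rat>" "\<forall>x>0. f x = poly p x"
    "degree q \<le> e" "coeff q e = c" "\<forall>i. coeff q i \<in> \<rat>" "\<forall>x>0. g x = poly q x"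
    unfolding rational_polynomial_on_pos_def by blast
  have "coeff (p * q) (d + e) = b * c"
  proof -
    have "coeff p i * coeff q (d + e - i) = (if i = d then b * c else 0)" if "i \<le> d + e" for i
      using that pq(1,2,5,6) by (cases i d rule: linorder_cases) (auto simp: coeff_eq_0)
    then have "coeff (p * q) (d + e) = (\<Sum>i\<le>d + e. if i = d then b * c else 0)"
      unfolding coeff_mult by (intro sum.cong) auto
    then show ?thesis by simp
  qed
  moreover have "coeff (p * q) i \<in> \<rat>" for i
    unfolding coeff_mult using pq by (intro Rats_sum Rats_mult) auto
  moreover have "degree (p * q) \<le> d + e"
    using degree_mult_le[of p q] pq by linarith
  ultimately show ?thesis unfolding rational_polynomial_on_pos_def
    using pq by (intro exI[of _ "p * q"]) auto
qed

lemma rational_polynomial_const: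
  "c \<in> \<rat> \<Longrightarrow> rational_polynomial_on_pos 0 c (\<lambda>_. c)"
  unfolding rational_polynomial_on_pos_def
  by (intro exI[of _ "[:c:]"]) (auto simp: coeff_pCons split: nat.split)

lemma rational_polynomial_cmult:
  assumes "c \<in> \<rat>" "rational_polynomial_on_pos d b f"
  shows "rational_polynomial_on_pos d (c * b) (\<lambda>x. c * f x)"
  using rational_polynomial_mult[OF rational_polynomial_const[OF assms(1)] assms(2)] by simp

lemma rational_polynomial_shifted_ident:
  "c \<in> \<rat> \<Longrightarrow> rational_polynomial_on_pos 1 1 (\<lambda>x. x + c)"
  unfolding rational_polynomial_on_pos_def
  by (intro exI[of _ "[:c, 1:]"]) (auto simp: coeff_pCons split: nat.split)

lemma rational_polynomial_weaken:
  assumes "rational_polynomial_on_pos d b f" "d < e"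
  shows "rational_polynomial_on_pos e 0 f"
  using assms unfolding rational_polynomial_on_pos_def by (meson coeff_eq_0 le_less_trans less_imp_le order_trans)

lemma rational_polynomial_sum:
  assumes "finite I" "\<And>i. i \<in> I \<Longrightarrow> rational_polynomial_on_pos d (c i) (f i)"
  shows "rational_polynomial_on_pos d (\<Sum>i\<in>I. c i) (\<lambda>x. \<Sum>i\<in>I. f i x)"
  using assms
proof (induction I rule: finite_induct)
  case empty
  show ?case unfolding rational_polynomial_on_pos_def by (intro exI[of _ 0]) auto
next
  case (insert i I)
  then show ?case by (simp add: rational_polynomial_add)
qed

lemma rational_polynomial_prod:
  assumes "finite I" "\<And>i. i \<in> I \<Longrightarrow> rational_polynomial_on_pos 1 1 (f i)"
  shows "rational_polynomial_on_pos (card I) 1 (\<lambda>x. \<Prod>i\<in>I. f i x)"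
  using assms
proof (induction I rule: finite_induct)
  case empty
  show ?case using rational_polynomial_const[of 1] by simp
next
  case (insert i I)
  then show ?case using rational_polynomial_mult[of 1 1 "f i" "card I" 1] by simp
qed

lemma rational_polynomial_cong:
  assumes "rational_polynomial_on_pos d c f" "\<And>x. x > 0 \<Longrightarrow> f x = g x"
  shows "rational_polynomial_on_pos d c g"
  using assms unfolding rational_polynomial_on_pos_def by auto

text \<open>The denominators in the recurrence always cancel, because \<open>x + j\<close> is one of the factors of the
Pochhammer symbol.\<close>

lemma rational_polynomial_pochhammer_quotient:
  assumes "j < m"
  shows "rational_polynomial_on_pos (m - 1) 1 (\<lambda>x. pochhammer x m / (real j + x))"
proof -
  have "rational_polynomial_on_pos (card ({0..<m} - {j})) 1 (\<lambda>x. \<Prod>i\<in>{0..<m} - {j}. x + real i)"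
    by (intro rational_polynomial_prod rational_polynomial_shifted_ident) auto
  moreover have "card ({0..<m} - {j}) = m - 1" using assms by simp
  moreover have "(\<Prod>i\<in>{0..<m} - {j}. x + real i) = pochhammer x m / (real j + x)" if "x > 0" for x
    using prod.remove[of "{0..<m}" j "\<lambda>i. x + real i"] assms that
    by (simp add: pochhammer_prod field_simps)
  ultimately show ?thesis by (auto intro: rational_polynomial_cong)
qed

text \<open>All terms of the recurrence have nominal degree \<open>2 n + 1\<close>. If the earlier leading coefficients are
\<open>1\<close>, the new one is \<open>(n + 1) - n = 1\<close>.\<close>

lemma t_coeff_polynomial: "rational_polynomial_on_pos (2 * n + 1) 1 (\<lambda>x. t_coeff x n)"
proof (induction n rule: less_induct)
  case (less n)
  show ?case
  proof (cases "n = 0")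
    case True
    then show ?thesis using rational_polynomial_shifted_ident[of 0] by simp
  next
    case False
    then have n: "n \<ge> 1" by simp
    have 1: "rational_polynomial_on_pos (2 * n + 1) (real n + 1)
        (\<lambda>x. (real n + 1) * (pochhammer x (2 * n + 2) / (real (n + 1) + x)))"
      using rational_polynomial_cmult[OF _ rational_polynomial_pochhammer_quotient[of "n + 1" "2 * n + 2"], of "real n + 1"]
      by (simp add: Rats_add)
    have "rational_polynomial_on_pos (2 * n + 1) (\<Sum>k=1..n. 1)
        (\<lambda>x. \<Sum>k=1..n. pochhammer x (2 * k + 1) / (real k + x) * t_coeff x (n - k))"
    proof (rule rational_polynomial_sum)
      fix k assume k: "k \<in> {1..n}"
      have "rational_polynomial_on_pos (2 * k + 1 - 1 + (2 * (n - k) + 1)) (1 * 1)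
         (\<lambda>x. pochhammer x (2 * k + 1) / (real k + x) * t_coeff x (n - k))"
        using k by (intro rational_polynomial_mult rational_polynomial_pochhammer_quotient less.IH) auto
      moreover have "2 * k + 1 - 1 + (2 * (n - k) + 1) = 2 * n + 1" using k by auto
      ultimately show "rational_polynomial_on_pos (2 * n + 1) 1
         (\<lambda>x. pochhammer x (2 * k + 1) / (real k + x) * t_coeff x (n - k))" by simp
    qed simp
    from rational_polynomial_add[OF 1 rational_polynomial_cmult[of "-1", OF _ this]]
    have "rational_polynomial_on_pos (2 * n + 1) 1
        (\<lambda>x. (real n + 1) * (pochhammer x (2 * n + 2) / (real (n + 1) + x)) +
           (-1) * (\<Sum>k=1..n. pochhammer x (2 * k + 1) / (real k + x) * t_coeff x (n - k)))"
      by (simp add: Rats_minus_iff)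
    then show ?thesis
      by (rule rational_polynomial_cong) (use n in \<open>simp add: algebra_simps\<close>)
  qed
qed

text \<open>With \<open>y = 1 / z\<^sup>2\<close>, the function to be inverted is asymptotically \<open>z\<close> times this series.\<close>

definition base_series :: "real \<Rightarrow> real fps" where
  "base_series x = 1 - fps_X * Abs_fps (\<lambda>k. (-1) ^ k * t_coeff x k / real (2 * k + 1))"

lemma base_series_nth_0 [simp]: "fps_nth (base_series x) 0 = 1"
  by (simp add: base_series_def)

lemma base_series_nth_Suc:
  "fps_nth (base_series x) (Suc k) = (-1) ^ Suc k * t_coeff x k / real (2 * k + 1)"
  by (simp add: base_series_def)

text \<open>The coefficient of index \<open>j \<ge> 1\<close> of the base has degree \<open>2 j - 1\<close>. In a product of powers, a term
that splits \<open>j\<close> into two positive parts has degree \<open>2 j - 2\<close> only, so leading coefficients are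
additive in the exponent.\<close>

lemma base_series_power_polynomial:
  assumes "j \<ge> 1"
  shows "rational_polynomial_on_pos (2 * j - 1) (real m * ((-1) ^ j / real (2 * j - 1)))
           (\<lambda>x. fps_nth (base_series x ^ m) j)"
  using assms
proof (induction m arbitrary: j)
  case 0
  then show ?case using rational_polynomial_weaken[OF rational_polynomial_const[of 0], of "2 * j - 1"] by simp
next
  case (Suc m)
  have base: "rational_polynomial_on_pos (2 * i - 1) ((-1) ^ i / real (2 * i - 1)) (\<lambda>x. fps_nth (base_series x) i)"
    if i: "i \<ge> 1" for i
  proof -
    obtain k where k: "i = Suc k" using i by (cases i) auto
    have "(-1) ^ Suc k / real (2 * k + 1) \<in> \<rat>" by (intro Rats_divide Rats_power) auto
    from rational_polynomial_cmult[OF this t_coeff_polynomial[of k]] show ?thesis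
      unfolding k base_series_nth_Suc by simp
  qed
  define c where "c = (\<lambda>i. if i = 0 then real m * ((-1) ^ j / real (2 * j - 1))
                           else if i = j then (-1) ^ j / real (2 * j - 1) else 0)"
  have "rational_polynomial_on_pos (2 * j - 1) (\<Sum>i=0..j. c i)
      (\<lambda>x. \<Sum>i=0..j. fps_nth (base_series x) i * fps_nth (base_series x ^ m) (j - i))"
  proof (rule rational_polynomial_sum)
    fix i assume i: "i \<in> {0..j}"
    consider "i = 0" | "i = j" "i \<noteq> 0" | "0 < i" "i < j" using i by fastforce
    then show "rational_polynomial_on_pos (2 * j - 1) (c i)
        (\<lambda>x. fps_nth (base_series x) i * fps_nth (base_series x ^ m) (j - i))"
    proof cases
      case 1
      then show ?thesis using Suc.IH[OF Suc.prems] by (simp add: c_def)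
    next
      case 2
      then show ?thesis using base[of j] Suc.prems by (simp add: c_def fps_power_zeroth)
    next
      case 3
      have "rational_polynomial_on_pos (2 * i - 1 + (2 * (j - i) - 1))
          ((-1) ^ i / real (2 * i - 1) * (real m * ((-1) ^ (j - i) / real (2 * (j - i) - 1))))
          (\<lambda>x. fps_nth (base_series x) i * fps_nth (base_series x ^ m) (j - i))"
        using 3 by (intro rational_polynomial_mult base Suc.IH) auto
      then show ?thesis using 3 by (auto simp: c_def intro: rational_polynomial_weaken)
    qed
  qed simp
  moreover have "(\<Sum>i=0..j. c i) = real (Suc m) * ((-1) ^ j / real (2 * j - 1))"
  proof -
    have "(\<Sum>i=0..j. c i) = c 0 + (\<Sum>i=1..j. c i)"
      by (simp add: sum.atLeast_Suc_atMost)
    also have "(\<Sum>i=1..j. c i) = (\<Sum>i=1..j. if i = j then (-1) ^ j / real (2 * j - 1) else 0)"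
      by (intro sum.cong) (auto simp: c_def)
    also have "\<dots> = (-1) ^ j / real (2 * j - 1)" using Suc.prems by simp
    finally show ?thesis by (simp add: c_def algebra_simps add_divide_distrib)
  qed
  ultimately show ?case by (simp add: fps_mult_nth)
qed

lemma c_coeff_base_series:
  "c_coeff n x = (-1) ^ (n + 1) * fps_nth (base_series x ^ (2 * n + 1)) (n + 1)"
  by (simp add: c_coeff_def base_series_def)

lemma c_coeff_polynomial:
  "\<exists>p :: real poly. degree p = 2 * n + 1 \<and> lead_coeff p = 1 \<and> (\<forall>i. coeff p i \<in> \<rat>) \<and>
      (\<forall>x>0. c_coeff n x = poly p x)"
proof -
  have "rational_polynomial_on_pos (2 * (n + 1) - 1)
       ((-1) ^ (n + 1) * (real (2 * n + 1) * ((-1) ^ (n + 1) / real (2 * (n + 1) - 1))))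
       (\<lambda>x. (-1) ^ (n + 1) * fps_nth (base_series x ^ (2 * n + 1)) (n + 1))"
    by (intro rational_polynomial_cmult base_series_power_polynomial Rats_power) auto
  moreover have "(-1) ^ (n + 1) * (real (2 * n + 1) * ((-1) ^ (n + 1) / real (2 * (n + 1) - 1))) = 1"
    by (cases "even n") auto
  moreover have "2 * (n + 1) - 1 = 2 * n + 1" by simp
  ultimately have "rational_polynomial_on_pos (2 * n + 1) 1 (\<lambda>x. c_coeff n x)"
    unfolding c_coeff_base_series by simp
  then obtain p where p: "degree p \<le> 2 * n + 1" "coeff p (2 * n + 1) = 1" "\<forall>i. coeff p i \<in> \<rat>"
    "\<forall>x>0. c_coeff n x = poly p x" unfolding rational_polynomial_on_pos_def by blast
  have "degree p = 2 * n + 1" using p le_degree[of p "2 * n + 1"] by simp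
  then show ?thesis using p by auto
qed

section \<open>Lagrange inversion for odd series\<close>

lemma fps_X_fps_deriv_nth: "fps_nth (fps_X * fps_deriv f) n = real n * fps_nth f n"
  for f :: "real fps"
  by (cases n) auto

text \<open>In terms of \<open>h z = z B (1 / z\<^sup>2)\<close> the left-hand side is a coefficient of \<open>h\<^sup>q h'\<close>, and the
lemma says that the derivative of \<open>h\<^sup>q\<^sup>+\<^sup>1\<close> has no residue.\<close>

lemma Lagrange_residue:
  fixes B :: "real fps"
  shows "fps_nth (B ^ q * (B - 2 * fps_X * fps_deriv B)) s
           = (1 - 2 * real s / real (q + 1)) * fps_nth (B ^ (q + 1)) s"
proof -
  have "fps_nth (fps_X * fps_deriv (B ^ (q + 1))) s = real s * fps_nth (B ^ (q + 1)) s"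
    by (rule fps_X_fps_deriv_nth)
  moreover have "fps_X * fps_deriv (B ^ (q + 1)) = of_nat (q + 1) * (B ^ q * (fps_X * fps_deriv B))"
  proof -
    have "fps_deriv (B ^ (q + 1)) = fps_const (of_nat (q + 1)) * fps_deriv B * B ^ (q + 1 - 1)"
      by (rule fps_deriv_power)
    then show ?thesis by (simp only: add_diff_cancel_right' fps_of_nat mult_ac)
  qed
  ultimately have "real (q + 1) * fps_nth (B ^ q * (fps_X * fps_deriv B)) s = real s * fps_nth (B ^ (q + 1)) s"
    by (metis fps_mult_of_nat_nth(1))
  then have r: "fps_nth (B ^ q * (fps_X * fps_deriv B)) s = real s / real (q + 1) * fps_nth (B ^ (q + 1)) s"
    by (simp add: field_simps)
  have "B ^ q * (B - 2 * fps_X * fps_deriv B) = B ^ (q + 1) - fps_const 2 * (B ^ q * (fps_X * fps_deriv B))"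
    by (simp add: algebra_simps numeral_fps_const)
  then have "fps_nth (B ^ q * (B - 2 * fps_X * fps_deriv B)) s
      = fps_nth (B ^ (q + 1)) s - 2 * (real s / real (q + 1) * fps_nth (B ^ (q + 1)) s)"
    by (simp only: fps_sub_nth fps_mult_left_const_nth r)
  also have "A - 2 * (real s / real (q + 1) * A) = (1 - 2 * real s / real (q + 1)) * A" for A
    by (simp add: left_diff_distrib)
  finally show ?thesis .
qed

text \<open>If \<open>h z = z B (1 / z\<^sup>2)\<close>, this is the coefficient of \<open>w\<^sup>-\<^sup>2\<^sup>n\<^sup>-\<^sup>1\<close> in the inverse
series of \<open>w = h z\<close>.\<close>

definition Lagrange_coeff :: "real fps \<Rightarrow> nat \<Rightarrow> real" where
  "Lagrange_coeff B n = - fps_nth (B ^ (2 * n + 1)) (n + 1) / real (2 * n + 1)"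

text \<open>Divided by \<open>z\<close>, the claim is \<open>h + \<Sum> d\<^sub>n h\<^sup>-\<^sup>2\<^sup>n\<^sup>-\<^sup>1 = z\<close> up to higher order. Adding
the term \<open>n = m\<close> changes only coefficients from index \<open>m + 1\<close> on. That first coefficient is
extracted as the residue against \<open>h\<^sup>2\<^sup>m h'\<close>: by \<open>Lagrange_residue\<close>, the powers of \<open>h\<close>
contribute nothing except \<open>h\<^sup>-\<^sup>2\<^sup>m\<^sup>-\<^sup>1\<close>, which cancels the contribution of \<open>z\<close>.\<close>

lemma Lagrange_inversion_inverse:
  fixes B :: "real fps"
  assumes B0: "fps_nth B 0 = 1" and j: "j \<le> m"
  shows "fps_nth (B + (\<Sum>n<m. fps_const (Lagrange_coeff B n) * fps_X ^ (n + 1) * inverse B ^ (2 * n + 1)) - 1) j = 0"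
  using j
proof (induction m arbitrary: j)
  case 0
  then show ?case by (simp add: B0)
next
  case (Suc m)
  define e where "e = (\<lambda>m. B + (\<Sum>n<m. fps_const (Lagrange_coeff B n) * fps_X ^ (n + 1) * inverse B ^ (2 * n + 1)) - 1)"
  define W where "W = B - 2 * fps_X * fps_deriv B"
  have BB: "inverse B * B = 1" using B0 by (intro inverse_mult_eq_1) simp
  have inv_pow: "inverse B ^ k * B ^ (k + l) = B ^ l" for k l
    using BB by (simp add: power_add flip: mult.assoc power_mult_distrib)
  have low: "fps_nth (e (Suc m)) i = 0" if "i \<le> m" for i
  proof -
    have "e (Suc m) = e m + fps_const (Lagrange_coeff B m) * (fps_X ^ (m + 1) * inverse B ^ (2 * m + 1))"
      by (simp add: e_def algebra_simps)
    moreover have "fps_nth (e m) i = 0" using Suc.IH[OF that] by (simp add: e_def)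
    ultimately show ?thesis using that by (simp add: fps_X_power_mult_nth del: power_Suc)
  qed
  have top: "fps_nth (e (Suc m)) (Suc m) = 0"
  proof -
    \<comment> \<open>all lower coefficients vanish, so the residue isolates the coefficient of index \<open>m + 1\<close>\<close>
    have "fps_nth (e (Suc m) * (B ^ (2 * m) * W)) (Suc m)
        = (\<Sum>i=0..Suc m. fps_nth (e (Suc m)) i * fps_nth (B ^ (2 * m) * W) (Suc m - i))"
      by (rule fps_mult_nth)
    also have "\<dots> = fps_nth (e (Suc m)) (Suc m)"
      using low by (simp add: W_def B0 fps_power_zeroth)
    finally have L: "fps_nth (e (Suc m)) (Suc m) = fps_nth (e (Suc m) * (B ^ (2 * m) * W)) (Suc m)" ..
    have tm: "fps_const c * fps_X ^ (n + 1) * inverse B ^ (2 * n + 1) * (B ^ (2 * m) * W)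
       = fps_const c * (fps_X ^ (n + 1) * (B ^ (2 * (m - n) - 1) * W))" if "n < m" for n c
    proof -
      have "2 * m = (2 * n + 1) + (2 * (m - n) - 1)" using that by simp
      then have "inverse B ^ (2 * n + 1) * B ^ (2 * m) = B ^ (2 * (m - n) - 1)" using inv_pow by metis
      then show ?thesis by (metis mult.assoc)
    qed
    have t1: "fps_nth (fps_const (Lagrange_coeff B n) * fps_X ^ (n + 1) * inverse B ^ (2 * n + 1) * (B ^ (2 * m) * W)) (Suc m) = 0"
      if "n < m" for n
    proof -
      have "fps_nth (B ^ (2 * (m - n) - 1) * W) (m - n) = 0"
        unfolding W_def Lagrange_residue using that by (simp add: of_nat_diff)
      then show ?thesis unfolding tm[OF that] using that by (simp add: fps_X_power_mult_nth del: power_Suc)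
    qed
    have t2: "fps_nth (fps_const (Lagrange_coeff B m) * fps_X ^ (m + 1) * inverse B ^ (2 * m + 1) * (B ^ (2 * m) * W)) (Suc m) = Lagrange_coeff B m"
    proof -
      have "inverse B ^ (2 * m + 1) * (B ^ (2 * m) * W) = inverse B * W"
      proof -
        have "inverse B ^ (2 * m + 1) * (B ^ (2 * m) * W) = (inverse B ^ (2 * m) * B ^ (2 * m)) * (inverse B * W)"
          by (simp only: power_add power_one_right mult_ac)
        then show ?thesis using inv_pow[of "2 * m" 0] by simp
      qed
      then have eq: "fps_const (Lagrange_coeff B m) * fps_X ^ (m + 1) * inverse B ^ (2 * m + 1) * (B ^ (2 * m) * W)
        = fps_const (Lagrange_coeff B m) * (fps_X ^ (m + 1) * (inverse B * W))" by (metis mult.assoc)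
      show ?thesis by (subst eq) (simp add: fps_X_power_mult_nth W_def B0 del: power_Suc)
    qed
    have t3: "fps_nth (B * (B ^ (2 * m) * W)) (Suc m) = 0"
    proof -
      have "B * (B ^ (2 * m) * W) = B ^ (2 * m + 1) * W" by (simp add: mult.assoc)
      then show ?thesis unfolding W_def by (simp only: Lagrange_residue) (simp add: field_simps)
    qed
    have t4: "fps_nth (B ^ (2 * m) * W) (Suc m) = Lagrange_coeff B m"
      unfolding W_def Lagrange_residue by (simp add: Lagrange_coeff_def field_simps)
    \<comment> \<open>the terms with \<open>n < m\<close> have residue zero, the last one cancels the residue of \<open>z\<close>\<close>
    define G where "G = (\<lambda>n. fps_const (Lagrange_coeff B n) * fps_X ^ (n + 1) * inverse B ^ (2 * n + 1) * (B ^ (2 * m) * W))"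
    have "(\<Sum>n<m. fps_nth (G n) (Suc m)) = 0"
      by (intro sum.neutral ballI) (simp only: G_def t1 lessThan_iff)
    moreover have "fps_nth (G m) (Suc m) = Lagrange_coeff B m" unfolding G_def by (rule t2)
    ultimately have sG: "fps_nth (\<Sum>n<Suc m. G n) (Suc m) = Lagrange_coeff B m"
      by (simp only: sum.lessThan_Suc fps_add_nth fps_sum_nth add_0_left)
    have "e (Suc m) * (B ^ (2 * m) * W) = B * (B ^ (2 * m) * W) + (\<Sum>n<Suc m. G n) - B ^ (2 * m) * W"
      unfolding e_def G_def by (simp only: distrib_right left_diff_distrib sum_distrib_right mult_1_left)
    then have "fps_nth (e (Suc m) * (B ^ (2 * m) * W)) (Suc m) = 0 + Lagrange_coeff B m - Lagrange_coeff B m"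
      by (simp only: fps_add_nth fps_sub_nth t3 t4 sG)
    then show ?thesis unfolding L by simp
  qed
  show ?case using low top Suc.prems by (cases "j = Suc m") (auto simp: e_def)
qed

text \<open>The same identity with denominators cleared, so that asymptotic series can be substituted using
sums and products only.\<close>

lemma Lagrange_inversion:
  fixes B :: "real fps"
  assumes B0: "fps_nth B 0 = 1" and j: "j \<le> m + 1"
  shows "fps_nth (B ^ (2 * m + 2) + (\<Sum>n\<le>m. fps_const (Lagrange_coeff B n) * fps_X ^ (n + 1) * B ^ (2 * (m - n)))
           - B ^ (2 * m + 1)) j = 0"
proof -
  define e where "e = B + (\<Sum>n<m + 1. fps_const (Lagrange_coeff B n) * fps_X ^ (n + 1) * inverse B ^ (2 * n + 1)) - 1"
  have e0: "fps_nth e i = 0" if "i \<le> m + 1" for i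
    unfolding e_def by (rule Lagrange_inversion_inverse[OF B0 that])
  have BB: "inverse B * B = 1" using B0 by (intro inverse_mult_eq_1) simp
  have inv_pow: "inverse B ^ k * B ^ (k + l) = B ^ l" for k l
    using BB by (simp add: power_add flip: mult.assoc power_mult_distrib)
  have "fps_const c * fps_X ^ (n + 1) * inverse B ^ (2 * n + 1) * B ^ (2 * m + 1) = fps_const c * fps_X ^ (n + 1) * B ^ (2 * (m - n))"
    if "n < m + 1" for n c
  proof -
    have "2 * m + 1 = (2 * n + 1) + 2 * (m - n)" using that by simp
    then have "inverse B ^ (2 * n + 1) * B ^ (2 * m + 1) = B ^ (2 * (m - n))" using inv_pow by metis
    then show ?thesis by (metis mult.assoc)
  qed
  then have "(\<Sum>n<m + 1. fps_const (Lagrange_coeff B n) * fps_X ^ (n + 1) * inverse B ^ (2 * n + 1)) * B ^ (2 * m + 1)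
     = (\<Sum>n\<le>m. fps_const (Lagrange_coeff B n) * fps_X ^ (n + 1) * B ^ (2 * (m - n)))"
    unfolding sum_distrib_right by (intro sum.cong) (auto simp: less_Suc_eq_le)
  then have "B ^ (2 * m + 2) + (\<Sum>n\<le>m. fps_const (Lagrange_coeff B n) * fps_X ^ (n + 1) * B ^ (2 * (m - n))) - B ^ (2 * m + 1)
     = e * B ^ (2 * m + 1)"
    unfolding e_def by (simp add: distrib_right left_diff_distrib)
  moreover have "fps_nth (e * B ^ (2 * m + 1)) j = 0"
    unfolding fps_mult_nth using j by (intro sum.neutral) (auto simp: e0)
  ultimately show ?thesis by simp
qed

lemma Lagrange_coeff_base_series:
  "Lagrange_coeff (base_series x) n = (-1) ^ n * c_coeff n x / real (2 * n + 1)"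
  by (cases "even n") (auto simp: Lagrange_coeff_def c_coeff_base_series)

section \<open>The recurrence as an identity of power series\<close>

definition even_pochhammer_series :: "real \<Rightarrow> real fps" where
  "even_pochhammer_series x = Abs_fps (\<lambda>n. (-1) ^ n * pochhammer x (2 * n))"

definition odd_pochhammer_series :: "real \<Rightarrow> real fps" where
  "odd_pochhammer_series x = Abs_fps (\<lambda>n. (-1) ^ n * pochhammer x (2 * n + 1))"

text \<open>The expansion of \<open>h'\<close> in powers of \<open>1 / z\<^sup>2\<close>.\<close>

definition derivative_series :: "real \<Rightarrow> real fps" where
  "derivative_series x = 1 + fps_X * Abs_fps (\<lambda>k. (-1) ^ k * t_coeff x k)"

text \<open>Let \<open>q\<close> and \<open>p\<close> be the even and odd series and \<open>D = q\<^sup>2 + y p\<^sup>2\<close>. The functional equation of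
Pochhammer symbols gives \<open>p = x q + 2 y q'\<close> and \<open>1 - q = y ((x + 1) p + 2 y p')\<close>; together they
yield \<open>y D' + x D = p\<close>, whose coefficients are the claim.\<close>

lemma sum_of_squares_series_nth:
  assumes "x > 0"
  shows "fps_nth (even_pochhammer_series x ^ 2 + fps_X * odd_pochhammer_series x ^ 2) k
           = (-1) ^ k * pochhammer x (2 * k + 1) / (real k + x)"
proof -
  define q where "q = even_pochhammer_series x"
  define p where "p = odd_pochhammer_series x"
  define D where "D = q ^ 2 + fps_X * p ^ 2"
  have 1: "p = fps_const x * q + 2 * (fps_X * fps_deriv q)"
    by (rule fps_ext) (simp add: p_def q_def odd_pochhammer_series_def even_pochhammer_series_def
        fps_X_fps_deriv_nth pochhammer_Suc algebra_simps numeral_fps_const)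
  have 2: "1 - q = fps_X * (fps_const (x + 1) * p + 2 * (fps_X * fps_deriv p))"
  proof (rule fps_ext)
    fix n show "fps_nth (1 - q) n = fps_nth (fps_X * (fps_const (x + 1) * p + 2 * (fps_X * fps_deriv p))) n"
    proof (cases n)
      case 0
      then show ?thesis by (simp add: q_def even_pochhammer_series_def)
    next
      case (Suc k)
      then show ?thesis
        by (simp add: p_def q_def odd_pochhammer_series_def even_pochhammer_series_def
          fps_X_fps_deriv_nth pochhammer_Suc algebra_simps numeral_fps_const)
    qed
  qed
  have "fps_X * fps_deriv D = q * (2 * (fps_X * fps_deriv q)) + fps_X * p ^ 2 + p * (fps_X * (2 * (fps_X * fps_deriv p)))"
    by (simp add: D_def fps_deriv_power power2_eq_square algebra_simps)
  also have "2 * (fps_X * fps_deriv q) = p - fps_const x * q" using 1 by simp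
  also have "fps_X * (2 * (fps_X * fps_deriv p)) = 1 - q - fps_X * (fps_const (x + 1) * p)" using 2 by (simp add: algebra_simps)
  also have "q * (p - fps_const x * q) + fps_X * p ^ 2 + p * (1 - q - fps_X * (fps_const (x + 1) * p))
     = p - fps_const x * D"
    by (simp add: D_def power2_eq_square algebra_simps flip: fps_const_add)
  finally have "fps_nth (fps_X * fps_deriv D) k = fps_nth (p - fps_const x * D) k" by simp
  then have "(real k + x) * fps_nth D k = fps_nth p k" unfolding fps_X_fps_deriv_nth by (simp add: algebra_simps)
  moreover have "real k + x > 0" using assms by (simp add: add_nonneg_pos)
  ultimately have "fps_nth D k = fps_nth p k / (real k + x)" by (simp add: field_simps)
  then show ?thesis by (simp add: D_def q_def p_def) (simp add: odd_pochhammer_series_def)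
qed

text \<open>This is the recurrence for \<open>t\<^sub>k\<close> in closed form: its sum is the convolution with the coefficients
of \<open>D\<close>, and its first term absorbs the shift caused by the constant term of the series.\<close>

lemma derivative_series_identity:
  assumes x: "x > 0"
  shows "(even_pochhammer_series x ^ 2 + fps_X * odd_pochhammer_series x ^ 2) * derivative_series x
           = even_pochhammer_series x"
proof (rule fps_ext)
  fix n
  define D where "D = even_pochhammer_series x ^ 2 + fps_X * odd_pochhammer_series x ^ 2"
  have D: "fps_nth D k = (-1) ^ k * pochhammer x (2 * k + 1) / (real k + x)" for k
    unfolding D_def by (rule sum_of_squares_series_nth[OF x])
  have rec: "t_coeff x n + (\<Sum>k=1..n. pochhammer x (2 * k + 1) / (real k + x) * t_coeff x (n - k))
      = (real n + 1) / (real n + x + 1) * pochhammer x (2 * n + 2)" for n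
  proof (cases "n = 0")
    case True
    have "pochhammer x (Suc (Suc 0)) = x * (x + 1)" by (simp add: pochhammer_Suc)
    then show ?thesis using True x by simp
  next
    case False
    then show ?thesis by simp
  qed
  show "fps_nth (D * derivative_series x) n = fps_nth (even_pochhammer_series x) n"
  proof (cases n)
    case 0
    then show ?thesis using x by (simp add: D derivative_series_def even_pochhammer_series_def)
  next
    case (Suc m)
    define T where "T = Abs_fps (\<lambda>k. (-1) ^ k * t_coeff x k)"
    have "D * derivative_series x = D + fps_X * (D * T)" by (simp add: derivative_series_def T_def algebra_simps)
    then have "fps_nth (D * derivative_series x) n = fps_nth D (Suc m) + fps_nth (D * T) m"
      by (simp add: Suc)
    also have "fps_nth (D * T) m = (\<Sum>k=0..m. (-1) ^ m * (pochhammer x (2 * k + 1) / (real k + x) * t_coeff x (m - k)))"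
      unfolding fps_mult_nth
    proof (rule sum.cong)
      fix k assume "k \<in> {0..m}"
      then have "(-1::real) ^ k * (-1) ^ (m - k) = (-1) ^ m" by (simp flip: power_add)
      then show "fps_nth D k * fps_nth T (m - k) = (-1) ^ m * (pochhammer x (2 * k + 1) / (real k + x) * t_coeff x (m - k))"
        by (simp add: D T_def)
    qed simp
    also have "\<dots> = (-1) ^ m * (t_coeff x m + (\<Sum>k=1..m. pochhammer x (2 * k + 1) / (real k + x) * t_coeff x (m - k)))"
      unfolding sum_distrib_left[symmetric] using x by (simp add: sum.atLeast_Suc_atMost)
    also have "\<dots> = (-1) ^ m * ((real m + 1) / (real m + x + 1) * pochhammer x (2 * m + 2))" by (simp only: rec)
    also have "fps_nth D (Suc m) = - ((-1) ^ m * (pochhammer x (2 * m + 2) * (x + 2 * real m + 2) / (real m + x + 1)))"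
    proof -
      have ps: "pochhammer x (2 * Suc m + 1) = pochhammer x (2 * m + 2) * (x + 2 * real m + 2)"
        using pochhammer_Suc[of x "2 * m + 2"] by (simp add: algebra_simps)
      have "real (Suc m) + x = real m + x + 1" by simp
      then show ?thesis unfolding D ps by (simp only: power_Suc) simp
    qed
    also have "- ((-1) ^ m * (pochhammer x (2 * m + 2) * (x + 2 * real m + 2) / (real m + x + 1)))
        + (-1) ^ m * ((real m + 1) / (real m + x + 1) * pochhammer x (2 * m + 2)) = (-1) ^ Suc m * pochhammer x (2 * m + 2)"
    proof -
      have "real m + x + 1 > 0" using x by simp
      then show ?thesis by (simp add: divide_simps) (simp add: algebra_simps)
    qed
    finally show ?thesis by (simp add: even_pochhammer_series_def Suc)
  qed
qed

lemma base_series_from_derivative_series: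
  "fps_nth (base_series x) j = fps_nth (derivative_series x) j / (1 - 2 * real j)"
  by (cases j) (simp_all add: base_series_nth_Suc derivative_series_def divide_simps algebra_simps)

section \<open>Asymptotic power series at the origin\<close>

definition fps_truncation :: "nat \<Rightarrow> real fps \<Rightarrow> real poly" where
  "fps_truncation N A = (\<Sum>n<N. monom (fps_nth A n) n)"

text \<open>Poincare expansions, formulated with truncation polynomials so that products reduce to the algebra
of polynomials.\<close>

definition has_asymptotic_series :: "(real \<Rightarrow> real) \<Rightarrow> real fps \<Rightarrow> bool" where
  "has_asymptotic_series f A \<longleftrightarrow>
     (\<forall>N. (\<lambda>y. f y - poly (fps_truncation N A) y) \<in> O[at_right 0](\<lambda>y. y ^ N))"

lemma coeff_fps_truncation: "coeff (fps_truncation N A) i = (if i < N then fps_nth A i else 0)"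
  by (simp add: fps_truncation_def coeff_sum)

lemma poly_fps_truncation: "poly (fps_truncation N A) y = (\<Sum>n<N. fps_nth A n * y ^ n)"
  by (simp add: fps_truncation_def poly_sum poly_monom)

lemma poly_bounded_at_0: "poly p \<in> O[at_right 0](\<lambda>_. 1 :: real)"
proof -
  have "((poly p) \<longlongrightarrow> poly p 0) (at_right 0)" by (intro tendsto_intros)
  then have "((\<lambda>y. poly p y / 1) \<longlongrightarrow> poly p 0) (at_right 0)" by simp
  then show ?thesis by (rule bigoI_tendsto) simp
qed

lemma poly_bigo_power:
  assumes "\<And>i. i < N \<Longrightarrow> coeff p i = 0"
  shows "poly p \<in> O[at_right 0](\<lambda>y :: real. y ^ N)"
proof -
  have "monom 1 N dvd p" using assms by (simp add: monom_1_dvd_iff')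
  then obtain q where q: "p = monom 1 N * q" by (auto elim: dvdE)
  have "(\<lambda>y. y ^ N * poly q y) \<in> O[at_right 0](\<lambda>y. y ^ N * 1)"
    by (intro landau_o.big_mult poly_bounded_at_0) simp
  moreover have "poly p = (\<lambda>y. y ^ N * poly q y)" by (rule ext) (simp add: q poly_monom)
  ultimately show ?thesis by simp
qed

text \<open>Any polynomial with the right low-order coefficients may replace the truncation.\<close>

lemma has_asymptotic_seriesI:
  assumes "\<And>N. \<exists>p. (\<lambda>y. f y - poly p y) \<in> O[at_right 0](\<lambda>y. y ^ N) \<and> (\<forall>i<N. coeff p i = fps_nth A i)"
  shows "has_asymptotic_series f A"
  unfolding has_asymptotic_series_def
proof
  fix N
  obtain p where p: "(\<lambda>y. f y - poly p y) \<in> O[at_right 0](\<lambda>y. y ^ N)" "\<forall>i<N. coeff p i = fps_nth A i"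
    using assms by blast
  have "poly (p - fps_truncation N A) \<in> O[at_right 0](\<lambda>y. y ^ N)"
    by (rule poly_bigo_power) (use p in \<open>auto simp: coeff_fps_truncation\<close>)
  from sum_in_bigo(1)[OF p(1) this]
  show "(\<lambda>y. f y - poly (fps_truncation N A) y) \<in> O[at_right 0](\<lambda>y. y ^ N)" by simp
qed

lemma has_asymptotic_series_bounded:
  assumes "has_asymptotic_series f A"
  shows "f \<in> O[at_right 0](\<lambda>_. 1)"
  using assms[unfolded has_asymptotic_series_def, rule_format, of 0] by (simp add: fps_truncation_def)

lemma has_asymptotic_series_tendsto:
  assumes "has_asymptotic_series f A"
  shows "(f \<longlongrightarrow> fps_nth A 0) (at_right 0)"
proof -
  have "(\<lambda>y. f y - fps_nth A 0) \<in> O[at_right 0](\<lambda>y. y)"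
    using assms[unfolded has_asymptotic_series_def, rule_format, of 1] by (simp add: poly_fps_truncation)
  moreover have "(\<lambda>y::real. y) \<in> o[at_right 0](\<lambda>_. 1)"
    by (intro smalloI_tendsto) (auto intro!: tendsto_eq_intros)
  ultimately have "(\<lambda>y. f y - fps_nth A 0) \<in> o[at_right 0](\<lambda>_. 1)"
    by (rule landau_o.big_small_trans)
  then have "((\<lambda>y. f y - fps_nth A 0) \<longlongrightarrow> 0) (at_right 0)"
    using smalloD_tendsto by fastforce
  then show ?thesis by (simp add: LIM_zero_iff)
qed

lemma has_asymptotic_series_poly: "has_asymptotic_series (poly p) (fps_of_poly p)"
  by (rule has_asymptotic_seriesI) (auto intro!: exI[of _ p])

lemma has_asymptotic_series_const: "has_asymptotic_series (\<lambda>_. c) (fps_const c)"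
proof -
  have "poly [:c:] = (\<lambda>_. c)" by (rule ext) simp
  then show ?thesis using has_asymptotic_series_poly[of "[:c:]"] by (simp add: fps_of_poly_const)
qed

lemma has_asymptotic_series_ident: "has_asymptotic_series (\<lambda>y. y) fps_X"
proof -
  have "poly [:0, 1:] = (\<lambda>y :: real. y)" by (rule ext) simp
  then show ?thesis using has_asymptotic_series_poly[of "[:0, 1:]"] by (simp add: fps_of_poly_pCons)
qed

lemma has_asymptotic_series_add:
  assumes "has_asymptotic_series f A" "has_asymptotic_series g B"
  shows "has_asymptotic_series (\<lambda>y. f y + g y) (A + B)"
proof (rule has_asymptotic_seriesI)
  fix N
  have "(\<lambda>y. (f y - poly (fps_truncation N A) y) + (g y - poly (fps_truncation N B) y)) \<in> O[at_right 0](\<lambda>y. y ^ N)"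
    using assms unfolding has_asymptotic_series_def by (intro sum_in_bigo(1)[of "\<lambda>y. f y - poly (fps_truncation N A) y"]) auto
  then show "\<exists>p. (\<lambda>y. f y + g y - poly p y) \<in> O[at_right 0](\<lambda>y. y ^ N) \<and> (\<forall>i<N. coeff p i = fps_nth (A + B) i)"
    by (intro exI[of _ "fps_truncation N A + fps_truncation N B"]) (auto simp: coeff_fps_truncation algebra_simps)
qed

lemma has_asymptotic_series_mult:
  assumes "has_asymptotic_series f A" "has_asymptotic_series g B"
  shows "has_asymptotic_series (\<lambda>y. f y * g y) (A * B)"
proof (rule has_asymptotic_seriesI)
  fix N
  define p where "p = fps_truncation N A"
  define q where "q = fps_truncation N B"
  have "(\<lambda>y. (f y - poly p y) * g y) \<in> O[at_right 0](\<lambda>y. y ^ N * 1)"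
    using assms has_asymptotic_series_bounded[OF assms(2)]
    by (intro landau_o.big_mult) (auto simp: has_asymptotic_series_def p_def)
  moreover have "(\<lambda>y. poly p y * (g y - poly q y)) \<in> O[at_right 0](\<lambda>y. 1 * y ^ N)"
    using assms by (intro landau_o.big_mult poly_bounded_at_0) (auto simp: has_asymptotic_series_def q_def)
  ultimately have "(\<lambda>y. (f y - poly p y) * g y + poly p y * (g y - poly q y)) \<in> O[at_right 0](\<lambda>y. y ^ N)"
    by (intro sum_in_bigo) simp_all
  then have 1: "(\<lambda>y. f y * g y - poly (p * q) y) \<in> O[at_right 0](\<lambda>y. y ^ N)"
    by (simp add: algebra_simps)
  have 2: "coeff (p * q) i = fps_nth (A * B) i" if "i < N" for i
    unfolding coeff_mult fps_mult_nth atMost_atLeast0 using that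
    by (intro sum.cong) (auto simp: p_def q_def coeff_fps_truncation)
  show "\<exists>p. (\<lambda>y. f y * g y - poly p y) \<in> O[at_right 0](\<lambda>y. y ^ N) \<and> (\<forall>i<N. coeff p i = fps_nth (A * B) i)"
    using 1 2 by blast
qed

lemma has_asymptotic_series_cmult:
  "has_asymptotic_series f A \<Longrightarrow> has_asymptotic_series (\<lambda>y. c * f y) (fps_const c * A)"
  by (rule has_asymptotic_series_mult[OF has_asymptotic_series_const])

lemma has_asymptotic_series_diff:
  assumes "has_asymptotic_series f A" "has_asymptotic_series g B"
  shows "has_asymptotic_series (\<lambda>y. f y - g y) (A - B)"
  using has_asymptotic_series_add[OF assms(1) has_asymptotic_series_cmult[OF assms(2), of "-1"]]
  by (simp add: fps_const_neg[symmetric] del: fps_const_neg)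

lemma has_asymptotic_series_power:
  "has_asymptotic_series f A \<Longrightarrow> has_asymptotic_series (\<lambda>y. f y ^ k) (A ^ k)"
  by (induction k) (use has_asymptotic_series_const[of 1] in \<open>simp_all add: has_asymptotic_series_mult\<close>)

lemma has_asymptotic_series_sum:
  assumes "finite I" "\<And>i. i \<in> I \<Longrightarrow> has_asymptotic_series (f i) (A i)"
  shows "has_asymptotic_series (\<lambda>y. \<Sum>i\<in>I. f i y) (\<Sum>i\<in>I. A i)"
  using assms
  by (induction I rule: finite_induct) (use has_asymptotic_series_const[of 0] in \<open>simp_all add: has_asymptotic_series_add\<close>)

lemma has_asymptotic_series_bigo:
  assumes "has_asymptotic_series f A" "\<And>i. i < N \<Longrightarrow> fps_nth A i = 0"
  shows "f \<in> O[at_right 0](\<lambda>y. y ^ N)"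
proof -
  have "fps_truncation N A = 0" using assms(2) by (intro poly_eqI) (simp add: coeff_fps_truncation)
  then show ?thesis using assms(1)[unfolded has_asymptotic_series_def, rule_format, of N] by simp
qed

text \<open>Multiplying the claim by \<open>g\<close> turns it into a statement about \<open>f - g p\<close>, whose expansion starts
at order \<open>N\<close>.\<close>

lemma has_asymptotic_series_divide:
  assumes f: "has_asymptotic_series f A" and g: "has_asymptotic_series g B"
    and B0: "fps_nth B 0 \<noteq> 0" and AB: "B * V = A"
  shows "has_asymptotic_series (\<lambda>y. f y / g y) V"
  unfolding has_asymptotic_series_def
proof
  fix N
  define p where "p = fps_truncation N V"
  have lim: "(g \<longlongrightarrow> fps_nth B 0) (at_right 0)" by (rule has_asymptotic_series_tendsto[OF g])
  have "has_asymptotic_series (\<lambda>y. f y - g y * poly p y) (A - B * fps_of_poly p)"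
    by (intro has_asymptotic_series_diff has_asymptotic_series_mult has_asymptotic_series_poly f g)
  moreover have "fps_nth (A - B * fps_of_poly p) i = 0" if "i < N" for i
    unfolding AB[symmetric] using that
    by (simp add: fps_mult_nth p_def coeff_fps_truncation flip: sum_subtractf right_diff_distrib)
       (auto intro!: sum.neutral)
  ultimately have "(\<lambda>y. f y - g y * poly p y) \<in> O[at_right 0](\<lambda>y. y ^ N)"
    by (rule has_asymptotic_series_bigo)
  moreover have "(\<lambda>y. 1 / g y) \<in> O[at_right 0](\<lambda>_. 1)"
  proof (rule bigoI_tendsto)
    show "((\<lambda>y. 1 / g y / 1) \<longlongrightarrow> 1 / fps_nth B 0) (at_right 0)" using lim B0 by (auto intro!: tendsto_intros)
  qed simp
  ultimately have "(\<lambda>y. (f y - g y * poly p y) * (1 / g y)) \<in> O[at_right 0](\<lambda>y. y ^ N * 1)"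
    by (rule landau_o.big_mult)
  moreover have "eventually (\<lambda>y. g y \<noteq> 0) (at_right 0)" using lim B0 by (rule tendsto_imp_eventually_ne)
  then have "eventually (\<lambda>y. (f y - g y * poly p y) * (1 / g y) = f y / g y - poly p y) (at_right 0)"
    by eventually_elim (simp add: field_simps)
  ultimately show "(\<lambda>y. f y / g y - poly (fps_truncation N V) y) \<in> O[at_right 0](\<lambda>y. y ^ N)"
    by (simp add: p_def landau_o.big.in_cong)
qed

text \<open>Asymptotic expansions may be integrated. The error \<open>E\<close> has derivative \<open>O(r\<^sup>-\<^sup>2\<^sup>N)\<close> and tends
to zero at infinity; adding a suitable multiple of \<open>r\<^sup>1\<^sup>-\<^sup>2\<^sup>N\<close> to \<open>E\<close> or \<open>- E\<close> gives a
decreasing function with limit zero, hence a nonnegative one.\<close>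

lemma has_asymptotic_series_primitive:
  fixes h v :: "real \<Rightarrow> real"
  assumes deriv: "\<And>r. r > 0 \<Longrightarrow> (h has_real_derivative v (1 / r ^ 2)) (at r)"
    and v: "has_asymptotic_series v V" and V0: "fps_nth V 0 = 1"
    and lim: "((\<lambda>r. h r - r) \<longlongrightarrow> 0) at_top"
    and B: "\<And>j. fps_nth B j = fps_nth V j / (1 - 2 * real j)"
  shows "has_asymptotic_series (\<lambda>y. sqrt y * h (1 / sqrt y)) B"
proof -
  have main: "(\<lambda>y. sqrt y * h (1 / sqrt y) - poly (fps_truncation N B) y) \<in> O[at_right 0](\<lambda>y. y ^ N)"
    if N: "N \<ge> 1" for N
  proof -
    obtain c where c: "c > 0" "eventually (\<lambda>y. norm (v y - poly (fps_truncation N V) y) \<le> c * norm (y ^ N)) (at_right 0)"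
      using v[unfolded has_asymptotic_series_def, rule_format, of N] by (elim landau_o.bigE)
    then obtain e where e: "e > 0" "\<And>y. 0 < y \<Longrightarrow> y < e \<Longrightarrow> \<bar>v y - poly (fps_truncation N V) y\<bar> \<le> c * y ^ N"
      unfolding eventually_at_right_field by (auto simp: abs_mult power_abs)
    define g where "g = (\<lambda>r. \<Sum>j<N. fps_nth B j * r powi (1 - 2 * int j))"
    define E where "E = (\<lambda>r. h r - g r)"
    define K where "K = c / real (2 * N - 1)"
    have N1: "real (2 * N - 1) > 0" using N by simp
    have K: "K \<ge> 0" using c N1 by (simp add: K_def)
    have dE: "(E has_real_derivative v (1 / r ^ 2) - poly (fps_truncation N V) (1 / r ^ 2)) (at r)" if r: "r > 0" for r
    proof -
      have "((\<lambda>r. fps_nth B j * r powi (1 - 2 * int j)) has_real_derivative fps_nth V j * (1 / r ^ 2) ^ j) (at r)" for j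
      proof -
        have "((\<lambda>r. fps_nth B j * r powi (1 - 2 * int j)) has_real_derivative
           fps_nth B j * (of_int (1 - 2 * int j) * r powi (1 - 2 * int j - 1) * 1)) (at r)"
          using r by (intro DERIV_cmult DERIV_power_int) auto
        moreover have "fps_nth B j * of_int (1 - 2 * int j) = fps_nth V j"
        proof -
          have "of_int (1 - 2 * int j) = 1 - 2 * real j" by simp
          moreover have "1 - 2 * real j \<noteq> 0" by (metis calculation even_add even_mult_iff even_numeral eq_iff_diff_eq_0 odd_one of_int_eq_0_iff)
          ultimately show ?thesis by (simp add: B)
        qed
        moreover have "r powi (1 - 2 * int j - 1) = (1 / r ^ 2) ^ j"
        proof -
          have "r powi (1 - 2 * int j - 1) = r powi (- int (2 * j))" by simp
          also have "\<dots> = (1 / r ^ 2) ^ j"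
            unfolding power_int_minus power_int_of_nat by (simp add: power_mult power_divide inverse_eq_divide)
          finally show ?thesis .
        qed
        ultimately show ?thesis by (simp add: mult.assoc[symmetric])
      qed
      then have "(g has_real_derivative (\<Sum>j<N. fps_nth V j * (1 / r ^ 2) ^ j)) (at r)"
        unfolding g_def by (intro DERIV_sum)
      then show ?thesis unfolding E_def poly_fps_truncation by (intro DERIV_diff deriv[OF r])
    qed
    have Elim: "(E \<longlongrightarrow> 0) at_top"
    proof -
      obtain M where M: "N = Suc M" using N by (cases N) auto
      have geq: "g r = r + (\<Sum>j<M. fps_nth B (Suc j) * (1 / r) ^ (2 * j + 1))" if "r > 0" for r
      proof -
        have "r powi (1 - 2 * int (Suc j)) = (1 / r) ^ (2 * j + 1)" for j
        proof -
          have "r powi (1 - 2 * int (Suc j)) = r powi (- int (2 * j + 1))" by (rule arg_cong[of _ _ "\<lambda>i. r powi i"]) simp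
          also have "\<dots> = (1 / r) ^ (2 * j + 1)"
            unfolding power_int_minus power_int_of_nat by (simp add: power_divide inverse_eq_divide)
          finally show ?thesis .
        qed
        then show ?thesis unfolding g_def M sum.lessThan_Suc_shift by (simp add: B V0)
      qed
      have "((\<lambda>r. 1 / r) \<longlongrightarrow> 0) (at_top :: real filter)" by real_asymp
      then have "((\<lambda>r. (h r - r) - (\<Sum>j<M. fps_nth B (Suc j) * (1 / r) ^ (2 * j + 1))) \<longlongrightarrow>
          0 - (\<Sum>j<M. fps_nth B (Suc j) * 0 ^ (2 * j + 1))) at_top"
        by (intro tendsto_intros lim)
      then have "((\<lambda>r. (h r - r) - (\<Sum>j<M. fps_nth B (Suc j) * (1 / r) ^ (2 * j + 1))) \<longlongrightarrow> 0) at_top" by simp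
      then show ?thesis
        by (rule Lim_transform_eventually)
           (use geq in \<open>auto simp: E_def intro: eventually_mono[OF eventually_gt_at_top[of 0]]\<close>)
    qed
    have Klim: "((\<lambda>r. K * (1 / r) ^ (2 * N - 1)) \<longlongrightarrow> 0) at_top"
    proof -
      have "((\<lambda>r. 1 / r) \<longlongrightarrow> 0) (at_top :: real filter)" by real_asymp
      then have "((\<lambda>r. K * (1 / r) ^ (2 * N - 1)) \<longlongrightarrow> K * 0 ^ (2 * N - 1)) at_top" by (intro tendsto_intros)
      moreover have "(0::real) ^ (2 * N - 1) = 0" using N by (intro zero_power) simp
      ultimately show ?thesis by (simp only: mult_zero_right)
    qed
    have dK: "((\<lambda>r. K * (1 / r) ^ (2 * N - 1)) has_real_derivative - (c * (1 / r ^ 2) ^ N)) (at r)" if r: "r > 0" for r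
    proof -
      define M where "M = 2 * N - 2"
      have M: "2 * N - 1 = Suc M" "2 * N = M + 2" using N by (auto simp: M_def)
      have "((\<lambda>r. K * (1 / r) ^ (2 * N - 1)) has_real_derivative K * (real (2 * N - 1) * (1 / r) ^ M * (- 1 / r ^ 2))) (at r)"
      proof -
        have "((\<lambda>r. 1 / r) has_real_derivative - 1 / r ^ 2) (at r)"
          using r by (auto intro!: derivative_eq_intros simp: power2_eq_square)
        from DERIV_cmult[OF DERIV_power[OF this, of "Suc M"], of K]
        show ?thesis unfolding M(1) by (simp only: diff_Suc_Suc diff_zero mult_ac)
      qed
      moreover have "K * (real (2 * N - 1) * (1 / r) ^ M * (- 1 / r ^ 2)) = - (c * (1 / r ^ 2) ^ N)"
      proof -
        have "(1 / r ^ 2) ^ N = (1 / r) ^ (2 * N)" by (simp add: power_mult power_divide)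
        also have "\<dots> = (1 / r) ^ M * (1 / r ^ 2)" unfolding M(2) power_add by (simp add: power_divide)
        finally have "(1 / r ^ 2) ^ N = (1 / r) ^ M * (1 / r ^ 2)" .
        moreover have "K * real (2 * N - 1) = c" using N1 by (simp add: K_def)
        ultimately show ?thesis by (simp only: flip: mult.assoc)
      qed
      ultimately show ?thesis by simp
    qed
    \<comment> \<open>\<open>r > r0\<close> means that \<open>y = 1 / r\<^sup>2\<close> lies in the range where the bound for \<open>v\<close> is valid\<close>
    define r0 where "r0 = 1 / sqrt e"
    have r0: "r0 > 0" using e by (simp add: r0_def)
    have yb: "0 < 1 / r ^ 2" "1 / r ^ 2 < e" if "r > r0" for r
    proof -
      have rp: "r > 0" using that r0 by simp
      show "0 < 1 / r ^ 2" using rp by simp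
      have "r0 ^ 2 < r ^ 2" using that r0 by (intro power_strict_mono) auto
      moreover have "r0 ^ 2 = 1 / e" using e by (simp add: r0_def power_divide)
      ultimately show "1 / r ^ 2 < e" using e rp by (simp add: field_simps)
    qed
    have bnd: "\<bar>E r\<bar> \<le> K * (1 / r) ^ (2 * N - 1)" if r: "r > r0" for r
    proof -
      have dle: "\<bar>v (1 / s ^ 2) - poly (fps_truncation N V) (1 / s ^ 2)\<bar> \<le> c * (1 / s ^ 2) ^ N" if "s \<ge> r" for s
        using e(2)[of "1 / s ^ 2"] yb[of s] r that by simp
      have comb: "0 \<le> K * (1 / r) ^ (2 * N - 1) + \<sigma> * E r" if \<sigma>: "\<sigma> = 1 \<or> \<sigma> = -1" for \<sigma> :: real
      proof -
        let ?F = "\<lambda>r. K * (1 / r) ^ (2 * N - 1) + \<sigma> * E r"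
        have mono: "?F s \<le> ?F r" if s: "s \<ge> r" for s
        proof (rule DERIV_nonpos_imp_nonincreasing[OF s])
          fix u assume u: "r \<le> u" "u \<le> s"
          have up: "u > 0" using u r r0 by simp
          have "(?F has_real_derivative - (c * (1 / u ^ 2) ^ N) + \<sigma> * (v (1 / u ^ 2) - poly (fps_truncation N V) (1 / u ^ 2))) (at u)"
            by (intro DERIV_add DERIV_cmult dK[OF up] dE[OF up])
          moreover have "- (c * (1 / u ^ 2) ^ N) + \<sigma> * (v (1 / u ^ 2) - poly (fps_truncation N V) (1 / u ^ 2)) \<le> 0"
            using dle[OF u(1)] \<sigma> by (auto simp: abs_le_iff)
          ultimately show "\<exists>y. (?F has_real_derivative y) (at u) \<and> y \<le> 0" by blast
        qed
        have Flim: "(?F \<longlongrightarrow> 0 + \<sigma> * 0) at_top" by (intro tendsto_intros Klim Elim)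
        have "eventually (\<lambda>s. ?F s \<le> ?F r) at_top"
          using eventually_ge_at_top[of r] by eventually_elim (rule mono)
        then have "0 + \<sigma> * 0 \<le> ?F r" by (rule tendsto_upperbound[OF Flim]) simp
        then show ?thesis by simp
      qed
      show ?thesis using comb[of 1] comb[of "-1"] by (simp add: abs_le_iff)
    qed
    show ?thesis
    proof (rule bigoI[where c = K])
      have "eventually (\<lambda>y. y \<in> {0<..<e}) (at_right 0)" using e by (intro eventually_at_right_real)
      then show "eventually (\<lambda>y. norm (sqrt y * h (1 / sqrt y) - poly (fps_truncation N B) y) \<le> K * norm (y ^ N)) (at_right 0)"
      proof eventually_elim
        case (elim y)
        define r where "r = 1 / sqrt y"
        have y: "0 < y" "y < e" using elim by auto
        have r: "r > 0" "r > r0" using y e by (auto simp: r_def r0_def frac_less2)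
        have yr: "y = (1 / r) ^ 2" "sqrt y = 1 / r" using y by (simp_all add: r_def)
        have "poly (fps_truncation N B) y = (1 / r) * g r"
          unfolding poly_fps_truncation g_def sum_distrib_left
        proof (rule sum.cong)
          fix j
          have "r powi (1 - 2 * int j) = r * (1 / r) ^ (2 * j)"
          proof -
            have "r powi (1 - 2 * int j) = r powi 1 * r powi (- int (2 * j))"
              using r by (subst power_int_add[symmetric]) auto
            also have "r powi (- int (2 * j)) = (1 / r) ^ (2 * j)"
              unfolding power_int_minus power_int_of_nat by (simp add: power_divide inverse_eq_divide)
            finally show ?thesis by simp
          qed
          then show "fps_nth B j * y ^ j = 1 / r * (fps_nth B j * r powi (1 - 2 * int j))"
            using r by (simp add: yr(1) power_mult)
        qed simp
        then have "sqrt y * h (1 / sqrt y) - poly (fps_truncation N B) y = (1 / r) * E r"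
          using y unfolding yr(2) by (simp add: E_def algebra_simps r_def)
        moreover have "\<bar>(1 / r) * E r\<bar> \<le> (1 / r) * (K * (1 / r) ^ (2 * N - 1))"
          unfolding abs_mult using bnd[OF r(2)] r by (intro mult_mono) auto
        moreover have "(1 / r) * (K * (1 / r) ^ (2 * N - 1)) = K * y ^ N"
        proof -
          have "y ^ N = (1 / r) ^ (2 * N)" by (simp add: yr(1) power_mult)
          also have "2 * N = Suc (2 * N - 1)" using N by simp
          finally show ?thesis by simp
        qed
        ultimately show ?case using y by simp
      qed
    qed
  qed
  show ?thesis
    unfolding has_asymptotic_series_def
  proof
    fix N show "(\<lambda>y. sqrt y * h (1 / sqrt y) - poly (fps_truncation N B) y) \<in> O[at_right 0](\<lambda>y. y ^ N)"
    proof (cases "N \<ge> 1")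
      case False
      then have N0: "N = 0" by simp
      have "(\<lambda>y. sqrt y * h (1 / sqrt y) - poly (fps_truncation 1 B) y) \<in> O[at_right 0](\<lambda>y. y ^ 1)" by (rule main) simp
      also have "(\<lambda>y::real. y ^ 1) \<in> O[at_right 0](\<lambda>_. 1)"
        by (intro bigoI_tendsto) (auto intro!: tendsto_eq_intros)
      finally have "(\<lambda>y. sqrt y * h (1 / sqrt y) - poly (fps_truncation 1 B) y) \<in> O[at_right 0](\<lambda>_. 1)" .
      from sum_in_bigo(1)[OF this poly_bounded_at_0[of "fps_truncation 1 B"]]
      have "(\<lambda>y. sqrt y * h (1 / sqrt y)) \<in> O[at_right 0](\<lambda>_. 1)" by simp
      then show ?thesis by (simp add: N0 fps_truncation_def)
    qed (rule main)
  qed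
qed

section \<open>Asymptotics of the phase on the positive axis\<close>

definition gamma_kernel_mean :: "nat \<Rightarrow> real \<Rightarrow> real \<Rightarrow> real" where
  "gamma_kernel_mean j x y = (LINT t|gamma_measure x. t ^ j / (1 + t ^ 2 * y)) / Gamma x"

text \<open>Expand \<open>1 / (1 + t\<^sup>2 y)\<close> as a finite geometric sum and integrate; the error is bounded by the first
omitted moment.\<close>

lemma gamma_kernel_mean_asymptotics:
  assumes x: "x > 0"
  shows "has_asymptotic_series (gamma_kernel_mean j x) (Abs_fps (\<lambda>n. (-1) ^ n * pochhammer x (2 * n + j)))"
  unfolding has_asymptotic_series_def
proof
  fix N
  have G: "Gamma x > 0" by (rule Gamma_real_pos[OF x])
  have poch: "pochhammer x m = Gamma (x + real m) / Gamma x" for m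
    using x by (intro pochhammer_Gamma) (auto dest!: nonpos_Ints_nonpos)
  have bound: "\<bar>gamma_kernel_mean j x y - (\<Sum>n<N. (-1) ^ n * pochhammer x (2 * n + j) * y ^ n)\<bar>
       \<le> pochhammer x (2 * N + j) * y ^ N" if y: "y > 0" for y
  proof -
    let ?s = "\<lambda>t. t ^ 2 * y"
    have mom: "has_bochner_integral (gamma_measure x) (\<lambda>t. (-1) ^ n * y ^ n * t ^ (2 * n + j)) ((-1) ^ n * y ^ n * Gamma (x + real (2 * n + j)))" for n
      by (intro has_bochner_integral_mult_right gamma_measure_moment[OF x])
    have sum: "has_bochner_integral (gamma_measure x) (\<lambda>t. \<Sum>n<N. (-1) ^ n * y ^ n * t ^ (2 * n + j))
        (\<Sum>n<N. (-1) ^ n * y ^ n * Gamma (x + real (2 * n + j)))"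
      by (intro has_bochner_integral_sum mom)
    have rem: "t ^ j / (1 + ?s t) - (\<Sum>n<N. (-1) ^ n * y ^ n * t ^ (2 * n + j)) = t ^ j * ((- ?s t) ^ N / (1 + ?s t))" for t
    proof -
      have p: "1 + ?s t > 0" using y by (simp add: add_pos_nonneg)
      have "(\<Sum>n<N. (-1) ^ n * y ^ n * t ^ (2 * n + j)) = t ^ j * (\<Sum>n<N. (- ?s t) ^ n)"
        unfolding sum_distrib_left
        by (intro sum.cong refl) (simp add: power_minus[of "t ^ 2 * y"] power_mult_distrib power_add power_mult)
      moreover have "1 - (- ?s t) ^ N = (1 + ?s t) * (\<Sum>n<N. (- ?s t) ^ n)"
        using one_diff_power_eq[of "- ?s t" N] by simp
      then have "(\<Sum>n<N. (- ?s t) ^ n) = (1 - (- ?s t) ^ N) / (1 + ?s t)" using p by (simp add: eq_divide_eq mult.commute)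
      ultimately show ?thesis by (simp only:) (simp add: diff_divide_distrib right_diff_distrib)
    qed
    have le: "\<bar>t ^ j * ((- ?s t) ^ N / (1 + ?s t))\<bar> \<le> y ^ N * t ^ (2 * N + j)" if t: "t > 0" for t
    proof -
      have "1 + ?s t \<ge> 1" using y by simp
      then have "(?s t) ^ N / (1 + ?s t) \<le> (?s t) ^ N / 1" using y \<open>1 + ?s t \<ge> 1\<close> by (intro divide_left_mono) (auto simp: add_pos_nonneg)
      then have "t ^ j * ((?s t) ^ N / (1 + ?s t)) \<le> t ^ j * (?s t) ^ N" using t by (intro mult_left_mono) auto
      moreover have "\<bar>t ^ j * ((- ?s t) ^ N / (1 + ?s t))\<bar> = t ^ j * ((?s t) ^ N / (1 + ?s t))"
        using t y by (simp add: abs_mult power_abs abs_of_nonneg add_nonneg_nonneg)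
      moreover have "t ^ j * (?s t) ^ N = y ^ N * t ^ (2 * N + j)"
        unfolding power_mult_distrib power_add power_mult[symmetric] by (simp only: mult_ac)
      ultimately show ?thesis by linarith
    qed
    have intN: "integrable (gamma_measure x) (\<lambda>t. y ^ N * t ^ (2 * N + j))"
      using gamma_measure_moment[OF x, of "2 * N + j"] by (simp add: has_bochner_integral_iff)
    have intj: "integrable (gamma_measure x) (\<lambda>t. t ^ j / (1 + ?s t))"
    proof (rule Bochner_Integration.integrable_bound)
      show "integrable (gamma_measure x) (\<lambda>t. t ^ j)"
        using gamma_measure_moment[OF x, of j] by (simp add: has_bochner_integral_iff)
      show "AE t in gamma_measure x. norm (t ^ j / (1 + ?s t)) \<le> norm (t ^ j)"
      proof (intro AE_I2)
        fix t
        have "1 + ?s t > 0" using y by (simp add: add_pos_nonneg)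
        then show "norm (t ^ j / (1 + ?s t)) \<le> norm (t ^ j)"
          using y divide_left_mono[of 1 "1 + ?s t" "norm (t ^ j)"] by (simp add: abs_of_nonneg add_nonneg_nonneg norm_divide)
      qed
    qed measurable
    have "\<bar>(LINT t|gamma_measure x. t ^ j / (1 + ?s t)) - (\<Sum>n<N. (-1) ^ n * y ^ n * Gamma (x + real (2 * n + j)))\<bar>
        = \<bar>LINT t|gamma_measure x. t ^ j / (1 + ?s t) - (\<Sum>n<N. (-1) ^ n * y ^ n * t ^ (2 * n + j))\<bar>"
      using sum intj by (simp add: has_bochner_integral_iff)
    also have "\<dots> \<le> (LINT t|gamma_measure x. \<bar>t ^ j / (1 + ?s t) - (\<Sum>n<N. (-1) ^ n * y ^ n * t ^ (2 * n + j))\<bar>)"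
      by (rule integral_abs_bound)
    also have "\<dots> \<le> (LINT t|gamma_measure x. y ^ N * t ^ (2 * N + j))"
    proof (rule integral_mono_AE)
      show "integrable (gamma_measure x) (\<lambda>t. \<bar>t ^ j / (1 + ?s t) - (\<Sum>n<N. (-1) ^ n * y ^ n * t ^ (2 * n + j))\<bar>)"
        using sum intj by (intro integrable_abs Bochner_Integration.integrable_diff) (auto simp: has_bochner_integral_iff)
      show "AE t in gamma_measure x. \<bar>t ^ j / (1 + ?s t) - (\<Sum>n<N. (-1) ^ n * y ^ n * t ^ (2 * n + j))\<bar> \<le> y ^ N * t ^ (2 * N + j)"
        using AE_gamma_measure by eventually_elim (unfold rem, rule le)
    qed (rule intN)
    also have "\<dots> = y ^ N * Gamma (x + real (2 * N + j))"
      using gamma_measure_moment[OF x, of "2 * N + j"] by (simp add: has_bochner_integral_iff)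
    finally have "\<bar>(LINT t|gamma_measure x. t ^ j / (1 + ?s t)) - (\<Sum>n<N. (-1) ^ n * y ^ n * Gamma (x + real (2 * n + j)))\<bar> / Gamma x
         \<le> y ^ N * Gamma (x + real (2 * N + j)) / Gamma x"
      using G by (intro divide_right_mono) auto
    moreover have "gamma_kernel_mean j x y - (\<Sum>n<N. (-1) ^ n * pochhammer x (2 * n + j) * y ^ n)
        = ((LINT t|gamma_measure x. t ^ j / (1 + ?s t)) - (\<Sum>n<N. (-1) ^ n * y ^ n * Gamma (x + real (2 * n + j)))) / Gamma x"
      unfolding gamma_kernel_mean_def diff_divide_distrib sum_divide_distrib poch
      by (intro arg_cong2[of _ _ _ _ "(-)"] sum.cong refl) (simp add: mult_ac)
    ultimately show ?thesis using G unfolding poch by (simp add: abs_divide mult_ac)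
  qed
  show "(\<lambda>y. gamma_kernel_mean j x y - poly (fps_truncation N (Abs_fps (\<lambda>n. (-1) ^ n * pochhammer x (2 * n + j)))) y) \<in> O[at_right 0](\<lambda>y. y ^ N)"
  proof (rule bigoI)
    show "eventually (\<lambda>y. norm (gamma_kernel_mean j x y - poly (fps_truncation N (Abs_fps (\<lambda>n. (-1) ^ n * pochhammer x (2 * n + j)))) y)
        \<le> pochhammer x (2 * N + j) * norm (y ^ N)) (at_right 0)"
      using eventually_at_right_less
      by eventually_elim (use bound in \<open>simp add: poly_fps_truncation\<close>)
  qed
qed

text \<open>The substitution \<open>y = 1 / r\<^sup>2\<close> separates the growth in \<open>r\<close> from a function that has an expansion
at \<open>y = 0\<close>.\<close>

lemma stieltjes_gamma_kernel_mean:
  assumes x: "x > 0" and r: "r > 0"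
  shows "stieltjes_im x r = Gamma x * gamma_kernel_mean 0 x (1 / r ^ 2) / r"
    and "stieltjes_re x r = Gamma x * gamma_kernel_mean 1 x (1 / r ^ 2) / r ^ 2"
proof -
  have G: "Gamma x > 0" by (rule Gamma_real_pos[OF x])
  have "r / (t ^ 2 + r ^ 2) = t ^ 0 / (1 + t ^ 2 * (1 / r ^ 2)) / r" for t
    using r by (simp add: divide_simps add_nonneg_eq_0_iff) (simp add: power2_eq_square algebra_simps)
  then have "stieltjes_im x r = (LINT t|gamma_measure x. t ^ 0 / (1 + t ^ 2 * (1 / r ^ 2)) / r)"
    using stieltjes_re_im_integrals(2)[OF assms] by (simp add: has_bochner_integral_iff)
  also have "\<dots> = (LINT t|gamma_measure x. t ^ 0 / (1 + t ^ 2 * (1 / r ^ 2))) / r" by (rule integral_divide_zero)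
  finally show "stieltjes_im x r = Gamma x * gamma_kernel_mean 0 x (1 / r ^ 2) / r"
    using G by (simp add: gamma_kernel_mean_def)
  have "t / (t ^ 2 + r ^ 2) = t ^ 1 / (1 + t ^ 2 * (1 / r ^ 2)) / r ^ 2" for t
    using r by (simp add: divide_simps add_nonneg_eq_0_iff)
  then have eq: "(\<lambda>t. t / (t ^ 2 + r ^ 2)) = (\<lambda>t. t ^ 1 / (1 + t ^ 2 * (1 / r ^ 2)) / r ^ 2)" by (rule ext)
  have "stieltjes_re x r = (LINT t|gamma_measure x. t ^ 1 / (1 + t ^ 2 * (1 / r ^ 2)) / r ^ 2)"
    using conjunct2[OF stieltjes_re_im_integrals(1)[OF assms, unfolded has_bochner_integral_iff]] by (simp only: eq)
  also have "\<dots> = (LINT t|gamma_measure x. t ^ 1 / (1 + t ^ 2 * (1 / r ^ 2))) / r ^ 2" by (rule integral_divide_zero)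
  finally show "stieltjes_re x r = Gamma x * gamma_kernel_mean 1 x (1 / r ^ 2) / r ^ 2"
    using G by (simp add: gamma_kernel_mean_def)
qed

text \<open>The function \<open>h\<close> to be inverted; for \<open>x = 1 - a\<close> it is the phase minus \<open>\<pi> / 2\<close>.\<close>

definition shifted_phase :: "real \<Rightarrow> real \<Rightarrow> real" where
  "shifted_phase x r = r - Re (phase_defect x (of_real r))"

lemma shifted_phase_eq:
  "x > 0 \<Longrightarrow> r > 0 \<Longrightarrow> shifted_phase x r = r - arctan (stieltjes_re x r / stieltjes_im x r)"
  by (simp add: shifted_phase_def phase_defect_of_real)

lemma inverse_square_at_right_0: "filterlim (\<lambda>r::real. 1 / r ^ 2) (at_right 0) at_top"
  by real_asymp

lemma shifted_phase_deriv:
  assumes x: "x > 0" and r: "r > 0"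
  shows "(shifted_phase x has_real_derivative
    gamma_kernel_mean 0 x (1 / r ^ 2) /
      (gamma_kernel_mean 0 x (1 / r ^ 2) ^ 2 + 1 / r ^ 2 * gamma_kernel_mean 1 x (1 / r ^ 2) ^ 2)) (at r)"
proof -
  define U where "U = gamma_kernel_mean 0 x (1 / r ^ 2)"
  define W where "W = gamma_kernel_mean 1 x (1 / r ^ 2)"
  have G: "Gamma x > 0" by (rule Gamma_real_pos[OF x])
  have im: "stieltjes_im x r = Gamma x * U / r" and re: "stieltjes_re x r = Gamma x * W / r ^ 2"
    using stieltjes_gamma_kernel_mean[OF assms] by (simp_all add: U_def W_def)
  have U: "U > 0" using stieltjes_pos(2)[OF assms] G r by (simp add: im zero_less_mult_iff zero_less_divide_iff)
  have D: "U ^ 2 + 1 / r ^ 2 * W ^ 2 > 0" using U r by (simp add: add_pos_nonneg)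
  have "stieltjes_re x r ^ 2 + stieltjes_im x r ^ 2 = (Gamma x) ^ 2 / r ^ 2 * (U ^ 2 + 1 / r ^ 2 * W ^ 2)"
    unfolding im re by (simp add: power_divide power_mult_distrib distrib_left power2_eq_square mult_ac)
  then have "Gamma x * stieltjes_im x r / (r * (stieltjes_re x r ^ 2 + stieltjes_im x r ^ 2))
     = U / (U ^ 2 + 1 / r ^ 2 * W ^ 2)"
    using G r D by (simp add: im) (simp add: power2_eq_square)
  then have "((\<lambda>r. r - arctan (stieltjes_re x r / stieltjes_im x r)) has_real_derivative U / (U ^ 2 + 1 / r ^ 2 * W ^ 2)) (at r)"
    using arctan_quotient_deriv[OF assms] by simp
  then have "(shifted_phase x has_real_derivative U / (U ^ 2 + 1 / r ^ 2 * W ^ 2)) (at r)"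
    by (rule has_field_derivative_transform_within_open[where S = "{0<..}"])
       (use r in \<open>auto simp: shifted_phase_eq[OF x]\<close>)
  then show ?thesis by (simp add: U_def W_def)
qed

lemma shifted_phase_asymptotics:
  assumes x: "x > 0"
  shows "has_asymptotic_series (\<lambda>y. sqrt y * shifted_phase x (1 / sqrt y)) (base_series x)"
proof -
  define v where "v = (\<lambda>y. gamma_kernel_mean 0 x y / (gamma_kernel_mean 0 x y ^ 2 + y * gamma_kernel_mean 1 x y ^ 2))"
  have u: "has_asymptotic_series (gamma_kernel_mean 0 x) (even_pochhammer_series x)"
    using gamma_kernel_mean_asymptotics[OF x, of 0] by (simp add: even_pochhammer_series_def)
  have w: "has_asymptotic_series (gamma_kernel_mean 1 x) (odd_pochhammer_series x)"
    using gamma_kernel_mean_asymptotics[OF x, of 1] by (simp add: odd_pochhammer_series_def)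
  have D: "has_asymptotic_series (\<lambda>y. gamma_kernel_mean 0 x y ^ 2 + y * gamma_kernel_mean 1 x y ^ 2)
      (even_pochhammer_series x ^ 2 + fps_X * odd_pochhammer_series x ^ 2)"
    by (intro has_asymptotic_series_add has_asymptotic_series_mult has_asymptotic_series_power
          has_asymptotic_series_ident u w)
  have v: "has_asymptotic_series v (derivative_series x)"
    unfolding v_def
    by (rule has_asymptotic_series_divide[OF u D _ derivative_series_identity[OF x]])
       (simp add: fps_power_zeroth even_pochhammer_series_def)
  have lim: "((\<lambda>r. shifted_phase x r - r) \<longlongrightarrow> 0) at_top"
  proof -
    have u1: "((\<lambda>r. gamma_kernel_mean 0 x (1 / r ^ 2)) \<longlongrightarrow> 1) at_top"
      using filterlim_compose[OF has_asymptotic_series_tendsto[OF u] inverse_square_at_right_0]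
      by (simp add: even_pochhammer_series_def)
    have w1: "((\<lambda>r. gamma_kernel_mean 1 x (1 / r ^ 2)) \<longlongrightarrow> x) at_top"
      using filterlim_compose[OF has_asymptotic_series_tendsto[OF w] inverse_square_at_right_0]
      by (simp add: odd_pochhammer_series_def)
    have i: "((\<lambda>r. 1 / r) \<longlongrightarrow> 0) (at_top :: real filter)" by real_asymp
    have "((\<lambda>r. - arctan (gamma_kernel_mean 1 x (1 / r ^ 2) / gamma_kernel_mean 0 x (1 / r ^ 2) * (1 / r)))
        \<longlongrightarrow> - arctan (x / 1 * 0)) at_top"
      by (intro tendsto_intros u1 w1 i) simp
    then have "((\<lambda>r. - arctan (gamma_kernel_mean 1 x (1 / r ^ 2) / gamma_kernel_mean 0 x (1 / r ^ 2) * (1 / r))) \<longlongrightarrow> 0) at_top"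
      by simp
    then show ?thesis
    proof (rule Lim_transform_eventually)
      show "eventually (\<lambda>r. - arctan (gamma_kernel_mean 1 x (1 / r ^ 2) / gamma_kernel_mean 0 x (1 / r ^ 2) * (1 / r))
          = shifted_phase x r - r) at_top"
        using eventually_gt_at_top[of 0]
      proof eventually_elim
        case (elim r)
        have "stieltjes_re x r / stieltjes_im x r = gamma_kernel_mean 1 x (1 / r ^ 2) / gamma_kernel_mean 0 x (1 / r ^ 2) * (1 / r)"
          unfolding stieltjes_gamma_kernel_mean[OF x elim] using elim Gamma_real_pos[OF x] by (simp add: power2_eq_square)
        then show ?case by (simp add: shifted_phase_eq[OF x elim])
      qed
    qed
  qed
  show ?thesis
  proof (rule has_asymptotic_series_primitive[of _ v])
    show "(shifted_phase x has_real_derivative v (1 / r ^ 2)) (at r)" if "r > 0" for r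
      unfolding v_def by (rule shifted_phase_deriv[OF x that])
  qed (use v lim in \<open>auto simp: derivative_series_def base_series_from_derivative_series\<close>)
qed

lemma has_asymptotic_series_leading:
  assumes f: "has_asymptotic_series f A" and A: "\<And>i. i \<le> N \<Longrightarrow> fps_nth A i = 0"
  shows "((\<lambda>y. f y / y ^ N) \<longlongrightarrow> 0) (at_right 0)"
proof -
  have "f \<in> O[at_right 0](\<lambda>y. y ^ Suc N)" by (rule has_asymptotic_series_bigo[OF f]) (auto intro: A)
  moreover have "(\<lambda>y::real. y ^ Suc N) \<in> o[at_right 0](\<lambda>y. y ^ N)"
  proof (rule smalloI_tendsto)
    have "((\<lambda>y. y) \<longlongrightarrow> (0::real)) (at_right 0)" by (rule tendsto_ident_at)
    then show "((\<lambda>y::real. y ^ Suc N / y ^ N) \<longlongrightarrow> 0) (at_right 0)"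
      by (rule Lim_transform_eventually) (intro eventually_mono[OF eventually_at_right_less], simp)
    show "eventually (\<lambda>y::real. y ^ N \<noteq> 0) (at_right 0)"
      by (intro eventually_mono[OF eventually_at_right_less], simp)
  qed
  ultimately have "f \<in> o[at_right 0](\<lambda>y. y ^ N)" by (rule landau_o.big_small_trans)
  then show ?thesis by (rule smalloD_tendsto)
qed

text \<open>Substituting the expansion of \<open>h\<close> into \<open>Lagrange_inversion\<close> gives an error \<open>o(y\<^sup>m\<^sup>+\<^sup>1)\<close>,
and multiplying by \<open>z\<^sup>2\<^sup>m\<^sup>+\<^sup>2\<close> turns powers of \<open>y\<close> and of \<open>h / z\<close> into powers of \<open>h\<close>.\<close>

lemma shifted_phase_reversion:
  assumes x: "x > 0"
  defines "h \<equiv> shifted_phase x"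
  shows "((\<lambda>z. h z ^ (2 * m + 1) * (z - h z - (\<Sum>n<m. Lagrange_coeff (base_series x) n / h z ^ (2 * n + 1))))
            \<longlongrightarrow> Lagrange_coeff (base_series x) m) at_top"
proof -
  define d where "d = Lagrange_coeff (base_series x)"
  define \<beta> where "\<beta> = (\<lambda>y. sqrt y * h (1 / sqrt y))"
  define E where "E = (\<lambda>y. \<beta> y ^ (2 * m + 2) + (\<Sum>n\<le>m. d n * y ^ (n + 1) * \<beta> y ^ (2 * (m - n))) - \<beta> y ^ (2 * m + 1))"
  have \<beta>: "has_asymptotic_series \<beta> (base_series x)"
    unfolding \<beta>_def h_def by (rule shifted_phase_asymptotics[OF x])
  have "has_asymptotic_series E (base_series x ^ (2 * m + 2)
      + (\<Sum>n\<le>m. fps_const (d n) * fps_X ^ (n + 1) * base_series x ^ (2 * (m - n))) - base_series x ^ (2 * m + 1))"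
    unfolding E_def
    by (intro has_asymptotic_series_add has_asymptotic_series_diff has_asymptotic_series_sum has_asymptotic_series_mult
          has_asymptotic_series_power has_asymptotic_series_ident has_asymptotic_series_const \<beta>) simp
  then have "((\<lambda>y. E y / y ^ (m + 1)) \<longlongrightarrow> 0) (at_right 0)"
    by (rule has_asymptotic_series_leading) (unfold d_def, rule Lagrange_inversion, auto)
  then have lim: "((\<lambda>z. d m - E (1 / z ^ 2) / (1 / z ^ 2) ^ (m + 1)) \<longlongrightarrow> d m - 0) at_top"
    by (intro tendsto_diff tendsto_const filterlim_compose[OF _ inverse_square_at_right_0])
  have hpos: "eventually (\<lambda>z. h z > 0) at_top"
    using eventually_gt_at_top[of "pi / 2"]
  proof eventually_elim
    case (elim z)
    then have "z > 0" using pi_gt_zero by (smt (verit) half_gt_zero)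
    then show ?case using Re_phase_defect(2)[OF x, of "of_real z"] elim by (simp add: h_def shifted_phase_def)
  qed
  have "eventually (\<lambda>z. d m - E (1 / z ^ 2) / (1 / z ^ 2) ^ (m + 1)
       = h z ^ (2 * m + 1) * (z - h z - (\<Sum>n<m. d n / h z ^ (2 * n + 1)))) at_top"
    using hpos eventually_gt_at_top[of 0]
  proof eventually_elim
    case (elim z)
    have \<beta>z: "\<beta> (1 / z ^ 2) = h z / z" using elim by (simp add: \<beta>_def real_sqrt_divide)
    have tm: "(1 / z ^ 2) ^ (n + 1) * (h z / z) ^ (2 * (m - n)) = h z ^ (2 * m + 1) / h z ^ (2 * n + 1) / z ^ (2 * m + 2)"
      if "n \<le> m" for n
    proof -
      define k where "k = m - n"
      have k: "m = n + k" using that by (simp add: k_def)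
      have hm: "h z ^ (2 * m + 1) = h z ^ (2 * n + 1) * h z ^ (2 * k)" by (simp add: k flip: power_add)
      have zm: "z ^ (2 * m + 2) = z ^ (2 * (n + 1)) * z ^ (2 * k)" by (simp add: k flip: power_add)
      have a: "(1 / z ^ 2) ^ (n + 1) = 1 / z ^ (2 * (n + 1))" by (simp only: power_divide power_one power_mult)
      have b: "(h z / z) ^ (2 * (m - n)) = h z ^ (2 * k) / z ^ (2 * k)"
        by (simp only: k_def power_divide)
      have gen: "1 / A * (B / C) = H * B / H / (A * C)" if "H \<noteq> 0" for A B C H :: real using that by simp
      show ?thesis unfolding a b hm zm by (rule gen) (use elim in simp)
    qed
    have "E (1 / z ^ 2) = (h z / z) ^ (2 * m + 2)
       + (\<Sum>n\<le>m. d n * (h z ^ (2 * m + 1) / h z ^ (2 * n + 1) / z ^ (2 * m + 2))) - (h z / z) ^ (2 * m + 1)"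
      unfolding E_def \<beta>z mult.assoc by (intro arg_cong2[of _ _ _ _ "(-)"] arg_cong2[of _ _ _ _ "(+)"] sum.cong refl) (simp only: tm atMost_iff)
    also have "\<dots> = (h z ^ (2 * m + 1) * h z + (\<Sum>n\<le>m. h z ^ (2 * m + 1) * (d n / h z ^ (2 * n + 1))) - h z ^ (2 * m + 1) * z) / z ^ (2 * m + 2)"
    proof -
      have 1: "(h z / z) ^ (2 * m + 2) = h z ^ (2 * m + 1) * h z / z ^ (2 * m + 2)" by (simp add: power_divide)
      have 2: "(h z / z) ^ (2 * m + 1) = h z ^ (2 * m + 1) * z / z ^ (2 * m + 2)" using elim by (simp add: power_divide)
      show ?thesis unfolding 1 2 diff_divide_distrib add_divide_distrib sum_divide_distrib
        by (intro arg_cong2[of _ _ _ _ "(-)"] arg_cong2[of _ _ _ _ "(+)"] sum.cong refl) (simp add: mult_ac)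
    qed
    also have "\<dots> = h z ^ (2 * m + 1) * (h z + (\<Sum>n\<le>m. d n / h z ^ (2 * n + 1)) - z) / z ^ (2 * m + 2)"
      by (simp only: sum_distrib_left distrib_left right_diff_distrib)
    finally have "E (1 / z ^ 2) / (1 / z ^ 2) ^ (m + 1) = h z ^ (2 * m + 1) * (h z + (\<Sum>n\<le>m. d n / h z ^ (2 * n + 1)) - z)"
    proof -
      assume E: "E (1 / z ^ 2) = h z ^ (2 * m + 1) * (h z + (\<Sum>n\<le>m. d n / h z ^ (2 * n + 1)) - z) / z ^ (2 * m + 2)"
      have "(1 / z ^ 2) ^ (m + 1) = 1 / z ^ (2 * m + 2)"
        unfolding power_divide power_one power_mult[symmetric] by simp
      then show ?thesis unfolding E using elim by simp
    qed
    also have "(\<Sum>n\<le>m. d n / h z ^ (2 * n + 1)) = (\<Sum>n<m. d n / h z ^ (2 * n + 1)) + d m / h z ^ (2 * m + 1)"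
      by (simp flip: lessThan_Suc_atMost)
    finally show ?case using elim by (simp add: algebra_simps)
  qed
  with lim show ?thesis by (simp add: Lim_transform_eventually d_def)
qed

section \<open>The inverse phase function\<close>

lemma shifted_phase_gap_limit:
  assumes x: "x > 0"
  shows "((\<lambda>r. r * Re (phase_defect x (of_real r))) \<longlongrightarrow> x) at_top"
proof -
  define \<beta> where "\<beta> = (\<lambda>y. sqrt y * shifted_phase x (1 / sqrt y))"
  have \<beta>: "has_asymptotic_series \<beta> (base_series x)"
    unfolding \<beta>_def by (rule shifted_phase_asymptotics[OF x])
  have B1: "fps_nth (base_series x) 1 = - x" using base_series_nth_Suc[of x 0] by simp
  have "has_asymptotic_series (\<lambda>y. \<beta> y - poly [:1, - x:] y) (base_series x - fps_of_poly [:1, - x:])"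
    by (intro has_asymptotic_series_diff has_asymptotic_series_poly \<beta>)
  then have "((\<lambda>y. (\<beta> y - poly [:1, - x:] y) / y ^ 1) \<longlongrightarrow> 0) (at_right 0)"
  proof (rule has_asymptotic_series_leading)
    fix i :: nat assume "i \<le> 1"
    then consider "i = 0" | "i = 1" by linarith
    then show "fps_nth (base_series x - fps_of_poly [:1, - x:]) i = 0"
      by cases (use B1 in auto)
  qed
  from filterlim_compose[OF this inverse_square_at_right_0]
  have "((\<lambda>r. x - (\<beta> (1 / r ^ 2) - poly [:1, - x:] (1 / r ^ 2)) / (1 / r ^ 2) ^ 1) \<longlongrightarrow> x - 0) at_top"
    by (intro tendsto_intros)
  then have "((\<lambda>r. x - (\<beta> (1 / r ^ 2) - poly [:1, - x:] (1 / r ^ 2)) / (1 / r ^ 2) ^ 1) \<longlongrightarrow> x) at_top" by simp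
  then show ?thesis
  proof (rule Lim_transform_eventually)
    show "eventually (\<lambda>r. x - (\<beta> (1 / r ^ 2) - poly [:1, - x:] (1 / r ^ 2)) / (1 / r ^ 2) ^ 1
        = r * Re (phase_defect x (of_real r))) at_top"
      using eventually_gt_at_top[of 0]
    proof eventually_elim
      case (elim r)
      then have eq: "\<beta> (1 / r ^ 2) = 1 - Re (phase_defect x (of_real r)) / r"
        by (simp add: \<beta>_def real_sqrt_divide shifted_phase_def diff_divide_distrib)
      show ?case unfolding eq using elim by (simp add: field_simps power2_eq_square)
    qed
  qed
qed

text \<open>The decay of \<open>f\<close> along the real axis determines its decay in the half-plane, because
\<open>f z = x / (z + x k z)\<close> with \<open>Re (k z) > 0\<close>.\<close>

lemma norm_phase_defect_le:
  assumes x: "x > 0" and z: "Re z > 0"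
  shows "norm (phase_defect x z) \<le> x / Re z"
proof -
  have at_0: "((\<lambda>r. r * Re (phase_defect x (of_real r))) \<longlongrightarrow> 0) (at_right 0)"
  proof (rule Lim_null_comparison)
    show "eventually (\<lambda>r. norm (r * Re (phase_defect x (of_real r))) \<le> r * (pi / 2)) (at_right 0)"
      using eventually_at_right_less
    proof eventually_elim
      case (elim r)
      then show ?case using Re_phase_defect[OF x, of "of_real r"] by (simp add: abs_mult)
    qed
    show "((\<lambda>r. r * (pi / 2)) \<longlongrightarrow> 0) (at_right 0)" by (auto intro!: tendsto_eq_intros)
  qed
  obtain k where k: "positive_real k" and eq: "phase_defect x z = of_real x / (z + of_real x * k z)"
    using positive_real_step(2)[OF positive_real_phase_defect[OF x] at_0 shifted_phase_gap_limit[OF x]] z by blast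
  have "Re (k z) > 0" using k z by (simp add: positive_real_def)
  then have "Re z \<le> Re (z + of_real x * k z)" using x by simp
  also have "\<dots> \<le> norm (z + of_real x * k z)" by (rule complex_Re_le_cmod)
  finally show ?thesis unfolding eq using x z by (simp add: norm_divide frac_le)
qed

text \<open>For two solutions, \<open>f u - f v = u - v\<close>, so the Schwarz-Pick inequality compares
\<open>u + cnj v = (f u + cnj (f v)) + 2 Re w\<close> with \<open>f u + cnj (f v)\<close>. Adding a positive number to a
number with positive real part increases its modulus, a contradiction.\<close>

lemma phase_equation_unique:
  assumes x: "x > 0" and w: "Re w > 0" and u: "Re u > 0" and v: "Re v > 0"
    and "u - phase_defect x u = w" "v - phase_defect x v = w"
  shows "u = v"
proof (rule ccontr)
  assume "u \<noteq> v"
  define f where "f = phase_defect x"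
  have uv: "u = w + f u" "v = w + f v" using assms(5,6) by (auto simp: f_def algebra_simps)
  have "norm (f u - f v) * norm (u + cnj v) \<le> norm (f u + cnj (f v)) * norm (u - v)"
    using Re_phase_defect(1)[OF x] unfolding f_def
    by (intro Schwarz_Pick_half_plane holomorphic_phase_defect x u v) auto
  moreover have "f u - f v = u - v" using uv by (metis add_diff_cancel_left)
  ultimately have le: "norm (u + cnj v) \<le> norm (f u + cnj (f v))" using \<open>u \<noteq> v\<close> by (simp add: mult.commute)
  define s where "s = f u + cnj (f v)"
  have s: "Re s > 0" using Re_phase_defect(1)[OF x u] Re_phase_defect(1)[OF x v] by (simp add: s_def f_def)
  have "u + cnj v = s + (w + cnj w)" unfolding s_def by (subst uv(1), subst uv(2)) simp
  then have "u + cnj v = s + of_real (2 * Re w)" by (simp add: complex_add_cnj)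
  moreover have "norm s < norm (s + of_real (2 * Re w))"
  proof -
    have "(Re s)\<^sup>2 < (Re s + 2 * Re w)\<^sup>2" using s w by (intro power_strict_mono) auto
    then have "norm s ^ 2 < norm (s + of_real (2 * Re w)) ^ 2" unfolding cmod_power2 by simp
    then show ?thesis by (rule power2_less_imp_less) simp
  qed
  ultimately show False using le by (simp add: s_def)
qed

text \<open>Brouwer's theorem for \<open>z \<mapsto> w + f z\<close> on a rectangle: its width is given by
\<open>0 < Re f < \<pi> / 2\<close>, its height by \<open>\<bar>f z\<bar> \<le> x / Re z\<close>.\<close>

lemma phase_equation_solvable:
  assumes x: "x > 0" and w: "Re w > 0"
  shows "\<exists>z. Re z > 0 \<and> z - phase_defect x z = w"
proof -
  define M where "M = x / Re w"
  have M: "M > 0" using x w by (simp add: M_def)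
  define K where "K = cbox (Complex (Re w) (Im w - M)) (Complex (Re w + pi / 2) (Im w + M))"
  have inK: "z \<in> K \<longleftrightarrow> Re w \<le> Re z \<and> Re z \<le> Re w + pi / 2 \<and> Im w - M \<le> Im z \<and> Im z \<le> Im w + M" for z
    by (auto simp: K_def in_cbox_complex_iff)
  have Kpos: "Re z > 0" if "z \<in> K" for z using that w by (auto simp: inK)
  have "continuous_on K (\<lambda>z. w + phase_defect x z)"
    using holomorphic_on_imp_continuous_on[OF holomorphic_phase_defect[OF x]] Kpos
    by (intro continuous_intros) (auto simp: right_half_plane_def elim: continuous_on_subset)
  moreover have "(\<lambda>z. w + phase_defect x z) \<in> K \<rightarrow> K"
  proof
    fix z assume z: "z \<in> K"
    have "norm (phase_defect x z) \<le> x / Re z" by (rule norm_phase_defect_le[OF x Kpos[OF z]])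
    also have "\<dots> \<le> M" unfolding M_def using z x w by (intro divide_left_mono) (auto simp: inK)
    finally have "\<bar>Im (phase_defect x z)\<bar> \<le> M" using abs_Im_le_cmod order_trans by blast
    then show "w + phase_defect x z \<in> K"
      using Re_phase_defect[OF x Kpos[OF z]] by (auto simp: inK abs_le_iff)
  qed
  moreover have "w \<in> K" using M by (simp add: inK)
  then have "K \<noteq> {}" by auto
  moreover have "compact K" "convex K" by (simp_all add: K_def)
  ultimately obtain z where "z \<in> K" "w + phase_defect x z = z" using brouwer[of K] by blast
  then show ?thesis using Kpos by (intro exI[of _ z]) (auto simp: algebra_simps)
qed

text \<open>Existence and uniqueness say that \<open>h\<close> maps an open part of the half-plane bijectively onto the
half-plane, and a holomorphic injection has a holomorphic inverse.\<close>

lemma inverse_phase_extension: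
  assumes x: "x > 0"
  obtains F where "F holomorphic_on right_half_plane"
    "\<And>w. Re w > 0 \<Longrightarrow> Re (F w) > 0" "\<And>w. Re w > 0 \<Longrightarrow> F w - phase_defect x (F w) = w"
    "\<And>w z. Re w > 0 \<Longrightarrow> Re z > 0 \<Longrightarrow> z - phase_defect x z = w \<Longrightarrow> F w = z"
proof -
  define h where "h = (\<lambda>z. z - phase_defect x z)"
  define \<Omega> where "\<Omega> = right_half_plane \<inter> h -` right_half_plane"
  have holh: "h holomorphic_on right_half_plane"
    unfolding h_def by (intro holomorphic_intros holomorphic_phase_defect x)
  have op: "open \<Omega>"
    unfolding \<Omega>_def
    by (intro continuous_open_preimage holomorphic_on_imp_continuous_on holh open_right_half_plane)
  have inj: "inj_on h \<Omega>"
  proof (rule inj_onI)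
    fix u v assume uv: "u \<in> \<Omega>" "v \<in> \<Omega>" "h u = h v"
    show "u = v"
      by (rule phase_equation_unique[OF x, of "h u"])
         (use uv in \<open>auto simp: \<Omega>_def h_def right_half_plane_def\<close>)
  qed
  have im: "h ` \<Omega> = right_half_plane"
  proof (intro equalityI subsetI)
    fix w assume "w \<in> right_half_plane"
    then obtain z where "Re z > 0" "h z = w" "Re w > 0"
      using phase_equation_solvable[OF x, of w] by (auto simp: h_def right_half_plane_def)
    then show "w \<in> h ` \<Omega>" by (intro image_eqI[of _ _ z]) (auto simp: \<Omega>_def right_half_plane_def)
  qed (auto simp: \<Omega>_def)
  have "h holomorphic_on \<Omega>" using holh by (rule holomorphic_on_subset) (auto simp: \<Omega>_def)
  then obtain F where F: "F holomorphic_on right_half_plane" "\<And>z. z \<in> \<Omega> \<Longrightarrow> F (h z) = z"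
    using holomorphic_has_inverse[OF _ op inj] unfolding im by metis
  have sol: "Re (F w) > 0 \<and> F w - phase_defect x (F w) = w" if w: "Re w > 0" for w
  proof -
    have "w \<in> h ` \<Omega>" using w by (simp add: im right_half_plane_def)
    then obtain z where "z \<in> \<Omega>" "h z = w" by blast
    then show ?thesis using F(2)[of z] by (auto simp: \<Omega>_def right_half_plane_def h_def)
  qed
  have "F w = z" if "Re w > 0" "Re z > 0" "z - phase_defect x z = w" for w z
    by (rule phase_equation_unique[OF x that(1)]) (use sol[OF that(1)] that in auto)
  with F(1) sol show ?thesis by (intro that[of F]) auto
qed

lemma phase_equation_solvable_real:
  assumes x: "x > 0" and w: "w > 0"
  shows "\<exists>r\<ge>w. shifted_phase x r = w"
proof -
  have "\<exists>r. w \<le> r \<and> r \<le> w + pi / 2 \<and> shifted_phase x r = w"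
  proof (rule IVT')
    show "shifted_phase x w \<le> w" "w \<le> shifted_phase x (w + pi / 2)"
      using Re_phase_defect[OF x, of "of_real w"] Re_phase_defect[OF x, of "of_real (w + pi / 2)"] w
      by (auto simp: shifted_phase_def)
    show "continuous_on {w..w + pi / 2} (shifted_phase x)"
      using w by (intro continuous_at_imp_continuous_on ballI DERIV_isCont[OF shifted_phase_deriv[OF x]]) simp
  qed simp
  then show ?thesis by blast
qed

lemma shifted_phase_complex:
  assumes "x > 0" "r > 0"
  shows "of_real r - phase_defect x (of_real r) = of_real (shifted_phase x r)"
  using phase_defect_of_real[OF assms] by (simp add: shifted_phase_def)

lemma shifted_phase_phase:
  assumes "a < 1" "z > 0"
  shows "phase a z - pi / 2 = shifted_phase (1 - a) z"
  using phase_eq_phase_branch[OF assms] phase_branch_eq[OF assms] by (simp add: shifted_phase_def)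

text \<open>The hypotheses of \<open>remainder_bounds\<close>. The first holds because \<open>F w - w = f (F w)\<close>, the second
because the real part of \<open>f\<close> is bounded, and the third by composing \<open>shifted_phase_reversion\<close> with
\<open>z = F r \<ge> r\<close>.\<close>

lemma inverse_phase_remainder:
  fixes F :: "complex \<Rightarrow> complex" and x :: real
  assumes x: "x > 0"
    and holF: "F holomorphic_on right_half_plane"
    and posF: "\<And>w. Re w > 0 \<Longrightarrow> Re (F w) > 0"
    and eqF: "\<And>w. Re w > 0 \<Longrightarrow> F w - phase_defect x (F w) = w"
    and uniF: "\<And>w z. Re w > 0 \<Longrightarrow> Re z > 0 \<Longrightarrow> z - phase_defect x z = w \<Longrightarrow> F w = z"
  defines "C \<equiv> \<lambda>n. c_coeff n x / real (2 * n + 1)"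
  shows "positive_real (\<lambda>w. F w - w)"
    and "((\<lambda>r. r * Re (F (of_real r) - of_real r)) \<longlongrightarrow> 0) (at_right 0)"
    and "((\<lambda>r. (-1) ^ N * r ^ (2 * N + 1) *
            Re (F (of_real r) - (of_real r + (\<Sum>n<N. (-1) ^ n * of_real (C n) / of_real r ^ (2 * n + 1))))) \<longlongrightarrow> C N) at_top"
proof -
  have diff: "F w - w = phase_defect x (F w)" if "Re w > 0" for w
    using eqF[OF that] by (simp add: algebra_simps)
  have Freal: "\<exists>s\<ge>r. F (of_real r) = of_real s \<and> shifted_phase x s = r" if r: "r > 0" for r
  proof -
    obtain s where s: "s \<ge> r" "shifted_phase x s = r" using phase_equation_solvable_real[OF x r] by blast
    have "F (of_real r) = of_real s"
      using s r shifted_phase_complex[OF x, of s] by (intro uniF) auto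
    then show ?thesis using s by blast
  qed
  show "positive_real (\<lambda>w. F w - w)"
    unfolding positive_real_def
  proof (intro conjI allI impI)
    show "(\<lambda>w. F w - w) holomorphic_on right_half_plane" by (intro holomorphic_intros holF)
    show "Re (F w - w) > 0" if "Re w > 0" for w
      unfolding diff[OF that] by (rule Re_phase_defect(1)[OF x posF[OF that]])
    show "F (of_real r) - of_real r \<in> \<real>" if "r > 0" for r
      using Freal[OF that] by auto
  qed
  show "((\<lambda>r. r * Re (F (of_real r) - of_real r)) \<longlongrightarrow> 0) (at_right 0)"
  proof (rule Lim_null_comparison)
    show "eventually (\<lambda>r. norm (r * Re (F (of_real r) - of_real r)) \<le> r * (pi / 2)) (at_right 0)"
      using eventually_at_right_less
    proof eventually_elim
      case (elim r)
      then have r: "Re (of_real r) > 0" by simp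
      show ?case unfolding diff[OF r]
        using Re_phase_defect[OF x posF[OF r]] elim by (simp add: abs_mult)
    qed
    show "((\<lambda>r. r * (pi / 2)) \<longlongrightarrow> 0) (at_right 0)" by (auto intro!: tendsto_eq_intros)
  qed
  define d where "d = Lagrange_coeff (base_series x)"
  have d: "d n = (-1) ^ n * C n" for n
    by (simp add: d_def Lagrange_coeff_base_series C_def)
  define X where "X = (\<lambda>r. Re (F (of_real r)))"
  have X: "X r \<ge> r" "F (of_real r) = of_real (X r)" "shifted_phase x (X r) = r" if "r > 0" for r
    using Freal[OF that] by (auto simp: X_def)
  have "filterlim X at_top at_top"
    by (rule filterlim_at_top_mono[OF filterlim_ident])
       (auto intro: eventually_mono[OF eventually_gt_at_top[of 0]] X(1))
  from filterlim_compose[OF shifted_phase_reversion[OF x, of N] this]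
  have "((\<lambda>r. (-1) ^ N * (shifted_phase x (X r) ^ (2 * N + 1) * (X r - shifted_phase x (X r)
      - (\<Sum>n<N. d n / shifted_phase x (X r) ^ (2 * n + 1))))) \<longlongrightarrow> (-1) ^ N * d N) at_top"
    unfolding d_def by (intro tendsto_intros)
  moreover have "(-1) ^ N * d N = C N" by (cases "even N") (auto simp: d)
  ultimately have "((\<lambda>r. (-1) ^ N * (shifted_phase x (X r) ^ (2 * N + 1) * (X r - shifted_phase x (X r)
      - (\<Sum>n<N. d n / shifted_phase x (X r) ^ (2 * n + 1))))) \<longlongrightarrow> C N) at_top" by simp
  then show "((\<lambda>r. (-1) ^ N * r ^ (2 * N + 1) *
            Re (F (of_real r) - (of_real r + (\<Sum>n<N. (-1) ^ n * of_real (C n) / of_real r ^ (2 * n + 1))))) \<longlongrightarrow> C N) at_top"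
  proof (rule Lim_transform_eventually)
    show "eventually (\<lambda>r. (-1) ^ N * (shifted_phase x (X r) ^ (2 * N + 1) * (X r - shifted_phase x (X r)
      - (\<Sum>n<N. d n / shifted_phase x (X r) ^ (2 * n + 1)))) = (-1) ^ N * r ^ (2 * N + 1) *
            Re (F (of_real r) - (of_real r + (\<Sum>n<N. (-1) ^ n * of_real (C n) / of_real r ^ (2 * n + 1))))) at_top"
      using eventually_gt_at_top[of 0]
    proof eventually_elim
      case (elim r)
      have "F (of_real r) - (of_real r + (\<Sum>n<N. (-1) ^ n * of_real (C n) / of_real r ^ (2 * n + 1)))
         = of_real (X r - r - (\<Sum>n<N. d n / r ^ (2 * n + 1)))"
        unfolding X(2)[OF elim] by (simp add: d algebra_simps)
      then show ?case unfolding X(3)[OF elim] by (simp only: Re_complex_of_real mult.assoc)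
    qed
  qed
qed

theorem theorem1p4:
  shows
    "(\<forall>a<1. \<exists>F.
        F analytic_on {w. Re w > 0} \<and>
        (\<forall>w::real. w > 0 \<longrightarrow> F (of_real w) = of_real (phase_inverse a w)) \<and>
        (\<forall>N.
          (\<forall>w. Re w > 0 \<longrightarrow>
             norm (X_remainder a F N w) \<le>
               c_coeff N (1 - a) / real (2 * N + 1) * (1 / norm w ^ (2 * N + 1)) *
               (if \<bar>Arg w\<bar> \<le> pi / 4 then 1 else \<bar>1 / sin (2 * Arg w)\<bar>)) \<and>
          (\<forall>w::real. w > 0 \<longrightarrow>
             X_remainder a F N (of_real w) \<in> \<real> \<and>
             \<bar>Re (X_remainder a F N (of_real w))\<bar> \<le> \<bar>X_term a N w\<bar> \<and>
             sgn (Re (X_remainder a F N (of_real w))) = sgn (X_term a N w)))) \<and>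
     (\<forall>n. \<exists>p :: real poly.
        degree p = 2 * n + 1 \<and> lead_coeff p = 1 \<and> (\<forall>i. coeff p i \<in> \<rat>) \<and>
        (\<forall>a<1. c_coeff n (1 - a) = poly p (1 - a))) \<and>
     (\<forall>n. \<forall>a<1. c_coeff n (1 - a) > 0)"
proof -
  have main: "(\<exists>F. F analytic_on {w. Re w > 0} \<and>
        (\<forall>w::real. w > 0 \<longrightarrow> F (of_real w) = of_real (phase_inverse a w)) \<and>
        (\<forall>N.
          (\<forall>w. Re w > 0 \<longrightarrow>
             norm (X_remainder a F N w) \<le>
               c_coeff N (1 - a) / real (2 * N + 1) * (1 / norm w ^ (2 * N + 1)) *
               (if \<bar>Arg w\<bar> \<le> pi / 4 then 1 else \<bar>1 / sin (2 * Arg w)\<bar>)) \<and>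
          (\<forall>w::real. w > 0 \<longrightarrow>
             X_remainder a F N (of_real w) \<in> \<real> \<and>
             \<bar>Re (X_remainder a F N (of_real w))\<bar> \<le> \<bar>X_term a N w\<bar> \<and>
             sgn (Re (X_remainder a F N (of_real w))) = sgn (X_term a N w)))) \<and>
        (\<forall>n. c_coeff n (1 - a) > 0)"
    if a: "a < 1" for a
  proof -
    have x: "1 - a > 0" using a by simp
    obtain F where F: "F holomorphic_on right_half_plane"
      "\<And>w. Re w > 0 \<Longrightarrow> Re (F w) > 0" "\<And>w. Re w > 0 \<Longrightarrow> F w - phase_defect (1 - a) (F w) = w"
      "\<And>w z. Re w > 0 \<Longrightarrow> Re z > 0 \<Longrightarrow> z - phase_defect (1 - a) z = w \<Longrightarrow> F w = z"
      using inverse_phase_extension[OF x] by blast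
    define C where "C = (\<lambda>n. c_coeff n (1 - a) / real (2 * n + 1))"
    have l1: "positive_real (\<lambda>w. F w - w)"
      by (rule inverse_phase_remainder(1)[OF x F(1)]) (fact F)+
    have l2: "((\<lambda>r. r * Re (F (of_real r) - of_real r)) \<longlongrightarrow> 0) (at_right 0)"
      by (rule inverse_phase_remainder(2)[OF x F(1)]) (fact F)+
    have l3: "((\<lambda>r. (-1) ^ N * r ^ (2 * N + 1) *
            Re (F (of_real r) - (of_real r + (\<Sum>n<N. (-1) ^ n * of_real (C n) / of_real r ^ (2 * n + 1))))) \<longlongrightarrow> C N) at_top" for N
      unfolding C_def by (rule inverse_phase_remainder(3)[OF x F(1)]) (fact F)+
    note bounds = remainder_bounds[of F C, OF l1 l2 l3]
    have R: "X_remainder a F N w = F w - (w + (\<Sum>n<N. (-1) ^ n * of_real (C n) / w ^ (2 * n + 1)))" for N w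
      by (simp add: X_remainder_def X_term_def C_def)
    have Cpos: "C n > 0" for n by (rule bounds(1))
    have inv: "F (of_real w) = of_real (phase_inverse a w)" if w: "w > 0" for w
    proof -
      have sol: "of_real r = F (of_real w)" if "r > 0" "phase a r - pi / 2 = w" for r
        using F(4)[of "of_real w" "of_real r"] shifted_phase_complex[OF x that(1)]
          shifted_phase_phase[OF a that(1)] that w by simp
      obtain r where r: "r \<ge> w" "shifted_phase (1 - a) r = w" using phase_equation_solvable_real[OF x w] by blast
      then have rp: "r > 0" "phase a r - pi / 2 = w" using w shifted_phase_phase[OF a, of r] by auto
      have "phase_inverse a w = r"
        unfolding phase_inverse_def the_inv_into_def
      proof (rule the_equality)
        show "r \<in> {0<..} \<and> phase a r - pi / 2 = w" using rp by simp
        fix s assume "s \<in> {0<..} \<and> phase a s - pi / 2 = w"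
        then have "complex_of_real s = of_real r" using sol[of s] sol[of r] rp by simp
        then show "s = r" by simp
      qed
      then show ?thesis using sol[OF rp] by simp
    qed
    have bound: "norm (X_remainder a F N w) \<le>
               c_coeff N (1 - a) / real (2 * N + 1) * (1 / norm w ^ (2 * N + 1)) *
               (if \<bar>Arg w\<bar> \<le> pi / 4 then 1 else \<bar>1 / sin (2 * Arg w)\<bar>)" if "Re w > 0" for N w
      unfolding R using bounds(2)[OF that, of N] by (simp only: C_def)
    have real: "X_remainder a F N (of_real w) \<in> \<real> \<and>
             \<bar>Re (X_remainder a F N (of_real w))\<bar> \<le> \<bar>X_term a N w\<bar> \<and>
             sgn (Re (X_remainder a F N (of_real w))) = sgn (X_term a N w)" if w: "w > 0" for N and w :: real
    proof (intro conjI)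
      have r: "X_remainder a F N (of_real w) \<in> \<real>" "0 < (-1) ^ N * Re (X_remainder a F N (of_real w))"
        unfolding R using bounds(3)[OF w, of N] by blast+
      show "X_remainder a F N (of_real w) \<in> \<real>" by (rule r(1))
      have T: "X_term a N w = (-1) ^ N * (C N / w ^ (2 * N + 1))" by (simp add: X_term_def C_def)
      have Tp: "C N / w ^ (2 * N + 1) > 0" using Cpos[of N] w by simp
      have Arg0: "Arg (complex_of_real w) = 0" using w by (simp add: Arg_eq_0)
      have "\<bar>Re (X_remainder a F N (of_real w))\<bar> \<le> norm (X_remainder a F N (of_real w))" by (rule abs_Re_le_cmod)
      also have "\<dots> \<le> C N * (1 / norm (complex_of_real w) ^ (2 * N + 1)) * 1"
        using bound[of "of_real w" N] w by (simp add: Arg0 C_def)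
      also have "\<dots> = \<bar>X_term a N w\<bar>" using w Cpos[of N] unfolding T by (simp add: abs_mult)
      finally show "\<bar>Re (X_remainder a F N (of_real w))\<bar> \<le> \<bar>X_term a N w\<bar>" .
      show "sgn (Re (X_remainder a F N (of_real w))) = sgn (X_term a N w)"
      proof (cases "even N")
        case True
        have "Re (X_remainder a F N (of_real w)) > 0" using r(2) True by simp
        moreover have "X_term a N w > 0" unfolding T using Tp True by simp
        ultimately show ?thesis by (simp only: sgn_pos)
      next
        case False
        have "Re (X_remainder a F N (of_real w)) < 0" using r(2) False by simp
        moreover have "X_term a N w < 0" unfolding T using Tp False by simp
        ultimately show ?thesis by (simp only: sgn_neg)
      qed
    qed
    have "F analytic_on {w. Re w > 0}"
      using F(1) open_right_half_plane by (simp add: analytic_on_open right_half_plane_def)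
    then show ?thesis
    proof (intro conjI exI[of _ F] allI impI)
      show "F (of_real w) = of_real (phase_inverse a w)" if "w > 0" for w by (rule inv[OF that])
      show "norm (X_remainder a F N w) \<le>
               c_coeff N (1 - a) / real (2 * N + 1) * (1 / norm w ^ (2 * N + 1)) *
               (if \<bar>Arg w\<bar> \<le> pi / 4 then 1 else \<bar>1 / sin (2 * Arg w)\<bar>)" if "Re w > 0" for N w
        by (rule bound[OF that])
      show "X_remainder a F N (of_real w) \<in> \<real>"
        "\<bar>Re (X_remainder a F N (of_real w))\<bar> \<le> \<bar>X_term a N w\<bar>"
        "sgn (Re (X_remainder a F N (of_real w))) = sgn (X_term a N w)" if "w > 0" for N w
        by (rule real[OF that, THEN conjunct1] real[OF that, THEN conjunct2, THEN conjunct1]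
            real[OF that, THEN conjunct2, THEN conjunct2])+
      show "c_coeff n (1 - a) > 0" for n
        using Cpos[of n] by (simp add: C_def zero_less_divide_iff)
    qed
  qed
  have poly: "\<exists>p :: real poly. degree p = 2 * n + 1 \<and> lead_coeff p = 1 \<and> (\<forall>i. coeff p i \<in> \<rat>) \<and>
        (\<forall>a<1. c_coeff n (1 - a) = poly p (1 - a))" for n
  proof -
    obtain p :: "real poly" where p: "degree p = 2 * n + 1" "lead_coeff p = 1" "\<forall>i. coeff p i \<in> \<rat>"
      "\<forall>x>0. c_coeff n x = poly p x" using c_coeff_polynomial by blast
    have "\<forall>a<1. c_coeff n (1 - a) = poly p (1 - a)" using p(4) by simp
    with p(1-3) show ?thesis by (intro exI[of _ p] conjI)
  qed
  show ?thesis
  proof (rule conjI, goal_cases)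
    case 1
    show ?case by (rule allI, rule impI, rule conjunct1[OF main])
  next
    case 2
    show ?case
      by (rule conjI, rule allI, rule poly, rule allI, rule allI, rule impI, rule spec[OF conjunct2[OF main]])
  qed
qed

end
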